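(* Let $\theta\in\{\pi/3,\ \pi/4,\ \pi/6,\ \pi/12\}$ and consider the straight path $\Gamma_\theta:\ z=te^{\mathrm{i}\theta}$ $(t\ge 0)$ in the complex plane of time. Then the solution of the complex-valued nonlinear heat equation $$u_z=u_{xx}+u^2,\qquad x\in(0,1),$$ with periodic boundary conditions in $x$ and initial data $u(0,x)=u_0(x)=50(1-\cos(2\pi x))$, considered along the path $\Gamma_\theta$, exists globally in $t$ (i.e. for all $t\ge 0$) and converges to the zero function as $t\to\infty$.
   Context: Here $z$ is a complex time variable and the subscript $z$ denotes the complex derivative. Along $\Gamma_\theta$, with real parameter $t\ge 0$, the equation becomes $$u_t=e^{\mathrm{i}\theta}(u_{xx}+u^2),\qquad x\in(0,1),\ t\ge0,$$ with periodic boundary conditions. Writing $u(t,x)=\sum_{k\in\mathbb{Z}}a_k(t)e^{2\pi \mathrm{i}kx}$, solutions are measured in the norm $\|u(t,\cdot)\|=\sum_{k\in\mathbb{Z}}|a_k(t)|$. *)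

theory Defs
  imports "HOL-Analysis.Analysis"
begin

text \<open>
  Classical solutions of the equation u_z = u_xx + u^2, restricted to the ray
  z = t * exp (i * theta) and parametrised by the real time t, on a time interval \<open>J\<close> that contains 0.
  Periodic boundary conditions on (0,1) are expressed by working with 1-periodic
  functions on the whole real line. At the end points of \<open>J\<close> (in particular at t = 0) the time
  derivative is one-sided.
\<close>

definition heat_solution ::
    "real \<Rightarrow> (real \<Rightarrow> complex) \<Rightarrow> real set \<Rightarrow> (real \<Rightarrow> real \<Rightarrow> complex) \<Rightarrow> bool" where
  "heat_solution \<theta> u0 J u \<longleftrightarrow>
     (\<forall>x. u 0 x = u0 x) \<and>
     (\<forall>t\<in>J. \<forall>x. u t (x + 1) = u t x) \<and>
     (\<exists>u_x u_xx u_t.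
        continuous_on (J \<times> UNIV) (\<lambda>(t, x). u t x) \<and>
        continuous_on (J \<times> UNIV) (\<lambda>(t, x). u_x t x) \<and>
        continuous_on (J \<times> UNIV) (\<lambda>(t, x). u_xx t x) \<and>
        continuous_on (J \<times> UNIV) (\<lambda>(t, x). u_t t x) \<and>
        (\<forall>t\<in>J. \<forall>x::real.
           ((\<lambda>y. u t y) has_vector_derivative u_x t x) (at x) \<and>
           ((\<lambda>y. u_x t y) has_vector_derivative u_xx t x) (at x) \<and>
           ((\<lambda>s. u s x) has_vector_derivative u_t t x) (at t within J) \<and>
           u_t t x = exp (\<i> * complex_of_real \<theta>) * (u_xx t x + (u t x)\<^sup>2)))"

text \<open>
  Absolutely convergent Fourier series; absolute summability makes the coefficients unique,
  so the norm below is a function of the sum \<open>f\<close>.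
\<close>

definition has_fourier_series :: "(real \<Rightarrow> complex) \<Rightarrow> (int \<Rightarrow> complex) \<Rightarrow> bool" where
  "has_fourier_series f a \<longleftrightarrow>
     (\<lambda>k. norm (a k)) summable_on UNIV \<and>
     (\<forall>x. ((\<lambda>k. a k * exp (2 * complex_of_real pi * \<i> * of_int k * complex_of_real x))
             has_sum f x) UNIV)"

definition l1_norm :: "(int \<Rightarrow> complex) \<Rightarrow> real" where
  "l1_norm a = (\<Sum>\<^sub>\<infinity>k\<in>UNIV. norm (a k))"

definition initial_data :: "real \<Rightarrow> complex" where
  "initial_data x = complex_of_real (50 * (1 - cos (2 * pi * x)))"

end

theory Submission
  imports Defs
begin

text \<open>
  Write \<open>u(t, x) = 4 \<pi>\<^sup>2 \<Sum>\<^sub>k b\<^sub>k(4 \<pi>\<^sup>2 t) exp (2 \<pi> i k x)\<close> and \<open>\<mu> = cis \<theta>\<close>. The equation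
  becomes \<open>b\<^sub>k' = \<mu> ((b * b)\<^sub>k - k\<^sup>2 b\<^sub>k)\<close>, with \<open>Re \<mu> > 0\<close> and three nonzero modes at
  time 0. The proof follows the exact solution, with rigorous error bounds, until it enters a region
  from which it provably decays.

  The region is explicit. Constants evolve into \<open>w(t) = \<beta> / (1 - \<beta> \<mu> t)\<close>, and if the
  \<open>\<ell>\<^sup>1\<close> distance of \<open>b\<close> to a constant \<open>\<beta>\<close> is at most \<open>- Re (\<mu> \<beta>)\<close>, then its
  distance to \<open>w(t)\<close> stays at most \<open>- Re (\<mu> w(t))\<close> for all time (\<open>cone_global\<close>). On the
  real axis a positive mean only grows; along a rotated path the mean turns, passing the
  real blow-up time at a distance, until \<open>\<mu> b\<^sub>0\<close> lies in the left half plane, while the other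
  modes are damped.

  To get there one needs error bounds that do not grow too fast. If \<open>U\<close> solves the mode equations
  up to a defect of norm \<open>\<delta>\<close>, the distance \<open>\<rho>\<close> of an exact solution to \<open>U\<close> is controlled
  by \<open>\<rho>' \<ge> (2 Re (\<mu> U\<^sub>0) + 2 \<Sum>|U\<^sub>k|) \<rho> + \<rho>\<^sup>2 + \<delta>\<close>, the sum being over \<open>k \<noteq> 0\<close>. That the mean
  enters by its signed real part and not by its modulus comes from putting it into the integrating
  factor of the Picard iteration; existence and the bound are obtained together, on intervals of any
  length (\<open>picard_lim_solution\<close>). The bounds obtained for this growth rate amplify an error by a factor
  of about 17 along the whole path for angle \<open>\<pi>/3\<close> and of about 5000 for \<open>\<pi>/12\<close>, so that low
  precision suffices.

  The approximate solutions are polynomials in \<open>\<eta> = \<mu> (R t - 1)\<close> on consecutive intervals of length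
  \<open>2 / R\<close>, with Gaussian integer coefficients over a common denominator. Since \<open>|\<eta>| \<le> 1\<close>, norms are
  bounded by sums of coefficients, and since \<open>\<mu>\<close> cancels from the equation in the variable
  \<open>\<eta>\<close>, the defect has integer coefficients as well. All conditions for one step thus become
  inequalities between integers (\<open>step_ok\<close>, \<open>jump_ok\<close>), proved sound in \<open>step_sound\<close> and
  \<open>jump_sound\<close> and decided by rewriting; 5, 8, 10 and 22 steps suffice for the four angles.

  Two classical ingredients connect the modes with the equation. Smoothing gives
  \<open>|b\<^sub>k| \<le> |b\<^sub>k(0)| + C\<^sub>k / k\<^sup>2\<close> with summable \<open>C\<^sub>k\<close>, so that the Fourier series is a
  classical solution up to time 0 (\<open>mode_solution_regular\<close>, \<open>global_heat_solution\<close>); an energy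
  estimate for the difference of two solutions gives uniqueness (\<open>heat_solution_unique\<close>).
\<close>

section \<open>Absolutely summable families indexed by the integers\<close>

text \<open>
  A bound by finite partial sums says at the same time that the family is absolutely summable and
  how large its norm is, so that no summability side conditions are needed in estimates.
\<close>

definition l1_le :: "(int \<Rightarrow> complex) \<Rightarrow> real \<Rightarrow> bool" where
  "l1_le a M \<longleftrightarrow> (\<forall>F. finite F \<longrightarrow> (\<Sum>k\<in>F. norm (a k)) \<le> M)"

text \<open>
  The Fourier coefficients of a product.
\<close>

definition conv :: "(int \<Rightarrow> complex) \<Rightarrow> (int \<Rightarrow> complex) \<Rightarrow> int \<Rightarrow> complex" where
  "conv a b k = (\<Sum>\<^sub>\<infinity>j. a j * b (k - j))"

lemma l1leD: "l1_le a M \<Longrightarrow> finite F \<Longrightarrow> (\<Sum>k\<in>F. norm (a k)) \<le> M"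
  by (simp add: l1_le_def)

lemma l1_le_nonneg: "l1_le a M \<Longrightarrow> 0 \<le> M"
  using l1leD[of a M "{}"] by simp

lemma l1_le_norm: "l1_le a M \<Longrightarrow> norm (a k) \<le> M"
  using l1leD[of a M "{k}"] by simp

lemma l1_le_mono: "l1_le a M \<Longrightarrow> M \<le> N \<Longrightarrow> l1_le a N"
  unfolding l1_le_def by (meson order_trans)

lemma l1_le_summable: "l1_le a M \<Longrightarrow> (\<lambda>k. norm (a k)) summable_on UNIV"
  by (rule nonneg_bdd_above_summable_on) (auto simp: bdd_above_def l1_le_def)

lemma l1_le_infsum: "l1_le a M \<Longrightarrow> (\<Sum>\<^sub>\<infinity>k. norm (a k)) \<le> M"
  by (rule infsum_le_finite_sums) (auto simp: l1_le_summable l1leD)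

lemma l1_le_of_summable:
  assumes "\<beta> summable_on UNIV" "\<And>k. norm (a k) \<le> \<beta> k"
  shows "l1_le a (\<Sum>\<^sub>\<infinity>k. \<beta> k)"
  unfolding l1_le_def
proof (intro allI impI)
  fix F :: "int set" assume "finite F"
  have "(\<Sum>k\<in>F. norm (a k)) \<le> sum \<beta> F" using assms(2) by (rule sum_mono)
  also have "\<dots> \<le> (\<Sum>\<^sub>\<infinity>k. \<beta> k)"
    by (rule finite_sum_le_infsum) (auto simp: assms \<open>finite F\<close> intro: order_trans[OF norm_ge_zero assms(2)])
  finally show "(\<Sum>k\<in>F. norm (a k)) \<le> (\<Sum>\<^sub>\<infinity>k. \<beta> k)" .
qed

lemma l1_le_add: "l1_le a M \<Longrightarrow> l1_le b N \<Longrightarrow> l1_le (\<lambda>k. a k + b k) (M + N)"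
  unfolding l1_le_def
proof (intro allI impI)
  fix F :: "int set"
  assume *: "\<forall>F. finite F \<longrightarrow> (\<Sum>k\<in>F. norm (a k)) \<le> M" "\<forall>F. finite F \<longrightarrow> (\<Sum>k\<in>F. norm (b k)) \<le> N" "finite F"
  have "(\<Sum>k\<in>F. norm (a k + b k)) \<le> (\<Sum>k\<in>F. norm (a k) + norm (b k))"
    by (intro sum_mono norm_triangle_ineq)
  also have "\<dots> \<le> M + N" using * by (auto simp: sum.distrib intro: add_mono)
  finally show "(\<Sum>k\<in>F. norm (a k + b k)) \<le> M + N" .
qed

lemma l1_le_cmult: "l1_le a M \<Longrightarrow> l1_le (\<lambda>k. c * a k) (norm c * M)"
  by (simp add: l1_le_def norm_mult mult_left_mono flip: sum_distrib_left)

lemma l1_le_uminus: "l1_le a M \<Longrightarrow> l1_le (\<lambda>k. - a k) M"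
  by (simp add: l1_le_def)

lemma l1_le_diff: "l1_le a M \<Longrightarrow> l1_le b N \<Longrightarrow> l1_le (\<lambda>k. a k - b k) (M + N)"
  using l1_le_add[OF _ l1_le_uminus, of a M b N] by simp

lemma has_sum_finite_sum:
  fixes f :: "'i \<Rightarrow> 'a \<Rightarrow> 'b::{comm_monoid_add,topological_comm_monoid_add}"
  assumes "finite F" "\<And>i. i \<in> F \<Longrightarrow> (f i has_sum s i) A"
  shows "((\<lambda>x. \<Sum>i\<in>F. f i x) has_sum (\<Sum>i\<in>F. s i)) A"
  using assms by (induction F rule: finite_induct) (auto intro: has_sum_add)

lemma conv_abs_summable:
  assumes "l1_le a M" "l1_le b N"
  shows "(\<lambda>j. norm (a j * b (k - j))) summable_on UNIV"
proof (rule summable_on_comparison_test)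
  show "(\<lambda>j. norm (a j) * N) summable_on UNIV"
    by (intro summable_on_cmult_left l1_le_summable[OF assms(1)])
qed (auto simp: norm_mult intro!: mult_left_mono l1_le_norm[OF assms(2)])

lemma conv_summable:
  assumes "l1_le a M" "l1_le b N"
  shows "(\<lambda>j. a j * b (k - j)) summable_on UNIV"
  by (rule abs_summable_summable[OF conv_abs_summable[OF assms]])

text \<open>
  Young's inequality. Exchanging the finite sum with the series leaves, for each \<open>j\<close>, a
  partial sum of a translate of \<open>b\<close>.
\<close>

lemma l1_le_conv:
  assumes "l1_le a M" "l1_le b N"
  shows "l1_le (conv a b) (M * N)"
  unfolding l1_le_def
proof (intro allI impI)
  fix F :: "int set" assume F: "finite F"
  have "(\<Sum>k\<in>F. norm (conv a b k)) \<le> (\<Sum>k\<in>F. \<Sum>\<^sub>\<infinity>j. norm (a j * b (k - j)))"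
    unfolding conv_def by (intro sum_mono norm_infsum_bound conv_abs_summable[OF assms])
  also have "\<dots> = (\<Sum>\<^sub>\<infinity>j. \<Sum>k\<in>F. norm (a j * b (k - j)))"
    by (rule infsumI[symmetric], rule has_sum_finite_sum[OF F], rule has_sum_infsum)
       (rule conv_abs_summable[OF assms])
  also have "\<dots> \<le> (\<Sum>\<^sub>\<infinity>j. norm (a j) * N)"
  proof (rule infsum_mono)
    show "(\<lambda>j. \<Sum>k\<in>F. norm (a j * b (k - j))) summable_on UNIV"
      by (rule has_sum_imp_summable, rule has_sum_finite_sum[OF F], rule has_sum_infsum)
         (rule conv_abs_summable[OF assms])
    show "(\<lambda>j. norm (a j) * N) summable_on UNIV"
      by (intro summable_on_cmult_left l1_le_summable[OF assms(1)])
    fix j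
    have "(\<Sum>k\<in>F. norm (b (k - j))) = (\<Sum>i\<in>(\<lambda>k. k - j) ` F. norm (b i))"
      by (subst sum.reindex) (auto simp: inj_on_def)
    also have "\<dots> \<le> N" using F by (intro l1leD[OF assms(2)]) auto
    finally show "(\<Sum>k\<in>F. norm (a j * b (k - j))) \<le> norm (a j) * N"
      by (auto simp: norm_mult simp flip: sum_distrib_left intro: mult_left_mono)
  qed
  also have "\<dots> = (\<Sum>\<^sub>\<infinity>j. norm (a j)) * N"
    by (rule infsum_cmult_left) (auto intro: l1_le_summable[OF assms(1)])
  also have "\<dots> \<le> M * N"
    by (intro mult_right_mono l1_le_infsum[OF assms(1)] l1_le_nonneg[OF assms(2)])
  finally show "(\<Sum>k\<in>F. norm (conv a b k)) \<le> M * N" .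
qed

lemma conv_commute: "conv a b k = conv b a k"
  unfolding conv_def
  by (rule infsum_reindex_bij_witness[of _ "\<lambda>j. k - j" "\<lambda>j. k - j"]) auto

lemma conv_add_left:
  assumes "l1_le a M" "l1_le b N" "l1_le c R"
  shows "conv (\<lambda>k. a k + b k) c k = conv a c k + conv b c k"
  unfolding conv_def ring_distribs
  by (rule infsum_add[OF conv_summable[OF assms(1,3)] conv_summable[OF assms(2,3)]])

lemma conv_diff_left:
  assumes "l1_le a M" "l1_le b N" "l1_le c R"
  shows "conv (\<lambda>k. a k - b k) c k = conv a c k - conv b c k"
proof -
  have "conv a c k = conv (\<lambda>k. (a k - b k) + b k) c k" by simp
  also have "\<dots> = conv (\<lambda>k. a k - b k) c k + conv b c k"
    by (rule conv_add_left[OF l1_le_diff[OF assms(1,2)] assms(2,3)])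
  finally show ?thesis by simp
qed

lemma conv_diff_right:
  assumes "l1_le a M" "l1_le b N" "l1_le c R"
  shows "conv c (\<lambda>k. a k - b k) k = conv c a k - conv c b k"
  using conv_diff_left[OF assms] by (simp add: conv_commute[of c])

definition mode0 :: "complex \<Rightarrow> int \<Rightarrow> complex" where
  "mode0 c k = (if k = 0 then c else 0)"

lemma l1_le_mode0: "l1_le (mode0 c) (norm c)"
  unfolding l1_le_def mode0_def
proof (intro allI impI)
  fix F :: "int set" assume "finite F"
  thus "(\<Sum>k\<in>F. norm (if k = 0 then c else 0)) \<le> norm c"
    using sum.delta[of F 0 "\<lambda>_. norm c"] by (simp add: if_distrib[of norm] cong: if_cong)
qed

lemma conv_mode0: "conv (mode0 c) b k = c * b k"
proof -
  have "conv (mode0 c) b k = (\<Sum>\<^sub>\<infinity>j\<in>{0}. c * b (k - j))"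
    unfolding conv_def mode0_def by (rule infsum_cong_neutral) auto
  thus ?thesis by simp
qed

text \<open>
  Weierstrass' test, as needed for the modes of the nonlinearity.
\<close>

lemma continuous_on_infsum_dominated:
  fixes f :: "'i \<Rightarrow> 'a::topological_space \<Rightarrow> complex"
  assumes "\<And>i. continuous_on S (f i)" "\<And>i x. x \<in> S \<Longrightarrow> norm (f i x) \<le> \<beta> i" "\<beta> summable_on UNIV"
  shows "continuous_on S (\<lambda>x. \<Sum>\<^sub>\<infinity>i. f i x)"
proof (rule uniform_limit_theorem)
  show "uniform_limit S (\<lambda>X x. \<Sum>i\<in>X. f i x) (\<lambda>x. \<Sum>\<^sub>\<infinity>i. f i x) (finite_subsets_at_top UNIV)"
    by (rule Weierstrass_m_test_general) (use assms in auto)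
qed (auto intro!: always_eventually continuous_on_sum assms)

lemma continuous_on_conv:
  assumes "\<And>j. continuous_on S (\<lambda>t. a t j)" "\<And>t j. t \<in> S \<Longrightarrow> norm (a t j) \<le> \<beta> j" "\<beta> summable_on UNIV"
    and "\<And>j. continuous_on S (\<lambda>t. b t j)" "\<And>t. t \<in> S \<Longrightarrow> l1_le (b t) N"
  shows "continuous_on S (\<lambda>t. conv (a t) (b t) k)"
  unfolding conv_def
proof (rule continuous_on_infsum_dominated)
  show "norm (a t j * b t (k - j)) \<le> \<beta> j * N" if "t \<in> S" for t j
    unfolding norm_mult
    by (intro mult_mono assms(2) that l1_le_norm[OF assms(5)[OF that]] order_trans[OF norm_ge_zero assms(2)[OF that]]) auto
  show "(\<lambda>j. \<beta> j * N) summable_on UNIV" by (intro summable_on_cmult_left assms)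
qed (auto intro!: continuous_intros assms)

section \<open>Comparison of a diagonal linear system with a scalar supersolution\<close>

lemma Re_mult_of_int_square: "Re (\<mu> * of_int k ^ 2) = Re \<mu> * of_int k ^ 2"
proof -
  have "\<mu> * (of_int k)\<^sup>2 = complex_of_real ((of_int k)\<^sup>2) * \<mu>" by simp
  thus ?thesis by (simp only: times_complex.sel Re_complex_of_real Im_complex_of_real) simp
qed

text \<open>
  The tool behind every estimate of the solution: a linear system whose \<open>k\<close>th mode is damped
  at rate \<open>Re \<mu> k\<^sup>2\<close> and driven by the common factor \<open>\<alpha>\<close> stays below any scalar
  supersolution. Only \<open>Re \<alpha>\<close> enters, with its sign; this is where the rotation of the time axis
  helps. The sum of moduli is not differentiable, so for a fixed final time it is written as one complex
  sum with constant unimodular weights, multiplied by the integrating factor, and the mean value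
  inequality is applied to that.
\<close>

lemma l1_comparison:
  fixes y :: "real \<Rightarrow> int \<Rightarrow> complex" and A \<alpha> :: "real \<Rightarrow> complex" and \<rho> :: "real \<Rightarrow> real"
  assumes A: "\<And>t. t \<in> {0..T} \<Longrightarrow> (A has_vector_derivative \<alpha> t) (at t within {0..T})"
    and y: "\<And>k t. t \<in> {0..T} \<Longrightarrow>
      ((\<lambda>t. y t k) has_vector_derivative (\<alpha> t - \<mu> * of_int k ^ 2) * y t k + g t k) (at t within {0..T})"
    and \<mu>: "Re \<mu> \<ge> 0"
    and \<rho>: "\<And>t. t \<in> {0..T} \<Longrightarrow> (\<rho> has_real_derivative r t) (at t within {0..T})"
    and F: "finite F"
    and g: "\<And>t. t \<in> {0..T} \<Longrightarrow> (\<Sum>k\<in>F. norm (g t k)) \<le> r t - Re (\<alpha> t) * \<rho> t"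
    and init: "(\<Sum>k\<in>F. norm (y 0 k)) \<le> \<rho> 0"
    and t: "t \<in> {0..T}"
  shows "(\<Sum>k\<in>F. norm (y t k)) \<le> \<rho> t"
proof (cases "t = 0")
  case True thus ?thesis using init by simp
next
  case False
  hence t0: "0 < t" "t \<le> T" using t by auto
  \<comment> \<open>unimodular weights turn the sum of moduli at the final time into the modulus of one sum\<close>
  define \<epsilon> where "\<epsilon> k = cnj (sgn (y t k))" for k
  define I where "I = (\<lambda>k s. exp (A t - A s + \<mu> * of_int k ^ 2 * of_real (s - t)))"
  define J where "J s = exp (Re (A t) - Re (A s))" for s
  define f where "f s = (\<Sum>k\<in>F. \<epsilon> k * I k s * y s k)" for s
  define f' where "f' s = (\<Sum>k\<in>F. \<epsilon> k * I k s * g s k)" for s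
  have eps: "norm (\<epsilon> k) \<le> 1" for k by (auto simp: \<epsilon>_def norm_sgn)
  have IJ: "norm (I k s) \<le> J s" if "s \<le> t" for k s
  proof -
    have "Re \<mu> * ((of_int k)\<^sup>2 * (s - t)) \<le> 0" using \<mu> that by (intro mult_nonneg_nonpos) auto
    moreover have "Re (A t - A s + \<mu> * of_int k ^ 2 * of_real (s - t)) =
      Re (A t) - Re (A s) + Re \<mu> * ((of_int k)\<^sup>2 * (s - t))"
      using Re_mult_of_int_square[of \<mu> k] by (simp del: of_real_diff)
    ultimately show ?thesis unfolding I_def J_def norm_exp_eq_Re by simp
  qed
  have subT: "{0..t} \<subseteq> {0..T}" using t0 by auto
  have A': "(A has_vector_derivative \<alpha> s) (at s within {0..t})" if "s \<in> {0..t}" for s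
    by (rule has_vector_derivative_within_subset[OF A subT]) (use that t0 in auto)
  have y': "((\<lambda>t. y t k) has_vector_derivative (\<alpha> s - \<mu> * of_int k ^ 2) * y s k + g s k) (at s within {0..t})"
    if "s \<in> {0..t}" for s k
    by (rule has_vector_derivative_within_subset[OF y subT]) (use that t0 in auto)
  have \<rho>': "(\<rho> has_real_derivative r s) (at s within {0..t})" if "s \<in> {0..t}" for s
    by (rule has_field_derivative_subset[OF \<rho> subT]) (use that t0 in auto)
  have dI: "(I k has_vector_derivative (- (\<alpha> s) + \<mu> * of_int k ^ 2) * I k s) (at s within {0..t})"
    if "s \<in> {0..t}" for s k
  proof -
    have "((\<lambda>s. A t - A s + \<mu> * of_int k ^ 2 * of_real (s - t)) has_vector_derivative
        (- (\<alpha> s) + \<mu> * of_int k ^ 2)) (at s within {0..t})"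
      by (auto intro!: derivative_eq_intros A'[OF that])
    from field_vector_diff_chain_within[OF this DERIV_subset[OF DERIV_exp subset_UNIV]]
    show ?thesis by (simp add: I_def o_def)
  qed
  have df: "(f has_vector_derivative f' s) (at s within {0..t})" if "s \<in> {0..t}" for s
    unfolding f_def f'_def
    by (rule has_vector_derivative_eq_rhs, rule has_vector_derivative_sum,
        rule has_vector_derivative_mult[OF has_vector_derivative_mult_right[OF dI[OF that]] y'[OF that]])
       (simp add: algebra_simps)
  have dA: "((\<lambda>s. Re (A s)) has_real_derivative Re (\<alpha> s)) (at s within {0..t})" if "s \<in> {0..t}" for s
    using bounded_linear.has_vector_derivative[OF bounded_linear_Re A'[OF that]]
    by (simp add: has_real_derivative_iff_has_vector_derivative)
  have dJ: "((\<lambda>s. J s * \<rho> s) has_real_derivative J s * (r s - Re (\<alpha> s) * \<rho> s)) (at s within {0..t})" if "s \<in> {0..t}" for s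
  proof -
    define a where "a = (\<lambda>s. Re (A s))"
    have a: "(a has_real_derivative Re (\<alpha> s)) (at s within {0..t})" using dA[OF that] by (simp add: a_def)
    have "((\<lambda>s. exp (a t - a s) * \<rho> s) has_real_derivative exp (a t - a s) * (r s - Re (\<alpha> s) * \<rho> s)) (at s within {0..t})"
      by (auto intro!: derivative_eq_intros a \<rho>'[OF that] simp: algebra_simps)
    thus ?thesis by (simp add: a_def J_def)
  qed
  have "norm (f t - f 0) \<le> J t * \<rho> t - J 0 * \<rho> 0"
  proof (rule differentiable_bound_general[where f' = f' and \<phi> = "\<lambda>s. J s * \<rho> s" and \<phi>' = "\<lambda>s. J s * (r s - Re (\<alpha> s) * \<rho> s)"])
    show "continuous_on {0..t} f" by (rule continuous_on_vector_derivative[OF df])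
    show "continuous_on {0..t} (\<lambda>s. J s * \<rho> s)" by (rule DERIV_continuous_on[OF dJ])
    fix s assume s: "0 < s" "s < t"
    show "(f has_vector_derivative f' s) (at s)"
      using df[of s] s by (simp add: at_within_Icc_at)
    show "((\<lambda>s. J s * \<rho> s) has_vector_derivative J s * (r s - Re (\<alpha> s) * \<rho> s)) (at s)"
      using dJ[of s] s by (simp add: at_within_Icc_at has_real_derivative_iff_has_vector_derivative)
    have "norm (f' s) \<le> (\<Sum>k\<in>F. norm (\<epsilon> k * I k s * g s k))" unfolding f'_def by (rule norm_sum)
    also have "\<dots> \<le> (\<Sum>k\<in>F. 1 * J s * norm (g s k))"
      unfolding norm_mult by (intro sum_mono mult_right_mono mult_mono eps IJ) (use s in auto)
    also have "\<dots> = J s * (\<Sum>k\<in>F. norm (g s k))" by (simp add: sum_distrib_left)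
    also have "\<dots> \<le> J s * (r s - Re (\<alpha> s) * \<rho> s)"
      by (intro mult_left_mono g) (use s t0 in \<open>auto simp: J_def\<close>)
    finally show "norm (f' s) \<le> J s * (r s - Re (\<alpha> s) * \<rho> s)" .
  qed (use t0 in auto)
  moreover have "norm (f 0) \<le> J 0 * \<rho> 0"
  proof -
    have "norm (f 0) \<le> (\<Sum>k\<in>F. norm (\<epsilon> k * I k 0 * y 0 k))" unfolding f_def by (rule norm_sum)
    also have "\<dots> \<le> (\<Sum>k\<in>F. 1 * J 0 * norm (y 0 k))"
      unfolding norm_mult by (intro sum_mono mult_right_mono mult_mono eps IJ) (use t0 in auto)
    also have "\<dots> = J 0 * (\<Sum>k\<in>F. norm (y 0 k))" by (simp add: sum_distrib_left)
    also have "\<dots> \<le> J 0 * \<rho> 0" by (intro mult_left_mono init) (auto simp: J_def)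
    finally show ?thesis .
  qed
  moreover have "f t = of_real (\<Sum>k\<in>F. norm (y t k))"
  proof -
    have "cnj (sgn z) * z = of_real (norm z)" for z :: complex
      by (cases "z = 0") (simp_all add: sgn_div_norm scaleR_conv_of_real mult.commute[of "cnj z"] complex_norm_square[symmetric] power2_eq_square field_simps)
    thus ?thesis by (simp add: f_def \<epsilon>_def I_def)
  qed
  moreover have "norm (f t) \<le> norm (f t - f 0) + norm (f 0)"
    by (metis diff_add_cancel norm_triangle_ineq)
  moreover have "J t = 1" by (simp add: J_def)
  ultimately have "\<bar>\<Sum>k\<in>F. norm (y t k)\<bar> \<le> \<rho> t" by (simp only: norm_of_real)
  thus ?thesis by linarith
qed

section \<open>Exact solutions near approximate solutions\<close>

text \<open>
  The gain of two derivatives from the heat semigroup, as a summable sequence; the summand 1 in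
  the denominator treats the undamped zero mode along with the others.
\<close>

lemma summable_inverse_square_int:
  assumes "\<gamma> > 0"
  shows "(\<lambda>k::int. 1 / (1 + \<gamma> * of_int k ^ 2) :: real) summable_on UNIV"
proof -
  have s: "summable (\<lambda>n::nat. 1 / (1 + \<gamma> * of_nat n ^ 2))"
  proof (rule summable_comparison_test')
    show "summable (\<lambda>n. 1 / \<gamma> * (1 / of_nat n ^ 2))"
      by (rule summable_mult) (use inverse_power_summable[of 2, where 'a = real] in \<open>simp add: inverse_eq_divide\<close>)
    show "norm (1 / (1 + \<gamma> * (of_nat n)\<^sup>2)) \<le> 1 / \<gamma> * (1 / of_nat n ^ 2)" if "n \<ge> 1" for n
      using assms that by (auto simp: field_simps add_pos_nonneg)
  qed
  have n: "(\<lambda>n::nat. 1 / (1 + \<gamma> * of_nat n ^ 2) :: real) summable_on UNIV"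
    using s assms by (subst summable_on_UNIV_nonneg_real_iff) (auto intro!: add_nonneg_nonneg divide_nonneg_nonneg)
  have i1: "(\<lambda>k::int. 1 / (1 + \<gamma> * of_int k ^ 2) :: real) summable_on range int"
    using n by (subst summable_on_reindex) (auto simp: o_def)
  have i2: "(\<lambda>k::int. 1 / (1 + \<gamma> * of_int k ^ 2) :: real) summable_on range (\<lambda>n. - int n)"
    using n by (subst summable_on_reindex) (auto simp: o_def inj_on_def)
  have "(UNIV :: int set) = range int \<union> range (\<lambda>n. - int n)"
    by (auto simp: image_iff) (metis int_cases2)
  thus ?thesis using summable_on_union[OF i1 i2] by simp
qed

text \<open>
  The equation for the Fourier modes in units where the Laplacian acts as \<open>- k\<^sup>2\<close>. The
  common summable bound makes the convolution continuous in time.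
\<close>

definition mode_solution :: "complex \<Rightarrow> real \<Rightarrow> (real \<Rightarrow> int \<Rightarrow> complex) \<Rightarrow> bool" where
  "mode_solution \<mu> T b \<longleftrightarrow>
     (\<exists>\<beta>. \<beta> summable_on UNIV \<and> (\<forall>t\<in>{0..T}. \<forall>k. norm (b t k) \<le> \<beta> k)) \<and>
     (\<forall>k. \<forall>t\<in>{0..T}. ((\<lambda>t. b t k) has_vector_derivative
        \<mu> * (conv (b t) (b t) k - of_int k ^ 2 * b t k)) (at t within {0..T}))"

text \<open>
  Twice the integrated mean of \<open>U\<close>: \<open>exp (phase \<mu> U t)\<close> is the integrating factor for the
  part of the linearisation at \<open>U\<close> that acts on all modes alike.
\<close>

definition phase :: "complex \<Rightarrow> (real \<Rightarrow> int \<Rightarrow> complex) \<Rightarrow> real \<Rightarrow> complex" where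
  "phase \<mu> U t = integral {0..t} (\<lambda>s. 2 * \<mu> * U s 0)"

text \<open>
  The Picard map, with the mean of \<open>U\<close> moved into the integrating factor. Keeping
  \<open>2 U\<^sub>0 a\<^sub>k\<close> on the linear side preserves the sign of its real part, which an estimate by
  moduli would lose.
\<close>

definition duhamel where
  "duhamel \<mu> U a0 a t k = exp (phase \<mu> U t - \<mu> * of_int k ^ 2 * of_real t) *
     (a0 k + integral {0..t} (\<lambda>s. exp (\<mu> * of_int k ^ 2 * of_real s - phase \<mu> U s) *
        (\<mu> * (conv (a s) (a s) k - 2 * U s 0 * a s k))))"

primrec picard where
  "picard \<mu> U a0 0 = U"
| "picard \<mu> U a0 (Suc n) = duhamel \<mu> U a0 (picard \<mu> U a0 n)"

text \<open>
  Defined without reference to the length of the time interval, so that the solutions obtained on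
  different intervals agree.
\<close>

definition picard_lim where
  "picard_lim \<mu> U a0 t k = lim (\<lambda>n. picard \<mu> U a0 n t k)"

lemma l1_le_limit:
  assumes "\<And>k. (\<lambda>n. a n k) \<longlonglongrightarrow> b k" "\<And>n. n \<ge> N \<Longrightarrow> l1_le (a n) M"
  shows "l1_le b M"
  unfolding l1_le_def
proof (intro allI impI)
  fix F :: "int set" assume F: "finite F"
  have "(\<lambda>n. \<Sum>k\<in>F. norm (a n k)) \<longlonglongrightarrow> (\<Sum>k\<in>F. norm (b k))"
    by (intro tendsto_sum tendsto_norm assms)
  thus "(\<Sum>k\<in>F. norm (b k)) \<le> M"
    by (rule tendsto_upperbound) (use assms(2) l1leD[OF _ F] in \<open>auto simp: eventually_sequentially\<close>)
qed

lemma l1_le_triangle: "l1_le (\<lambda>k. a k - b k) M \<Longrightarrow> l1_le (\<lambda>k. b k - c k) N \<Longrightarrow> l1_le (\<lambda>k. a k - c k) (M + N)"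
  using l1_le_add[of "\<lambda>k. a k - b k" M "\<lambda>k. b k - c k" N] by simp

text \<open>
  An approximate solution \<open>U\<close> with defect \<open>d\<close> and a radius \<open>\<rho>\<close>. The last
  assumption says that \<open>\<rho>\<close> is a supersolution of the differential inequality for the
  \<open>\<ell>\<^sup>1\<close> distance of an exact solution to \<open>U\<close>: the mean of \<open>U\<close> acts through its
  real part, the other modes act through their total size \<open>W\<close>, and \<open>\<rho>\<^sup>2\<close> is the
  contribution of the square of the difference.
\<close>

locale tube =
  fixes \<mu> :: complex and T :: real and U d :: "real \<Rightarrow> int \<Rightarrow> complex"
    and \<rho> r W \<delta> :: "real \<Rightarrow> real" and \<upsilon> :: "int \<Rightarrow> real" and a0 :: "int \<Rightarrow> complex"
  assumes mu: "norm \<mu> = 1" "Re \<mu> > 0" and T: "T \<ge> 0"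
    and U: "\<And>t k. t \<in> {0..T} \<Longrightarrow> ((\<lambda>t. U t k) has_vector_derivative
        \<mu> * (conv (U t) (U t) k - of_int k ^ 2 * U t k) + d t k) (at t within {0..T})"
    and U_dom: "\<And>t k. t \<in> {0..T} \<Longrightarrow> norm (U t k) \<le> \<upsilon> k" "\<upsilon> summable_on UNIV"
    and rho: "\<And>t. t \<in> {0..T} \<Longrightarrow> (\<rho> has_real_derivative r t) (at t within {0..T})"
    and rho_nonneg: "\<And>t. t \<in> {0..T} \<Longrightarrow> \<rho> t \<ge> 0"
    and init: "l1_le (\<lambda>k. a0 k - U 0 k) (\<rho> 0)"
    and W: "\<And>t. t \<in> {0..T} \<Longrightarrow> l1_le (\<lambda>k. if k = 0 then 0 else U t k) (W t)"
    and \<delta>: "\<And>t. t \<in> {0..T} \<Longrightarrow> l1_le (d t) (\<delta> t)"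
    and super: "\<And>t. t \<in> {0..T} \<Longrightarrow> (2 * Re (\<mu> * U t 0) + 2 * W t) * \<rho> t + \<rho> t ^ 2 + \<delta> t \<le> r t"
begin

abbreviation "\<alpha> t \<equiv> 2 * \<mu> * U t 0"
abbreviation "\<Phi> \<equiv> duhamel \<mu> U a0"
abbreviation "P \<equiv> picard \<mu> U a0"
abbreviation "B \<equiv> picard_lim \<mu> U a0"

definition in_tube where
  "in_tube a \<longleftrightarrow> (\<forall>k. continuous_on {0..T} (\<lambda>t. a t k)) \<and>
     (\<exists>\<beta>. \<beta> summable_on UNIV \<and> (\<forall>t\<in>{0..T}. \<forall>k. norm (a t k) \<le> \<beta> k)) \<and>
     (\<forall>t\<in>{0..T}. l1_le (\<lambda>k. a t k - U t k) (\<rho> t))"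

lemma U_cont: "continuous_on {0..T} (\<lambda>t. U t k)"
  by (rule continuous_on_vector_derivative[OF U])

lemma in_tube_U: "in_tube U"
  unfolding in_tube_def
proof (intro conjI exI[of _ \<upsilon>] ballI allI)
  show "l1_le (\<lambda>k. U t k - U t k) (\<rho> t)" if "t \<in> {0..T}" for t
    using rho_nonneg[OF that] by (simp add: l1_le_def)
qed (use U_cont U_dom in auto)

text \<open>
  One bound for all functions in the tube, so that constants do not depend on the iterate.
\<close>

lemma bound_ex:
  "\<exists>M\<ge>0. (\<forall>t\<in>{0..T}. \<rho> t \<le> M \<and> l1_le (U t) M) \<and> (\<forall>a. in_tube a \<longrightarrow> (\<forall>t\<in>{0..T}. l1_le (a t) M))"
proof -
  have "compact (\<rho> ` {0..T})"
    by (rule compact_continuous_image[OF DERIV_continuous_on[OF rho]]) auto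
  hence "bdd_above (\<rho> ` {0..T})" by (intro bounded_imp_bdd_above compact_imp_bounded)
  then obtain R where "\<forall>t\<in>{0..T}. \<rho> t \<le> R" by (auto simp: bdd_above_def)
  hence R: "\<rho> t \<le> R" if "t \<in> {0..T}" for t using that by blast
  define S where "S = (\<Sum>\<^sub>\<infinity>k. \<upsilon> k)"
  have U1: "l1_le (U t) S" if "t \<in> {0..T}" for t
    unfolding S_def by (rule l1_le_of_summable[OF U_dom(2) U_dom(1)[OF that]])
  have S0: "S \<ge> 0" using l1_le_nonneg[OF U1[of 0]] T by auto
  have R0: "R \<ge> 0" using R[of 0] rho_nonneg[of 0] T by auto
  have "l1_le (a t) (R + S)" if "in_tube a" "t \<in> {0..T}" for a t
  proof -
    have "l1_le (\<lambda>k. a t k - U t k) R"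
      by (rule l1_le_mono[OF _ R[OF that(2)]]) (use that in \<open>simp add: in_tube_def\<close>)
    from l1_le_add[OF this U1[OF that(2)]] show ?thesis by simp
  qed
  moreover have "\<rho> t \<le> R + S" "l1_le (U t) (R + S)" if "t \<in> {0..T}" for t
    using R[OF that] l1_le_mono[OF U1[OF that], of "R+S"] R0 S0 by auto
  ultimately show ?thesis using R0 S0 by (intro exI[of _ "R + S"]) auto
qed

definition M where "M = (SOME M. M \<ge> 0 \<and> (\<forall>t\<in>{0..T}. \<rho> t \<le> M \<and> l1_le (U t) M) \<and>
    (\<forall>a. in_tube a \<longrightarrow> (\<forall>t\<in>{0..T}. l1_le (a t) M)))"

lemma M: "M \<ge> 0" "t \<in> {0..T} \<Longrightarrow> \<rho> t \<le> M" "t \<in> {0..T} \<Longrightarrow> l1_le (U t) M"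
    "in_tube a \<Longrightarrow> t \<in> {0..T} \<Longrightarrow> l1_le (a t) M"
  using someI_ex[OF bound_ex, folded M_def] by auto

lemma phase_deriv:
  assumes "t \<in> {0..T}"
  shows "(phase \<mu> U has_vector_derivative \<alpha> t) (at t within {0..T})"
  unfolding phase_def
  by (rule integral_has_vector_derivative[OF _ assms]) (intro continuous_intros U_cont)

lemma phase_cont: "continuous_on {0..T} (phase \<mu> U)"
  by (rule continuous_on_vector_derivative[OF phase_deriv])

lemma Re_alpha_le: "t \<in> {0..T} \<Longrightarrow> Re (\<alpha> t) \<le> 2 * M"
proof -
  assume t: "t \<in> {0..T}"
  have "Re (\<alpha> t) \<le> norm (\<alpha> t)" by (rule complex_Re_le_cmod)
  also have "\<dots> \<le> 2 * M" using l1_le_norm[OF M(3)[OF t], of 0] mu by (simp add: norm_mult)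
  finally show ?thesis .
qed

lemma conv_cont:
  assumes "in_tube a" shows "continuous_on {0..T} (\<lambda>t. conv (a t) (a t) k)"
proof -
  obtain \<beta> where \<beta>: "\<beta> summable_on UNIV" "\<And>t k. t\<in>{0..T} \<Longrightarrow> norm (a t k) \<le> \<beta> k"
    and c: "\<And>k. continuous_on {0..T} (\<lambda>t. a t k)"
    using assms unfolding in_tube_def by blast
  show ?thesis by (rule continuous_on_conv[OF c \<beta>(2) \<beta>(1) c M(4)[OF assms]])
qed

lemma duhamel_deriv:
  assumes a: "in_tube a" and t: "t \<in> {0..T}"
  shows "((\<lambda>t. \<Phi> a t k) has_vector_derivative
     (\<alpha> t - \<mu> * of_int k ^ 2) * \<Phi> a t k + \<mu> * (conv (a t) (a t) k - 2 * U t 0 * a t k)) (at t within {0..T})"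
proof -
  define f where "f s = \<mu> * (conv (a s) (a s) k - 2 * U s 0 * a s k)" for s
  define E where "E = (\<lambda>t. exp (phase \<mu> U t - \<mu> * of_int k ^ 2 * of_real t))"
  define E' where "E' = (\<lambda>s. exp (\<mu> * of_int k ^ 2 * of_real s - phase \<mu> U s))"
  have EE: "E t * E' t = 1" by (simp add: E_def E'_def flip: exp_add)
  have "continuous_on {0..T} (\<lambda>s. E' s * f s)"
    unfolding f_def E'_def using a
    by (auto intro!: continuous_intros conv_cont phase_cont U_cont simp: in_tube_def)
  hence i: "((\<lambda>t. integral {0..t} (\<lambda>s. E' s * f s)) has_vector_derivative E' t * f t) (at t within {0..T})"
    using t by (rule integral_has_vector_derivative)
  have "((\<lambda>t. phase \<mu> U t - \<mu> * of_int k ^ 2 * of_real t) has_vector_derivative (\<alpha> t - \<mu> * of_int k ^ 2)) (at t within {0..T})"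
    by (auto intro!: derivative_eq_intros phase_deriv t)
  from field_vector_diff_chain_within[OF this DERIV_subset[OF DERIV_exp subset_UNIV]]
  have e: "(E has_vector_derivative (\<alpha> t - \<mu> * of_int k ^ 2) * E t) (at t within {0..T})"
    by (simp add: E_def o_def)
  define I where "I = (\<lambda>t. a0 k + integral {0..t} (\<lambda>s. E' s * f s))"
  have I: "(I has_vector_derivative E' t * f t) (at t within {0..T})"
    unfolding I_def using has_vector_derivative_add[OF has_vector_derivative_const i] by simp
  have "((\<lambda>t. E t * I t) has_vector_derivative
     E t * (E' t * f t) + (\<alpha> t - \<mu> * of_int k ^ 2) * E t * I t) (at t within {0..T})"
    by (rule has_vector_derivative_mult[OF e I])
  moreover have "E t * (E' t * f t) = f t" using EE by (simp flip: mult.assoc)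
  moreover have "(\<lambda>t. \<Phi> a t k) = (\<lambda>t. E t * I t)"
    by (auto simp: duhamel_def E_def E'_def f_def I_def)
  ultimately have "((\<lambda>t. \<Phi> a t k) has_vector_derivative
     f t + (\<alpha> t - \<mu> * of_int k ^ 2) * \<Phi> a t k) (at t within {0..T})"
    by (simp add: fun_eq_iff mult.assoc)
  thus ?thesis by (simp only: f_def add.commute)
qed

lemma duhamel_0: "\<Phi> a 0 k = a0 k"
  by (simp add: duhamel_def phase_def)

text \<open>
  The tube is mapped into itself. Subtracting the equation of \<open>U\<close>, the square of \<open>a\<close>
  leaves \<open>h * h + 2 V * h\<close>, where \<open>h = a - U\<close> and \<open>V\<close> is \<open>U\<close> without its
  mean.
\<close>

lemma duhamel_tube:
  assumes a: "in_tube a" and t: "t \<in> {0..T}"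
  shows "l1_le (\<lambda>k. \<Phi> a t k - U t k) (\<rho> t)"
  unfolding l1_le_def
proof (intro allI impI)
  fix F :: "int set" assume F: "finite F"
  define g where "g s k = \<mu> * (conv (a s) (a s) k - conv (U s) (U s) k - 2 * U s 0 * (a s k - U s k)) - d s k" for s k
  show "(\<Sum>k\<in>F. norm (\<Phi> a t k - U t k)) \<le> \<rho> t"
  proof (rule l1_comparison[OF phase_deriv _ _ rho F _ _ t, where y = "\<lambda>t k. \<Phi> a t k - U t k" and g = g and \<mu> = \<mu>])
    fix k s assume s: "s \<in> {0..T}"
    show "((\<lambda>t. \<Phi> a t k - U t k) has_vector_derivative
         (\<alpha> s - \<mu> * (of_int k)\<^sup>2) * (\<Phi> a s k - U s k) + g s k) (at s within {0..T})"
      by (rule has_vector_derivative_eq_rhs, rule has_vector_derivative_diff[OF duhamel_deriv[OF a s] U[OF s]])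
         (simp add: g_def algebra_simps)
  next
    fix s assume s: "s \<in> {0..T}"
    define h where "h = (\<lambda>k. a s k - U s k)"
    define V where "V = (\<lambda>k. if k = 0 then 0 else U s k)"
    have h: "l1_le h (\<rho> s)" using a s by (auto simp: in_tube_def h_def)
    have V: "l1_le V (W s)" using W[OF s] by (simp add: V_def)
    note aM = M(4)[OF a s] and UM = M(3)[OF s]
    have "g s k = \<mu> * (conv h h k + 2 * conv V h k) - d s k" for k
    proof -
      have c1: "conv (a s) (a s) k = conv (U s) (U s) k + conv h (a s) k + conv (U s) h k"
        unfolding h_def using conv_diff_left[OF aM UM aM] conv_diff_right[OF aM UM UM] by simp
      have c2: "conv h (a s) k = conv h h k + conv (U s) h k"
        using conv_diff_right[OF aM UM h] by (simp add: h_def conv_commute[of "U s"])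
      have c3: "conv V h k = conv (U s) h k - U s 0 * h k"
      proof -
        have "V = (\<lambda>k. U s k - mode0 (U s 0) k)" by (auto simp: V_def mode0_def)
        thus ?thesis using conv_diff_left[OF UM l1_le_mode0 h] by (simp add: conv_mode0)
      qed
      have "g s k = \<mu> * (conv (a s) (a s) k - conv (U s) (U s) k - 2 * U s 0 * h k) - d s k"
        by (simp add: g_def h_def)
      thus ?thesis by (simp add: c1 c2 c3 algebra_simps)
    qed
    moreover have "l1_le (\<lambda>k. \<mu> * (conv h h k + 2 * conv V h k) - d s k) (norm \<mu> * (\<rho> s * \<rho> s + norm (2::complex) * (W s * \<rho> s)) + \<delta> s)"
      by (intro l1_le_diff l1_le_cmult l1_le_add l1_le_conv h V \<delta> s)
    ultimately have "(\<Sum>k\<in>F. norm (g s k)) \<le> \<rho> s * \<rho> s + 2 * (W s * \<rho> s) + \<delta> s"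
      using mu F by (simp add: l1_le_def)
    also have "\<dots> \<le> r s - Re (\<alpha> s) * \<rho> s"
      using super[OF s] by (simp add: algebra_simps power2_eq_square)
    finally show "(\<Sum>k\<in>F. norm (g s k)) \<le> r s - Re (\<alpha> s) * \<rho> s" .
  next
    show "(\<Sum>k\<in>F. norm (\<Phi> a 0 k - U 0 k)) \<le> \<rho> 0" using init F by (simp add: duhamel_0 l1_le_def)
  qed (use mu in auto)
qed

text \<open>
  One smoothing step turns a uniform \<open>\<ell>\<^sup>1\<close> bound into a summable bound of the
  individual modes, the same for all functions in the tube. The supersolution is
  \<open>exp ((2 M + 1) t) (|a0\<^sub>k| + C / (1 + Re \<mu> k\<^sup>2))\<close>.
\<close>

lemma duhamel_dom:
  "\<exists>\<beta>. \<beta> summable_on UNIV \<and> (\<forall>a. in_tube a \<longrightarrow> (\<forall>t\<in>{0..T}. \<forall>k. norm (\<Phi> a t k) \<le> \<beta> k))"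
proof -
  define C where "C = M * M + 2 * M * M"
  define w where "w k = 1 / (1 + Re \<mu> * of_int k ^ 2)" for k :: int
  define \<beta> where "\<beta> k = exp ((2 * M + 1) * T) * (norm (a0 k) + C * w k)" for k
  have C0: "C \<ge> 0" using M(1) by (simp add: C_def)
  have w0: "0 < 1 + Re \<mu> * of_int k ^ 2" for k :: int using mu by (auto intro: add_pos_nonneg)
  have wpos: "w k > 0" for k using w0[of k] by (simp add: w_def)
  have "l1_le (\<lambda>k. (a0 k - U 0 k) + U 0 k) (\<rho> 0 + M)" using T by (intro l1_le_add init M(3)) auto
  hence "(\<lambda>k. norm (a0 k)) summable_on UNIV" using l1_le_summable by simp
  hence "\<beta> summable_on UNIV"
    unfolding \<beta>_def w_def
    by (intro summable_on_cmult_right summable_on_add summable_inverse_square_int mu(2))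
  moreover have "norm (\<Phi> a t k) \<le> \<beta> k" if a: "in_tube a" and t: "t \<in> {0..T}" for a t k
  proof -
    let ?\<phi> = "\<lambda>t. exp ((2 * M + 1) * t) * (norm (a0 k) + C * w k)"
    define g where "g s = \<mu> * (conv (a s) (a s) k - 2 * U s 0 * a s k)" for s
    have "(\<Sum>j\<in>{k}. norm (\<Phi> a t k)) \<le> ?\<phi> t"
    proof (rule l1_comparison[where y = "\<lambda>t j. \<Phi> a t k" and A = "\<lambda>t. phase \<mu> U t - \<mu> * of_int k ^ 2 * of_real t"
          and \<alpha> = "\<lambda>t. \<alpha> t - \<mu> * of_int k ^ 2" and \<mu> = 0 and g = "\<lambda>s j. g s" and T = T
          and r = "\<lambda>t. (2 * M + 1) * ?\<phi> t"])
      fix s assume s: "s \<in> {0..T}"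
      show "((\<lambda>t. phase \<mu> U t - \<mu> * (of_int k)\<^sup>2 * of_real t) has_vector_derivative \<alpha> s - \<mu> * (of_int k)\<^sup>2) (at s within {0..T})"
        by (auto intro!: derivative_eq_intros phase_deriv s)
      show "(?\<phi> has_real_derivative (2 * M + 1) * ?\<phi> s) (at s within {0..T})"
        by (auto intro!: derivative_eq_intros)
      show "((\<lambda>t. \<Phi> a t k) has_vector_derivative (\<alpha> s - \<mu> * (of_int k)\<^sup>2 - 0 * (of_int j)\<^sup>2) * \<Phi> a s k + g s) (at s within {0..T})" for j
        using duhamel_deriv[OF a s] by (simp add: g_def)
      have "norm (g s) \<le> norm (conv (a s) (a s) k) + norm (2 * U s 0 * a s k)"
        unfolding g_def norm_mult[of \<mu>] mu mult_1 by (rule norm_triangle_ineq4)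
      also have "\<dots> \<le> M * M + 2 * (M * M)"
        unfolding norm_mult mult.assoc using M(1)
        by (intro add_mono l1_le_norm[OF l1_le_conv] mult_mono l1_le_norm[OF M(4)[OF a s]] l1_le_norm[OF M(3)[OF s]] M(4)[OF a s] mult_nonneg_nonneg) auto
      also have "\<dots> = C" by (simp add: C_def)
      also have "C = (1 + Re \<mu> * of_int k ^ 2) * (1 * (C * w k))" using w0[of k] by (simp add: w_def)
      also have "\<dots> \<le> (1 + Re \<mu> * of_int k ^ 2) * ?\<phi> s"
        using w0[of k] C0 wpos[of k] M(1) s by (intro mult_left_mono mult_mono) auto
      also have "\<dots> \<le> ((2 * M + 1) - Re (\<alpha> s) + Re \<mu> * of_int k ^ 2) * ?\<phi> s"
        using Re_alpha_le[OF s] C0 wpos[of k] by (intro mult_right_mono) (auto intro!: mult_nonneg_nonneg add_nonneg_nonneg simp: less_imp_le)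
      also have "\<dots> = (2 * M + 1) * ?\<phi> s - Re (\<alpha> s - \<mu> * (of_int k)\<^sup>2) * ?\<phi> s"
        using Re_mult_of_int_square[of \<mu> k] by (simp add: algebra_simps)
      finally show "(\<Sum>j\<in>{k}. norm (g s)) \<le> (2 * M + 1) * ?\<phi> s - Re (\<alpha> s - \<mu> * (of_int k)\<^sup>2) * ?\<phi> s" by simp
    next
      show "(\<Sum>j\<in>{k}. norm (\<Phi> a 0 k)) \<le> ?\<phi> 0" using C0 wpos[of k] by (simp add: duhamel_0)
    qed (use t in auto)
    also have "\<dots> \<le> \<beta> k"
      unfolding \<beta>_def using t M(1) C0 wpos[of k] by (intro mult_right_mono) (auto intro!: mult_left_mono add_nonneg_nonneg mult_nonneg_nonneg simp: less_imp_le)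
    finally show ?thesis by simp
  qed
  ultimately show ?thesis by blast
qed

lemma in_tube_duhamel: "in_tube a \<Longrightarrow> in_tube (\<Phi> a)"
proof -
  assume a: "in_tube a"
  obtain \<beta> where "\<beta> summable_on UNIV" "\<forall>t\<in>{0..T}. \<forall>k. norm (\<Phi> a t k) \<le> \<beta> k"
    using duhamel_dom a by blast
  thus ?thesis unfolding in_tube_def
    using duhamel_tube[OF a] continuous_on_vector_derivative[OF duhamel_deriv[OF a]] by blast
qed

lemma in_tube_picard: "in_tube (P n)"
  by (induction n) (auto intro: in_tube_U in_tube_duhamel)

text \<open>
  The Lipschitz constant of the forcing on the tube is at most \<open>4 M\<close> and the linear growth
  rate at most \<open>2 M\<close>; with weight \<open>exp (10 M t)\<close> the Picard map halves distances, on an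
  interval of any length.
\<close>

definition L where "L = 10 * M"

lemma duhamel_contract:
  assumes a: "in_tube a" "in_tube a'" and c: "c \<ge> 0"
    and le: "\<And>t. t \<in> {0..T} \<Longrightarrow> l1_le (\<lambda>k. a t k - a' t k) (c * exp (L * t))"
    and t: "t \<in> {0..T}"
  shows "l1_le (\<lambda>k. \<Phi> a t k - \<Phi> a' t k) (c / 2 * exp (L * t))"
  unfolding l1_le_def
proof (intro allI impI)
  fix F :: "int set" assume F: "finite F"
  define g where "g s k = \<mu> * (conv (a s) (a s) k - conv (a' s) (a' s) k - 2 * U s 0 * (a s k - a' s k))" for s k
  show "(\<Sum>k\<in>F. norm (\<Phi> a t k - \<Phi> a' t k)) \<le> c / 2 * exp (L * t)"
  proof (rule l1_comparison[OF phase_deriv _ _ _ F _ _ t, where y = "\<lambda>t k. \<Phi> a t k - \<Phi> a' t k" and g = g and \<mu> = \<mu>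
        and \<rho> = "\<lambda>t. c / 2 * exp (L * t)" and r = "\<lambda>t. L * (c / 2 * exp (L * t))"])
    fix k s assume s: "s \<in> {0..T}"
    show "((\<lambda>t. \<Phi> a t k - \<Phi> a' t k) has_vector_derivative
         (\<alpha> s - \<mu> * (of_int k)\<^sup>2) * (\<Phi> a s k - \<Phi> a' s k) + g s k) (at s within {0..T})"
      by (rule has_vector_derivative_eq_rhs, rule has_vector_derivative_diff[OF duhamel_deriv[OF a(1) s] duhamel_deriv[OF a(2) s]])
         (simp add: g_def algebra_simps)
  next
    fix s assume s: "s \<in> {0..T}"
    show "((\<lambda>t. c / 2 * exp (L * t)) has_real_derivative L * (c / 2 * exp (L * s))) (at s within {0..T})"
      by (auto intro!: derivative_eq_intros)
    let ?\<psi> = "c * exp (L * s)"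
    define h where "h = (\<lambda>k. a s k - a' s k)"
    have h: "l1_le h ?\<psi>" using le[OF s] by (simp add: h_def)
    note aM = M(4)[OF a(1) s] and aM' = M(4)[OF a(2) s]
    have "g s k = \<mu> * (conv h (a s) k + conv (a' s) h k - 2 * U s 0 * h k)" for k
      unfolding g_def h_def using conv_diff_left[OF aM aM' aM] conv_diff_right[OF aM aM' aM'] by simp
    moreover have "l1_le (\<lambda>k. \<mu> * (conv h (a s) k + conv (a' s) h k - 2 * U s 0 * h k))
       (norm \<mu> * (?\<psi> * M + M * ?\<psi> + norm (2 * U s 0) * ?\<psi>))"
      by (intro l1_le_diff l1_le_cmult l1_le_add l1_le_conv h aM aM')
    ultimately have "(\<Sum>k\<in>F. norm (g s k)) \<le> ?\<psi> * M + M * ?\<psi> + norm (2 * U s 0) * ?\<psi>"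
      using mu F by (simp add: l1_le_def)
    also have "\<dots> \<le> ?\<psi> * M + M * ?\<psi> + (2 * M) * ?\<psi>"
      using l1_le_norm[OF M(3)[OF s], of 0] c by (intro add_left_mono mult_right_mono) (auto simp: norm_mult)
    also have "\<dots> = (L - 2 * M) * (c / 2 * exp (L * s))" by (simp add: L_def)
    also have "\<dots> \<le> (L - Re (\<alpha> s)) * (c / 2 * exp (L * s))"
      using Re_alpha_le[OF s] c by (intro mult_right_mono) auto
    also have "\<dots> = L * (c / 2 * exp (L * s)) - Re (\<alpha> s) * (c / 2 * exp (L * s))" by (simp only: left_diff_distrib)
    finally show "(\<Sum>k\<in>F. norm (g s k)) \<le> L * (c / 2 * exp (L * s)) - Re (\<alpha> s) * (c / 2 * exp (L * s))" .
  next
    show "(\<Sum>k\<in>F. norm (\<Phi> a 0 k - \<Phi> a' 0 k)) \<le> c / 2 * exp (L * 0)" using c by (simp add: duhamel_0)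
  qed (use mu in auto)
qed

lemma picard_step:
  "t \<in> {0..T} \<Longrightarrow> l1_le (\<lambda>k. P (Suc n) t k - P n t k) (2 * M / 2 ^ n * exp (L * t))"
proof (induction n arbitrary: t)
  case 0
  have "l1_le (\<lambda>k. P (Suc 0) t k - P 0 t k) (\<rho> t)"
    using in_tube_picard[of "Suc 0"] 0 by (auto simp: in_tube_def)
  moreover have "\<rho> t \<le> 2 * M * exp (L * t)"
  proof -
    have "\<rho> t \<le> M * 2" using M(1,2) 0 by fastforce
    also have "\<dots> \<le> M * 2 * exp (L * t)"
      using mult_left_mono[of 1 "exp (L * t)" "M * 2"] M(1) 0 by (simp add: L_def)
    finally show ?thesis by (simp add: mult_ac)
  qed
  ultimately show ?case by (simp add: l1_le_mono)
next
  case (Suc n)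
  have "l1_le (\<lambda>k. P (Suc (Suc n)) t k - P (Suc n) t k) (2 * M / 2 ^ n / 2 * exp (L * t))"
    unfolding picard.simps(2)[of _ _ _ "Suc n"] picard.simps(2)[of _ _ _ n]
    by (rule duhamel_contract) (use in_tube_picard in_tube_picard[of "Suc n"] M(1) Suc in auto)
  thus ?case by (simp add: mult_ac)
qed

lemma picard_cauchy:
  assumes "t \<in> {0..T}"
  shows "l1_le (\<lambda>k. P (n + m) t k - P n t k) (4 * M / 2 ^ n * (1 - 1 / 2 ^ m) * exp (L * t))"
proof (induction m)
  case 0 thus ?case by (simp add: l1_le_def)
next
  case (Suc m)
  have "l1_le (\<lambda>k. P (n + Suc m) t k - P n t k)
    (2 * M / 2 ^ (n + m) * exp (L * t) + 4 * M / 2 ^ n * (1 - 1 / 2 ^ m) * exp (L * t))"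
    using l1_le_triangle[OF picard_step[OF assms, of "n + m"] Suc] by simp
  also have "2 * M / 2 ^ (n + m) * exp (L * t) + 4 * M / 2 ^ n * (1 - 1 / 2 ^ m) * exp (L * t)
    = 4 * M / 2 ^ n * (1 - 1 / 2 ^ Suc m) * exp (L * t)"
    by (simp add: field_simps power_add)
  finally show ?case .
qed

lemma picard_cauchy':
  assumes "t \<in> {0..T}"
  shows "l1_le (\<lambda>k. P (n + m) t k - P n t k) (4 * M / 2 ^ n * exp (L * T))"
proof (rule l1_le_mono[OF picard_cauchy[OF assms]])
  have "4 * M / 2 ^ n * (1 - 1 / 2 ^ m) * exp (L * t) \<le> 4 * M / 2 ^ n * 1 * exp (L * T)"
    using M(1) assms by (intro mult_mono) (auto simp: L_def intro: mult_left_mono)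
  thus "4 * M / 2 ^ n * (1 - 1 / 2 ^ m) * exp (L * t) \<le> 4 * M / 2 ^ n * exp (L * T)" by simp
qed

lemma tail_null: "(\<lambda>n. 4 * M / 2 ^ n * exp (L * T)) \<longlonglongrightarrow> 0"
proof -
  have "(\<lambda>n. 4 * M * exp (L * T) * (1/2) ^ n) \<longlonglongrightarrow> 4 * M * exp (L * T) * 0"
    by (intro tendsto_mult_left LIMSEQ_power_zero) auto
  thus ?thesis by (simp add: field_simps)
qed

lemma picard_tendsto:
  assumes "t \<in> {0..T}"
  shows "(\<lambda>n. P n t k) \<longlonglongrightarrow> B t k"
proof -
  have "Cauchy (\<lambda>n. P n t k)"
  proof (rule metric_CauchyI)
    fix e :: real assume "e > 0"
    then obtain N where N: "4 * M / 2 ^ N * exp (L * T) < e / 2"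
      using order_tendstoD(2)[OF tail_null, of "e/2"] unfolding eventually_sequentially by auto
    have *: "norm (P n t k - P N t k) < e / 2" if "n \<ge> N" for n
      using l1_le_norm[OF picard_cauchy'[OF assms, of N "n - N"], of k] that N by simp
    show "\<exists>N. \<forall>m\<ge>N. \<forall>n\<ge>N. dist (P m t k) (P n t k) < e"
    proof (intro exI[of _ N] allI impI)
      fix m n assume "N \<le> m" "N \<le> n"
      thus "dist (P m t k) (P n t k) < e"
        using *[of m] *[of n] dist_triangle_half_r[of "P N t k" "P m t k" e "P n t k"]
        by (simp add: dist_norm norm_minus_commute)
    qed
  qed
  thus ?thesis unfolding picard_lim_def by (simp add: convergent_LIMSEQ_iff[symmetric] Cauchy_convergent)
qed

lemma picard_lim_tail:
  assumes "t \<in> {0..T}"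
  shows "l1_le (\<lambda>k. B t k - P n t k) (4 * M / 2 ^ n * exp (L * T))"
proof (rule l1_le_limit[where N = n])
  show "(\<lambda>m. P m t k - P n t k) \<longlonglongrightarrow> B t k - P n t k" for k
    by (intro tendsto_diff picard_tendsto assms tendsto_const)
  show "l1_le (\<lambda>k. P m t k - P n t k) (4 * M / 2 ^ n * exp (L * T))" if "m \<ge> n" for m
    using picard_cauchy'[OF assms, of n "m - n"] that by simp
qed

lemma in_tube_lim: "in_tube B"
proof -
  have "continuous_on {0..T} (\<lambda>t. B t k)" for k
  proof (rule uniform_limit_theorem[of _ "\<lambda>n t. P n t k"])
    show "\<forall>\<^sub>F n in sequentially. continuous_on {0..T} (\<lambda>t. P n t k)"
      using in_tube_picard by (auto simp: in_tube_def)
    show "uniform_limit {0..T} (\<lambda>n t. P n t k) (\<lambda>t. B t k) sequentially"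
    proof (rule uniform_limitI)
      fix e :: real assume "e > 0"
      with tail_null have "\<forall>\<^sub>F n in sequentially. 4 * M / 2 ^ n * exp (L * T) < e" by (rule order_tendstoD(2))
      thus "\<forall>\<^sub>F n in sequentially. \<forall>t\<in>{0..T}. dist (P n t k) (B t k) < e"
      proof eventually_elim
        case (elim n)
        thus ?case using l1_le_norm[OF picard_lim_tail[of _ n], where k = k] by (fastforce simp: dist_norm norm_minus_commute)
      qed
    qed
  qed auto
  moreover obtain \<beta> where \<beta>: "\<beta> summable_on UNIV" "\<And>a t k. in_tube a \<Longrightarrow> t\<in>{0..T} \<Longrightarrow> norm (\<Phi> a t k) \<le> \<beta> k"
    using duhamel_dom by blast
  have "norm (B t k) \<le> \<beta> k" if "t \<in> {0..T}" for t k
  proof (rule tendsto_upperbound[OF tendsto_norm[OF picard_tendsto[OF that]]])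
    show "\<forall>\<^sub>F n in sequentially. norm (P n t k) \<le> \<beta> k"
      unfolding eventually_sequentially
    proof (intro exI[of _ 1] allI impI)
      fix n :: nat assume "n \<ge> 1"
      then obtain m where "n = Suc m" by (cases n) auto
      thus "norm (P n t k) \<le> \<beta> k" using \<beta>(2)[OF in_tube_picard that] by simp
    qed
  qed auto
  moreover have "l1_le (\<lambda>k. B t k - U t k) (\<rho> t)" if "t \<in> {0..T}" for t
    by (rule l1_le_limit[where a = "\<lambda>n k. P n t k - U t k" and N = 0])
       (use in_tube_picard that in \<open>auto simp: in_tube_def intro!: tendsto_diff picard_tendsto\<close>)
  ultimately show ?thesis using \<beta>(1) unfolding in_tube_def by blast
qed

text \<open>
  Both sides have vanishing distance to the next iterate.
\<close>

lemma duhamel_lim: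
  assumes t: "t \<in> {0..T}" shows "\<Phi> B t k = B t k"
proof -
  have le: "norm (\<Phi> B t k - P (Suc n) t k) \<le> 4 * M / 2 ^ n * exp (L * T) / 2 * exp (L * T)" for n
  proof -
    have "l1_le (\<lambda>k. \<Phi> B t k - \<Phi> (P n) t k) (4 * M / 2 ^ n * exp (L * T) / 2 * exp (L * t))"
    proof (rule duhamel_contract[OF in_tube_lim in_tube_picard _ _ t])
      fix s assume s: "s \<in> {0..T}"
      have "4 * M / 2 ^ n * exp (L * T) * 1 \<le> 4 * M / 2 ^ n * exp (L * T) * exp (L * s)"
        using M(1) s by (intro mult_left_mono) (auto simp: L_def)
      thus "l1_le (\<lambda>k. B s k - P n s k) (4 * M / 2 ^ n * exp (L * T) * exp (L * s))"
        using picard_lim_tail[OF s, of n] by (auto intro: l1_le_mono)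
    qed (use M(1) in auto)
    hence "norm (\<Phi> B t k - P (Suc n) t k) \<le> 4 * M / 2 ^ n * exp (L * T) / 2 * exp (L * t)"
      using l1_le_norm by fastforce
    also have "\<dots> \<le> 4 * M / 2 ^ n * exp (L * T) / 2 * exp (L * T)"
      using M(1) t by (intro mult_left_mono) (auto simp: L_def intro: mult_left_mono)
    finally show ?thesis .
  qed
  have "(\<lambda>n. 4 * M / 2 ^ n * exp (L * T) / 2 * exp (L * T)) \<longlonglongrightarrow> 0 / 2 * exp (L * T)"
    by (intro tendsto_mult tendsto_divide tail_null tendsto_const) auto
  hence "(\<lambda>n. \<Phi> B t k - P (Suc n) t k) \<longlonglongrightarrow> 0"
    by (intro Lim_null_comparison[OF always_eventually[OF allI[OF le]]]) simp
  moreover have "(\<lambda>n. \<Phi> B t k - P (Suc n) t k) \<longlonglongrightarrow> \<Phi> B t k - B t k"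
    by (intro tendsto_diff tendsto_const LIMSEQ_Suc picard_tendsto t)
  ultimately show ?thesis using LIMSEQ_unique by fastforce
qed

text \<open>
  The limit is a fixed point of the Picard map and therefore differentiable in time; it stays in the
  tube because finite partial sums pass to the limit.
\<close>

theorem picard_lim_solution:
  "mode_solution \<mu> T B" "B 0 = a0" "t \<in> {0..T} \<Longrightarrow> l1_le (\<lambda>k. B t k - U t k) (\<rho> t)"
proof -
  have "((\<lambda>t. B t k) has_vector_derivative \<mu> * (conv (B t) (B t) k - of_int k ^ 2 * B t k)) (at t within {0..T})"
    if t: "t \<in> {0..T}" for t k
  proof (rule has_vector_derivative_transform[OF t])
    show "((\<lambda>t. \<Phi> B t k) has_vector_derivative \<mu> * (conv (B t) (B t) k - of_int k ^ 2 * B t k)) (at t within {0..T})"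
      using duhamel_deriv[OF in_tube_lim t, of k] duhamel_lim[OF t, of k] by (simp add: algebra_simps)
  qed (auto simp: duhamel_lim)
  thus "mode_solution \<mu> T B" using in_tube_lim by (auto simp: mode_solution_def in_tube_def)
  show "B 0 = a0" using duhamel_lim[of 0] T by (auto simp: duhamel_0 fun_eq_iff)
  show "t \<in> {0..T} \<Longrightarrow> l1_le (\<lambda>k. B t k - U t k) (\<rho> t)" using in_tube_lim by (auto simp: in_tube_def)
qed

end

section \<open>Continuation in time and the invariant cone\<close>

text \<open>
  At the junction the two one-sided derivatives agree because the right-hand side depends only on the
  current state.
\<close>

lemma mode_solution_continue:
  assumes b1: "mode_solution \<mu> T1 b1" and b2: "mode_solution \<mu> T2 b2" and eq: "b2 0 = b1 T1" and T: "T1 \<ge> 0" "T2 \<ge> 0"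
  shows "mode_solution \<mu> (T1 + T2) (\<lambda>t. if t \<in> {0..T1} then b1 t else b2 (t - T1))"
proof -
  define b where "b = (\<lambda>t. if t \<in> {0..T1} then b1 t else b2 (t - T1))"
  obtain \<beta>1 where \<beta>1: "\<beta>1 summable_on UNIV" "\<And>t k. t\<in>{0..T1} \<Longrightarrow> norm (b1 t k) \<le> \<beta>1 k"
    using b1 unfolding mode_solution_def by blast
  obtain \<beta>2 where \<beta>2: "\<beta>2 summable_on UNIV" "\<And>t k. t\<in>{0..T2} \<Longrightarrow> norm (b2 t k) \<le> \<beta>2 k"
    using b2 unfolding mode_solution_def by blast
  have n1: "\<beta>1 k \<ge> 0" for k using \<beta>1(2)[of 0 k] T by (auto intro: order_trans[OF norm_ge_zero])
  have n2: "\<beta>2 k \<ge> 0" for k using \<beta>2(2)[of 0 k] T by (auto intro: order_trans[OF norm_ge_zero])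
  have "norm (b t k) \<le> \<beta>1 k + \<beta>2 k" if "t \<in> {0..T1+T2}" for t k
    using \<beta>1(2)[of t k] \<beta>2(2)[of "t - T1" k] n1[of k] n2[of k] that by (auto simp: b_def)
  moreover have "((\<lambda>t. b t k) has_vector_derivative
        \<mu> * (conv (b t) (b t) k - of_int k ^ 2 * b t k)) (at t within {0..T1+T2})" if t: "t \<in> {0..T1+T2}" for t k
  proof -
    define f' where "f' = (\<lambda>t. \<mu> * (conv (b1 t) (b1 t) k - of_int k ^ 2 * b1 t k))"
    define g' where "g' = (\<lambda>t. \<mu> * (conv (b2 (t - T1)) (b2 (t - T1)) k - of_int k ^ 2 * b2 (t - T1) k))"
    have f: "((\<lambda>t. b1 t k) has_vector_derivative f' s) (at s within {0..T1})" if "s \<in> {0..T1}" for s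
      using b1 that by (auto simp: mode_solution_def f'_def)
    have g: "((\<lambda>t. b2 (t - T1) k) has_vector_derivative g' s) (at s within {T1..T1+T2})" if "s \<in> {T1..T1+T2}" for s
    proof -
      have im: "(\<lambda>t. t - T1) ` {T1..T1+T2} = {0..T2}" by (simp add: image_diff_atLeastAtMost)
      have "((\<lambda>t. b2 t k) has_vector_derivative g' s) (at (s - T1) within (\<lambda>t. t - T1) ` {T1..T1+T2})"
        unfolding im using b2 that by (auto simp: mode_solution_def g'_def)
      moreover have "((\<lambda>t. t - T1) has_vector_derivative 1) (at s within {T1..T1+T2})"
        by (auto intro!: derivative_eq_intros)
      ultimately show ?thesis using vector_diff_chain_within[of "\<lambda>t. t - T1" 1 s "{T1..T1+T2}" "\<lambda>t. b2 t k" "g' s"]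
        by (simp add: o_def)
    qed
    have cl: "closure {0..T1} \<inter> closure {T1..T1+T2} = {T1}" using T by auto
    have u: "{0..T1} \<union> {T1} = {0..T1}" "{T1..T1+T2} \<union> {T1} = {T1..T1+T2}" "{0..T1+T2} = {0..T1} \<union> {T1..T1+T2}"
      using T by auto
    have "((\<lambda>t. if t \<in> {0..T1} then b1 t k else b2 (t - T1) k) has_vector_derivative
       (if t \<in> {0..T1} then f' t else g' t)) (at t within {0..T1+T2})"
    proof (rule has_vector_derivative_If_within_closures[OF _ u(3)], unfold cl u)
      have c: "s = T1" if "s \<in> closure {0..T1}" "s \<in> closure {T1..T1+T2}" for s using cl that by blast
      show "b1 t k = b2 (t - T1) k" if "t \<in> closure {0..T1}" "t \<in> closure {T1..T1+T2}"
        using c[OF that] eq by simp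
      show "f' t = g' t" if "t \<in> closure {0..T1}" "t \<in> closure {T1..T1+T2}"
        using c[OF that] eq by (simp add: f'_def g'_def)
    qed (use t T f g in auto)
    moreover have "(if t \<in> {0..T1} then f' t else g' t) = \<mu> * (conv (b t) (b t) k - of_int k ^ 2 * b t k)"
      by (simp add: b_def f'_def g'_def)
    moreover have "(\<lambda>t. b t k) = (\<lambda>t. if t \<in> {0..T1} then b1 t k else b2 (t - T1) k)" by (auto simp: b_def)
    ultimately show ?thesis by simp
  qed
  ultimately have "mode_solution \<mu> (T1 + T2) b" unfolding mode_solution_def
    using summable_on_add[OF \<beta>1(1) \<beta>2(1)] by blast
  thus ?thesis by (simp add: b_def)
qed

text \<open>
  The terminal condition. The constant function \<open>\<beta>\<close> evolves into
  \<open>w(t) = \<beta> / (1 - \<beta> \<mu> t)\<close>, an exact solution, which tends to 0 like \<open>1/t\<close>. As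
  radius take \<open>\<rho> = - Re (\<mu> w)\<close>. With \<open>\<mu> w = r + i s\<close> one has
  \<open>\<rho>' = s\<^sup>2 - r\<^sup>2\<close>, and the inequality required of \<open>\<rho>\<close> is
  \<open>- 2 r\<^sup>2 + r\<^sup>2 \<le> s\<^sup>2 - r\<^sup>2\<close>. So it suffices that the distance to some
  constant is at most minus the real part of its rotation: the half plane where the quadratic term
  pulls the mean towards zero.
\<close>

lemma cone_global:
  assumes mu: "norm \<mu> = 1" "Re \<mu> > 0" and neg: "Re (\<mu> * \<beta>) < 0"
    and a: "l1_le (\<lambda>k. a k - mode0 \<beta> k) (- Re (\<mu> * \<beta>))"
  shows "\<exists>b. b 0 = a \<and> (\<forall>T\<ge>0. mode_solution \<mu> T b) \<and>
    (\<forall>t\<ge>0. l1_le (b t) (2 * norm (\<beta> / (1 - \<beta> * \<mu> * of_real t))))"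
proof -
  define w where "w = (\<lambda>t. \<beta> / (1 - \<beta> * \<mu> * of_real t))"
  define U where "U = (\<lambda>t. mode0 (w t))"
  have re: "Re (1 - \<beta> * \<mu> * of_real t) \<ge> 1" if "t \<ge> 0" for t
    using mult_nonpos_nonneg[of "Re (\<mu> * \<beta>)" t] neg that by (simp add: algebra_simps)
  hence nz: "1 - \<beta> * \<mu> * of_real t \<noteq> 0" if "t \<ge> 0" for t
    using re[OF that] by (metis not_one_le_zero zero_complex.sel(1))
  have dw: "(w has_vector_derivative \<mu> * w t ^ 2) (at t within S)" if "t \<ge> 0" for t S
  proof -
    have "((\<lambda>z. \<beta> / (1 - \<beta> * \<mu> * z)) has_field_derivative \<mu> * w t ^ 2) (at (of_real t))"
      using nz[OF that] by (auto intro!: derivative_eq_intros simp: w_def power2_eq_square field_simps)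
    from has_vector_derivative_real_field[OF this]
    show ?thesis by (simp add: w_def has_vector_derivative_at_within)
  qed
  \<comment> \<open>the real part of the quotient has the sign of its numerator times the conjugate denominator\<close>
  have muw: "Re (\<mu> * w t) \<le> 0" if "t \<ge> 0" for t
  proof -
    have "Re (z * cnj (1 - z * of_real t)) = Re z - t * (norm z)\<^sup>2" for z
      unfolding cmod_power2 by (simp add: algebra_simps power2_eq_square)
    from this[of "\<mu> * \<beta>"]
    have "Re (\<mu> * \<beta> * cnj (1 - \<beta> * \<mu> * of_real t)) = Re (\<mu> * \<beta>) - t * (norm (\<mu> * \<beta>))\<^sup>2"
      by (simp only: mult.commute[of \<beta> \<mu>])
    hence "Re (\<mu> * \<beta> * cnj (1 - \<beta> * \<mu> * of_real t)) \<le> 0" using neg that by (smt (verit) mult_nonneg_nonneg zero_le_power2)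
    thus ?thesis by (simp add: w_def Re_divide_Reals Re_complex_div_le_0)
  qed
  have drho: "((\<lambda>t. - Re (\<mu> * w t)) has_real_derivative - Re ((\<mu> * w t)\<^sup>2)) (at t within S)" if "t \<ge> 0" for t S
  proof -
    have "((\<lambda>t. \<mu> * w t) has_vector_derivative \<mu> * (\<mu> * w t ^ 2)) (at t within S)"
      by (rule has_vector_derivative_mult_right[OF dw[OF that]])
    from bounded_linear.has_vector_derivative[OF bounded_linear_Re this]
    have "((\<lambda>t. Re (\<mu> * w t)) has_real_derivative Re ((\<mu> * w t)\<^sup>2)) (at t within S)"
      by (simp add: has_real_derivative_iff_has_vector_derivative power2_eq_square mult_ac)
    thus ?thesis by (rule DERIV_minus)
  qed
  have tube: "tube \<mu> T U (\<lambda>t k. 0) (\<lambda>t. - Re (\<mu> * w t)) (\<lambda>t. - Re ((\<mu> * w t)\<^sup>2)) (\<lambda>t. 0) (\<lambda>t. 0)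
     (\<lambda>k. if k = 0 then norm \<beta> else 0) a" if "T \<ge> 0" for T
  proof (unfold_locales, goal_cases)
    case (4 t k)
    have "conv (U t) (U t) k = w t * mode0 (w t) k"
      unfolding U_def by (rule conv_mode0)
    thus ?case using dw[of t "{0..T}"] 4 by (cases "k = 0") (auto simp: U_def mode0_def power2_eq_square mult_ac)
  next
    case (5 t k)
    have "1 \<le> norm (1 - \<beta> * \<mu> * of_real t)" using re[of t] complex_Re_le_cmod[of "1 - \<beta> * \<mu> * of_real t"] 5 by auto
    hence "norm \<beta> / norm (1 - \<beta> * \<mu> * of_real t) \<le> norm \<beta> / 1" by (intro divide_left_mono) auto
    thus ?case by (auto simp: U_def mode0_def w_def norm_divide)
  next
    case 6 show ?case by (rule finite_nonzero_values_imp_summable_on, rule finite_subset[of _ "{0}"]) auto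
  next
    case (7 t) thus ?case by (intro drho) auto
  next
    case (8 t) thus ?case using muw by auto
  next
    case 9 thus ?case using a by (simp add: U_def w_def)
  next
    case (10 t)
    have "(\<lambda>k. if k = 0 then 0 else U t k) = (\<lambda>k. 0)" by (auto simp: fun_eq_iff U_def mode0_def)
    thus ?case by (simp add: l1_le_def)
  next
    case (12 t)
    have "(2 * x + 2 * 0) * - x + (- x)\<^sup>2 + 0 \<le> - (x\<^sup>2 - y\<^sup>2)" for x y :: real
      by (simp add: power2_eq_square algebra_simps)
    moreover have "Re ((\<mu> * w t)\<^sup>2) = Re (\<mu> * w t) ^ 2 - Im (\<mu> * w t) ^ 2"
      by (simp only: power2_eq_square times_complex.sel)
    moreover have "U t 0 = w t" by (simp add: U_def mode0_def)
    ultimately show ?case by metis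
  qed (use mu that in \<open>auto simp: U_def mode0_def l1_le_def\<close>)
  define b where "b = picard_lim \<mu> U a"
  have sol: "mode_solution \<mu> T b" "b 0 = a" if "T \<ge> 0" for T
    using tube.picard_lim_solution(1,2)[OF tube[OF that]] by (auto simp: b_def)
  have "l1_le (b t) (2 * norm (w t))" if "t \<ge> 0" for t
  proof -
    have "l1_le (\<lambda>k. b t k - U t k) (- Re (\<mu> * w t))"
      using tube.picard_lim_solution(3)[OF tube[OF that], of t] that by (simp add: b_def)
    hence "l1_le (\<lambda>k. b t k - U t k) (norm (w t))"
      by (rule l1_le_mono) (use abs_Re_le_cmod[of "\<mu> * w t"] mu in \<open>simp add: norm_mult\<close>)
    from l1_le_add[OF this l1_le_mode0[of "w t"]] show ?thesis by (simp add: U_def)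
  qed
  thus ?thesis using sol[of 0] sol(1) by (auto simp: w_def)
qed

lemma has_sum_int_nat:
  fixes f :: "int \<Rightarrow> 'a::{comm_monoid_add,t2_space}"
  shows "(f has_sum s) UNIV \<longleftrightarrow> ((\<lambda>n. f (int_decode n)) has_sum s) UNIV"
  using has_sum_reindex_bij_betw[OF bij_int_decode, of f s] by (simp add: o_def)

section \<open>Regularity of the Fourier modes\<close>

lemma dominated_summable:
  fixes g :: "'i \<Rightarrow> complex"
  assumes "\<And>k. norm (g k) \<le> K k" "K summable_on UNIV"
  shows "g summable_on UNIV"
  by (rule abs_summable_summable, rule summable_on_comparison_test[OF assms(2)]) (use assms in auto)

text \<open>
  Termwise differentiation, transferred from series over the naturals by an enumeration of the
  integers.
\<close>

lemma has_vector_derivative_infsum: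
  fixes f f' :: "int \<Rightarrow> real \<Rightarrow> complex"
  assumes S: "convex S" "x \<in> S"
    and d: "\<And>k x. x \<in> S \<Longrightarrow> (f k has_vector_derivative f' k x) (at x within S)"
    and M: "\<And>k x. x \<in> S \<Longrightarrow> norm (f' k x) \<le> M k" "M summable_on UNIV"
    and N: "\<And>k x. x \<in> S \<Longrightarrow> norm (f k x) \<le> N k" "N summable_on UNIV"
  shows "((\<lambda>x. \<Sum>\<^sub>\<infinity>k. f k x) has_vector_derivative (\<Sum>\<^sub>\<infinity>k. f' k x)) (at x within S)"
proof -
  have s1: "(\<lambda>n. f (int_decode n) x) sums (\<Sum>\<^sub>\<infinity>k. f k x)" if "x \<in> S" for x
    by (rule has_sum_imp_sums, subst has_sum_int_nat[symmetric, of "\<lambda>k. f k x"], rule has_sum_infsum)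
       (use dominated_summable[OF N(1)[OF that] N(2)] in auto)
  have s2: "(\<lambda>n. f' (int_decode n) x) sums (\<Sum>\<^sub>\<infinity>k. f' k x)" if "x \<in> S" for x
    by (rule has_sum_imp_sums, subst has_sum_int_nat[symmetric, of "\<lambda>k. f' k x"], rule has_sum_infsum)
       (use dominated_summable[OF M(1)[OF that] M(2)] in auto)
  have M': "summable (\<lambda>n. M (int_decode n))"
    by (rule summable_on_imp_summable, rule has_sum_imp_summable, subst has_sum_int_nat[symmetric], rule has_sum_infsum[OF M(2)])
  have u: "uniform_limit S (\<lambda>n x. \<Sum>i<n. f' (int_decode i) x) (\<lambda>x. \<Sum>i. f' (int_decode i) x) sequentially"
    by (rule Weierstrass_m_test[OF M(1) M'])
  have "\<exists>g. \<forall>x\<in>S. (\<lambda>n. f (int_decode n) x) sums g x \<and> (g has_derivative (\<lambda>h. h *\<^sub>R (\<Sum>\<^sub>\<infinity>k. f' k x))) (at x within S)"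
  proof (rule has_derivative_series[where f = "\<lambda>n x. f (int_decode n) x" and l = "\<Sum>\<^sub>\<infinity>k. f k x"
        and f' = "\<lambda>n x h. h *\<^sub>R f' (int_decode n) x", OF S(1) _ _ S(2) s1[OF S(2)]])
    show "(f (int_decode n) has_derivative (\<lambda>h. h *\<^sub>R f' (int_decode n) x)) (at x within S)" if "x \<in> S" for n x
      using d[OF that] by (simp add: has_vector_derivative_def)
    fix e :: real assume "e > 0"
    from uniform_limitD[OF u this]
    show "\<forall>\<^sub>F n in sequentially. \<forall>x\<in>S. \<forall>h. norm ((\<Sum>i<n. h *\<^sub>R f' (int_decode i) x) - h *\<^sub>R (\<Sum>\<^sub>\<infinity>k. f' k x)) \<le> e * norm h"
    proof eventually_elim
      case (elim n)
      show ?case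
      proof (intro ballI allI)
        fix x and h :: real assume x: "x \<in> S"
        have "norm ((\<Sum>i<n. h *\<^sub>R f' (int_decode i) x) - h *\<^sub>R (\<Sum>\<^sub>\<infinity>k. f' k x)) =
          \<bar>h\<bar> * norm ((\<Sum>i<n. f' (int_decode i) x) - (\<Sum>\<^sub>\<infinity>k. f' k x))"
          by (simp flip: scaleR_sum_right scaleR_diff_right)
        also have "\<dots> \<le> \<bar>h\<bar> * e"
          using elim x sums_unique[OF s2[OF x]] by (intro mult_left_mono) (auto simp: dist_norm less_imp_le)
        finally show "norm ((\<Sum>i<n. h *\<^sub>R f' (int_decode i) x) - h *\<^sub>R (\<Sum>\<^sub>\<infinity>k. f' k x)) \<le> e * norm h"
          by (simp add: mult.commute)
      qed
    qed
  qed
  then obtain g where g: "\<And>x. x\<in>S \<Longrightarrow> (\<lambda>n. f (int_decode n) x) sums g x"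
     "\<And>x. x \<in> S \<Longrightarrow> (g has_derivative (\<lambda>h. h *\<^sub>R (\<Sum>\<^sub>\<infinity>k. f' k x))) (at x within S)" by blast
  have "(\<Sum>\<^sub>\<infinity>k. f k x) = g x" if "x \<in> S" for x using sums_unique2[OF s1[OF that] g(1)[OF that]] .
  thus ?thesis unfolding has_vector_derivative_def
    by (intro has_derivative_transform[OF S(2) _ g(2)[OF S(2)]]) auto
qed

text \<open>
  Cauchy product; evaluated at \<open>f\<^sub>k = a\<^sub>k e\<^sub>k(x)\<close> this is the product rule for
  Fourier series.
\<close>

lemma infsum_conv:
  assumes "l1_le f M" "l1_le g N"
  shows "(\<Sum>\<^sub>\<infinity>k. conv f g k) = (\<Sum>\<^sub>\<infinity>k. f k) * (\<Sum>\<^sub>\<infinity>k. g k)"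
proof -
  have shift: "bij_betw (\<lambda>k. k - j) UNIV UNIV" for j :: int
    by (rule bij_betwI[of _ _ _ "\<lambda>k. k + j"]) auto
  have gs: "(\<lambda>k. norm (g (k - j))) summable_on UNIV" for j
    using summable_on_reindex_bij_betw[OF shift, of "\<lambda>k. norm (g k)" j] l1_le_summable[OF assms(2)] by simp
  have gi: "(\<Sum>\<^sub>\<infinity>k. norm (g (k - j))) = (\<Sum>\<^sub>\<infinity>k. norm (g k))" "(\<Sum>\<^sub>\<infinity>k. g (k - j)) = (\<Sum>\<^sub>\<infinity>k. g k)" for j
    using infsum_reindex_bij_betw[OF shift, of "\<lambda>k. norm (g k)" j] infsum_reindex_bij_betw[OF shift, of g j] by simp_all
  have "(\<lambda>p. norm (case p of (j, k) \<Rightarrow> f j * g (k - j))) summable_on UNIV \<times> UNIV"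
    unfolding Infinite_Sum.abs_summable_on_Sigma_iff
  proof (intro conjI ballI)
    show "(\<lambda>y. norm (case (x, y) of (j, k) \<Rightarrow> f j * g (k - j))) summable_on UNIV" for x
      using summable_on_cmult_right[OF gs, of "norm (f x)" x] by (simp add: norm_mult)
    show "(\<lambda>x. norm (\<Sum>\<^sub>\<infinity>y. norm (case (x, y) of (j, k) \<Rightarrow> f j * g (k - j)))) summable_on UNIV"
      using summable_on_cmult_left[OF l1_le_summable[OF assms(1)], of "\<Sum>\<^sub>\<infinity>k. norm (g k)"]
      by (simp add: norm_mult infsum_cmult_right' gi infsum_nonneg)
  qed
  hence "(\<lambda>(j, k). f j * g (k - j)) summable_on UNIV \<times> UNIV" by (rule abs_summable_summable)
  from infsum_swap_banach[OF this]
  have "(\<Sum>\<^sub>\<infinity>k. conv f g k) = (\<Sum>\<^sub>\<infinity>j. \<Sum>\<^sub>\<infinity>k. f j * g (k - j))" by (simp add: conv_def)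
  thus ?thesis by (simp add: infsum_cmult_right' infsum_cmult_left' gi)
qed

text \<open>
  A constant supersolution for a single damped mode.
\<close>

lemma mode_solution_mode_bound:
  assumes b: "mode_solution \<mu> T b" and mu: "Re \<mu> > 0" and k: "k \<noteq> 0"
    and G: "\<And>t. t \<in> {0..T} \<Longrightarrow> norm (\<mu> * conv (b t) (b t) k) \<le> G" and t: "t \<in> {0..T}"
  shows "norm (b t k) \<le> norm (b 0 k) + G / (Re \<mu> * of_int k ^ 2)"
proof -
  let ?\<rho> = "norm (b 0 k) + G / (Re \<mu> * of_int k ^ 2)"
  have G0: "G \<ge> 0" using order_trans[OF norm_ge_zero G[OF t]] .
  have pos: "Re \<mu> * of_int k ^ 2 > 0" using mu k by simp
  have "(\<Sum>j\<in>{k}. norm (b t k)) \<le> ?\<rho>"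
  proof (rule l1_comparison[where y = "\<lambda>t j. b t k" and A = "\<lambda>t. - (\<mu> * of_int k ^ 2 * of_real t)"
          and \<alpha> = "\<lambda>t. - (\<mu> * of_int k ^ 2)" and \<mu> = 0 and g = "\<lambda>s j. \<mu> * conv (b s) (b s) k" and T = T
          and r = "\<lambda>t. 0" and \<rho> = "\<lambda>t. ?\<rho>"])
    fix s assume s: "s \<in> {0..T}"
    show "((\<lambda>t. - (\<mu> * (of_int k)\<^sup>2 * of_real t)) has_vector_derivative - (\<mu> * (of_int k)\<^sup>2)) (at s within {0..T})"
      by (auto intro!: derivative_eq_intros)
    show "((\<lambda>t. b t k) has_vector_derivative (- (\<mu> * (of_int k)\<^sup>2) - 0 * (of_int j)\<^sup>2) * b s k + \<mu> * conv (b s) (b s) k)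
      (at s within {0..T})" for j
      using b s by (auto simp: mode_solution_def algebra_simps)
    have re: "Re (- (\<mu> * (of_int k)\<^sup>2)) = - (Re \<mu> * (of_int k)\<^sup>2)"
      using Re_mult_of_int_square[of \<mu> k] by simp
    have "norm (\<mu> * conv (b s) (b s) k) \<le> G" by (rule G[OF s])
    also have "\<dots> = Re \<mu> * of_int k ^ 2 * (G / (Re \<mu> * of_int k ^ 2))"
      using pos by (metis less_irrefl nonzero_mult_div_cancel_left times_divide_eq_right)
    also have "\<dots> \<le> Re \<mu> * of_int k ^ 2 * ?\<rho>" using pos by (intro mult_left_mono) auto
    finally show "(\<Sum>j\<in>{k}. norm (\<mu> * conv (b s) (b s) k)) \<le> 0 - Re (- (\<mu> * (of_int k)\<^sup>2)) * ?\<rho>" unfolding re by simp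
  qed (use t G0 pos in auto)
  thus ?thesis by simp
qed

text \<open>
  Bootstrapping: a summable bound \<open>\<beta>\<close> of the modes gives the summable bound
  \<open>\<beta> * \<beta>\<close> of the forcing, and the heat semigroup gains \<open>k\<^sup>2\<close>. This is uniform
  down to time 0 because the initial data have two derivatives, and it is what makes the Fourier series
  a classical solution on the closed half line.
\<close>

lemma mode_solution_regular:
  assumes b: "mode_solution \<mu> T b" and mu: "norm \<mu> = 1" "Re \<mu> > 0" and T: "T \<ge> 0"
    and b0: "(\<lambda>k. of_int k ^ 2 * norm (b 0 k)) summable_on UNIV"
  shows "\<exists>\<beta> \<beta>'. \<beta> summable_on UNIV \<and> (\<lambda>k. of_int k ^ 2 * \<beta> k) summable_on UNIV \<and> \<beta>' summable_on UNIV \<and>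
     (\<forall>t\<in>{0..T}. \<forall>k. norm (b t k) \<le> \<beta> k \<and> norm (\<mu> * (conv (b t) (b t) k - of_int k ^ 2 * b t k)) \<le> \<beta>' k)"
proof -
  obtain \<beta> where \<beta>: "\<beta> summable_on UNIV" "\<And>t k. t\<in>{0..T} \<Longrightarrow> norm (b t k) \<le> \<beta> k"
    using b unfolding mode_solution_def by blast
  have \<beta>0: "\<beta> k \<ge> 0" for k using \<beta>(2)[of 0 k] T by (auto intro: order_trans[OF norm_ge_zero])
  define c where "c = (\<lambda>k. complex_of_real (\<beta> k))"
  have c: "l1_le c (\<Sum>\<^sub>\<infinity>k. \<beta> k)" by (rule l1_le_of_summable[OF \<beta>(1)]) (simp add: c_def \<beta>0)
  define G where "G k = norm (conv c c k)" for k
  have G: "G summable_on UNIV" unfolding G_def by (rule l1_le_summable[OF l1_le_conv[OF c c]])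
  have cG: "norm (conv (b t) (b t) k) \<le> G k" if t: "t \<in> {0..T}" for t k
  proof -
    have bt: "l1_le (b t) (\<Sum>\<^sub>\<infinity>k. \<beta> k)" by (rule l1_le_of_summable[OF \<beta>(1) \<beta>(2)[OF t]])
    have "norm (conv (b t) (b t) k) \<le> (\<Sum>\<^sub>\<infinity>j. norm (b t j * b t (k - j)))"
      unfolding conv_def by (rule norm_infsum_bound[OF conv_abs_summable[OF bt bt]])
    also have "\<dots> \<le> (\<Sum>\<^sub>\<infinity>j. norm (c j * c (k - j)))"
    proof (rule infsum_mono[OF conv_abs_summable[OF bt bt] conv_abs_summable[OF c c]])
      show "norm (b t j * b t (k - j)) \<le> norm (c j * c (k - j))" for j
        using \<beta>(2)[OF t] \<beta>0 by (auto simp: norm_mult c_def intro!: mult_mono)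
    qed
    also have "\<dots> = (\<Sum>\<^sub>\<infinity>j. Re (c j * c (k - j)))"
      by (rule infsum_cong) (simp add: c_def norm_mult \<beta>0)
    also have "\<dots> = Re (conv c c k)" unfolding conv_def by (rule infsum_Re[OF conv_summable[OF c c]])
    also have "\<dots> \<le> G k" unfolding G_def by (rule complex_Re_le_cmod)
    finally show ?thesis .
  qed
  \<comment> \<open>the zero mode is not damped and keeps its old bound\<close>
  define \<beta>1 where "\<beta>1 k = (if k = 0 then \<beta> k else min (\<beta> k) (norm (b 0 k) + G k / (Re \<mu> * of_int k ^ 2)))" for k
  have \<beta>1: "norm (b t k) \<le> \<beta>1 k" if t: "t \<in> {0..T}" for t k
    using \<beta>(2)[OF t, of k] mode_solution_mode_bound[OF b mu(2) _ _ t, of k "G k"] cG[of _ k] mu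
    by (auto simp: \<beta>1_def norm_mult)
  have n1: "\<beta>1 k \<ge> 0" for k using \<beta>1[of 0 k] T by (auto intro: order_trans[OF norm_ge_zero])
  have s1: "\<beta>1 summable_on UNIV"
    by (rule summable_on_comparison_test[OF \<beta>(1)]) (use n1 in \<open>auto simp: \<beta>1_def\<close>)
  have s2: "(\<lambda>k. of_int k ^ 2 * \<beta>1 k) summable_on UNIV"
  proof (rule summable_on_comparison_test)
    show "(\<lambda>k. of_int k ^ 2 * norm (b 0 k) + G k * (1 / Re \<mu>)) summable_on UNIV"
      by (intro summable_on_add b0 summable_on_cmult_left G)
    fix k :: int
    show "(of_int k)\<^sup>2 * \<beta>1 k \<le> of_int k ^ 2 * norm (b 0 k) + G k * (1 / Re \<mu>)"
    proof (cases "k = 0")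
      case False
      have "(of_int k)\<^sup>2 * \<beta>1 k \<le> (of_int k)\<^sup>2 * (norm (b 0 k) + G k / (Re \<mu> * of_int k ^ 2))"
        using False by (intro mult_left_mono) (auto simp: \<beta>1_def)
      also have "\<dots> = of_int k ^ 2 * norm (b 0 k) + G k * (1 / Re \<mu>)" using False mu by (simp add: field_simps)
      finally show ?thesis .
    qed (use mu in \<open>simp add: G_def\<close>)
    show "0 \<le> (of_int k)\<^sup>2 * \<beta>1 k" using n1 by simp
  qed
  have "norm (\<mu> * (conv (b t) (b t) k - of_int k ^ 2 * b t k)) \<le> G k + of_int k ^ 2 * \<beta>1 k" if t: "t \<in> {0..T}" for t k
  proof -
    have "norm (\<mu> * (conv (b t) (b t) k - of_int k ^ 2 * b t k)) \<le> norm (conv (b t) (b t) k) + norm (of_int k ^ 2 * b t k)"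
      unfolding norm_mult[of \<mu>] mu mult_1 by (rule norm_triangle_ineq4)
    also have "\<dots> \<le> G k + of_int k ^ 2 * \<beta>1 k"
      using \<beta>1[OF t, of k] by (intro add_mono cG[OF t]) (auto simp: norm_mult norm_power intro: mult_left_mono)
    finally show ?thesis .
  qed
  thus ?thesis using s1 s2 \<beta>1 summable_on_add[OF G s2] by blast
qed

section \<open>From Fourier modes to classical solutions\<close>

text \<open>
  The characters, in the form in which they occur in \<open>has_fourier_series\<close>.
\<close>

definition fmode :: "int \<Rightarrow> real \<Rightarrow> complex" where
  "fmode k x = exp (2 * complex_of_real pi * \<i> * of_int k * complex_of_real x)"

definition fsum :: "(int \<Rightarrow> complex) \<Rightarrow> real \<Rightarrow> complex" where
  "fsum a x = (\<Sum>\<^sub>\<infinity>k. a k * fmode k x)"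

lemma norm_fmode [simp]: "norm (fmode k x) = 1"
  by (simp add: fmode_def norm_exp_eq_Re)

lemma fmode_add: "fmode j x * fmode (k - j) x = fmode k x"
  by (simp add: fmode_def algebra_simps flip: exp_add)

lemma fmode_periodic: "fmode k (x + 1) = fmode k x"
proof -
  have "exp (2 * complex_of_real pi * \<i> * of_int k) = 1"
    using exp_integer_2pi[of "of_int k"] by (simp add: mult_ac)
  thus ?thesis by (simp add: fmode_def distrib_left exp_add)
qed

lemma fmode_deriv:
  "((\<lambda>x. fmode k x) has_vector_derivative (2 * complex_of_real pi * \<i> * of_int k) * fmode k x) (at x within S)"
proof -
  have "((\<lambda>z. exp (2 * complex_of_real pi * \<i> * of_int k * z)) has_field_derivative
     (2 * complex_of_real pi * \<i> * of_int k) * exp (2 * complex_of_real pi * \<i> * of_int k * of_real x)) (at (of_real x))"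
    by (auto intro!: derivative_eq_intros)
  from has_vector_derivative_real_field[OF this] show ?thesis
    unfolding fmode_def by (rule has_vector_derivative_at_within)
qed

lemma fmode_cont: "continuous_on S (fmode k)"
  unfolding fmode_def by (intro continuous_intros)

lemma fsum_periodic: "fsum a (x + 1) = fsum a x"
  by (simp add: fsum_def fmode_periodic)

lemma fsum_mult:
  assumes "l1_le a M" "l1_le b N"
  shows "fsum (conv a b) x = fsum a x * fsum b x"
proof -
  have l: "l1_le (\<lambda>k. c k * fmode k x) K" if "l1_le c K" for c K
    using that by (simp add: l1_le_def norm_mult)
  have "conv a b k * fmode k x = conv (\<lambda>k. a k * fmode k x) (\<lambda>k. b k * fmode k x) k" for k
  proof -
    have "conv a b k * fmode k x = (\<Sum>\<^sub>\<infinity>j. a j * b (k - j) * fmode k x)"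
      unfolding conv_def by (rule infsum_cmult_left'[symmetric])
    also have "\<dots> = conv (\<lambda>k. a k * fmode k x) (\<lambda>k. b k * fmode k x) k"
      unfolding conv_def by (rule infsum_cong) (simp add: mult_ac fmode_add[of _ x k, symmetric])
    finally show ?thesis .
  qed
  thus ?thesis unfolding fsum_def using infsum_conv[OF l[OF assms(1)] l[OF assms(2)]] by simp
qed

lemma fsum_cmult: "fsum (\<lambda>k. c * a k) x = c * fsum a x"
  by (simp add: fsum_def mult.assoc infsum_cmult_right')

lemma fsum_add:
  assumes "l1_le a M" "l1_le b N"
  shows "fsum (\<lambda>k. a k + b k) x = fsum a x + fsum b x"
proof -
  have s: "(\<lambda>k. c k * fmode k x) summable_on UNIV" if "l1_le c K" for c K
    by (rule dominated_summable[OF _ l1_le_summable[OF that]]) (simp add: norm_mult)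
  show ?thesis unfolding fsum_def distrib_right by (rule infsum_add[OF s[OF assms(1)] s[OF assms(2)]])
qed

lemma fsum_continuous:
  assumes "\<And>k. continuous_on S (\<lambda>t. a t k)" "\<And>t k. t \<in> S \<Longrightarrow> norm (a t k) \<le> \<beta> k" "\<beta> summable_on UNIV"
  shows "continuous_on (S \<times> UNIV) (\<lambda>(t, x). fsum (a t) x)"
  unfolding fsum_def case_prod_beta
proof (rule continuous_on_infsum_dominated)
  show "continuous_on (S \<times> UNIV) (\<lambda>p. a (fst p) k * fmode k (snd p))" for k
    by (intro continuous_intros continuous_on_compose2[OF assms(1)] continuous_on_compose2[OF fmode_cont[of UNIV]]) auto
qed (use assms in \<open>auto simp: norm_mult\<close>)

lemma fsum_deriv_x:
  assumes "(\<lambda>k. norm (a k)) summable_on UNIV" "(\<lambda>k. \<bar>of_int k\<bar> * norm (a k)) summable_on UNIV"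
  shows "(fsum a has_vector_derivative fsum (\<lambda>k. (2 * complex_of_real pi * \<i> * of_int k) * a k) x) (at x)"
proof -
  have "((\<lambda>x. \<Sum>\<^sub>\<infinity>k. a k * fmode k x) has_vector_derivative
     (\<Sum>\<^sub>\<infinity>k. a k * ((2 * complex_of_real pi * \<i> * of_int k) * fmode k x))) (at x within UNIV)"
  proof (rule has_vector_derivative_infsum[where M = "\<lambda>k. 2 * pi * (\<bar>of_int k\<bar> * norm (a k))" and N = "\<lambda>k. norm (a k)"])
    show "((\<lambda>x. a k * fmode k x) has_vector_derivative a k * ((2 * complex_of_real pi * \<i> * of_int k) * fmode k x)) (at x within UNIV)" for k x
      by (rule has_vector_derivative_mult_right[OF fmode_deriv])
    show "(\<lambda>k. 2 * pi * (\<bar>of_int k\<bar> * norm (a k))) summable_on UNIV"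
      by (rule summable_on_cmult_right[OF assms(2)])
  qed (use assms(1) in \<open>auto simp: norm_mult\<close>)
  moreover have "(\<lambda>k. a k * ((2 * complex_of_real pi * \<i> * of_int k) * fmode k x)) =
     (\<lambda>k. 2 * complex_of_real pi * \<i> * of_int k * a k * fmode k x)" by (simp add: fun_eq_iff mult_ac)
  moreover have "fsum a = (\<lambda>x. \<Sum>\<^sub>\<infinity>k. a k * fmode k x)" by (simp add: fsum_def fun_eq_iff)
  ultimately show ?thesis by (simp add: fsum_def)
qed

lemma fsum_deriv_t:
  assumes "\<And>k t. t \<in> {0..T} \<Longrightarrow> ((\<lambda>t. a t k) has_vector_derivative a' t k) (at t within {0..T})"
    and "\<And>t k. t \<in> {0..T} \<Longrightarrow> norm (a t k) \<le> \<beta> k" "\<beta> summable_on UNIV"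
    and "\<And>t k. t \<in> {0..T} \<Longrightarrow> norm (a' t k) \<le> \<beta>' k" "\<beta>' summable_on UNIV" and "t \<in> {0..T}"
  shows "((\<lambda>t. fsum (a t) x) has_vector_derivative fsum (a' t) x) (at t within {0..T})"
  unfolding fsum_def
  by (rule has_vector_derivative_infsum[where M = \<beta>' and N = \<beta>])
     (use assms in \<open>auto simp: norm_mult intro!: has_vector_derivative_mult_left\<close>)

lemma continuous_on_half_line:
  assumes "\<And>T. T \<ge> 0 \<Longrightarrow> continuous_on ({0..T} \<times> (UNIV :: real set)) (f :: real \<times> real \<Rightarrow> complex)"
  shows "continuous_on ({0..} \<times> UNIV) f"
  unfolding continuous_on_eq_continuous_within
proof
  fix p :: "real \<times> real" assume p: "p \<in> {0..} \<times> UNIV"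
  obtain t x where tx: "p = (t, x)" by (cases p)
  have "at p within ({0..} \<times> UNIV) = at p within ({0..t+1} \<times> UNIV)"
  proof (rule at_within_nhd[of _ "{..<t+1} \<times> UNIV"])
    show "open ({..<t + 1} \<times> (UNIV :: real set))" by (intro open_Times) auto
  qed (use p tx in auto)
  thus "continuous (at p within {0..} \<times> UNIV) f"
    using assms[of "t + 1"] p tx unfolding continuous_on_eq_continuous_within by auto
qed

lemma at_within_half_line: "t \<ge> 0 \<Longrightarrow> at t within {0..} = at t within {0..t + 1::real}"
  by (rule at_within_nhd[of _ "{..<t+1}"]) auto

text \<open>
  The scaling by \<open>c = 4 \<pi>\<^sup>2\<close> of both time and amplitude absorbs the eigenvalues
  \<open>- 4 \<pi>\<^sup>2 k\<^sup>2\<close> of the Laplacian. All four functions in the definition of a solution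
  are Fourier series with coefficients dominated uniformly on bounded time intervals.
\<close>

lemma global_heat_solution:
  fixes \<theta> :: real and u0 :: "real \<Rightarrow> complex" and b :: "real \<Rightarrow> int \<Rightarrow> complex"
  assumes sol: "\<And>T. T \<ge> 0 \<Longrightarrow> mode_solution (cis \<theta>) T b" and th: "cos \<theta> > 0"
    and b0: "(\<lambda>k. of_int k ^ 2 * norm (b 0 k)) summable_on UNIV"
    and u0: "\<And>x. u0 x = fsum (\<lambda>k. of_real (4 * pi\<^sup>2) * b 0 k) x"
  defines "a \<equiv> \<lambda>t k. of_real (4 * pi\<^sup>2) * b (4 * pi\<^sup>2 * t) k"
  shows "heat_solution \<theta> u0 {0..} (\<lambda>t. fsum (a t))"
proof -
  define c where "c = 4 * pi\<^sup>2"
  have c0: "c > 0" by (simp add: c_def)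
  define \<mu> where "\<mu> = cis \<theta>"
  have mu: "norm \<mu> = 1" "Re \<mu> > 0" using th by (auto simp: \<mu>_def)
  define D where "D = (\<lambda>k::int. 2 * complex_of_real pi * \<i> * of_int k)"
  define a' where "a' = (\<lambda>t k. of_real c * (of_real c * (\<mu> * (conv (b (c * t)) (b (c * t)) k - of_int k ^ 2 * b (c * t) k))))"
  have a: "a t k = of_real c * b (c * t) k" for t k by (simp add: a_def c_def)
  have D2: "D k * D k = - of_real c * of_int k ^ 2" for k
    by (simp add: D_def c_def power2_eq_square mult_ac)
  have nD: "norm (D k) = 2 * pi * \<bar>of_int k\<bar>" for k by (simp add: D_def norm_mult)
  have reg: "\<exists>\<beta> \<beta>'. \<beta> summable_on UNIV \<and> (\<lambda>k. of_int k ^ 2 * \<beta> k) summable_on UNIV \<and> \<beta>' summable_on UNIV \<and>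
     (\<forall>t\<in>{0..T}. \<forall>k. norm (a t k) \<le> \<beta> k \<and> norm (a' t k) \<le> \<beta>' k)" if "T \<ge> 0" for T
  proof -
    have "c * T \<ge> 0" using c0 that by simp
    from mode_solution_regular[OF sol[OF this, folded \<mu>_def] mu this b0] obtain \<beta> \<beta>' where
      *: "\<beta> summable_on UNIV" "(\<lambda>k. of_int k ^ 2 * \<beta> k) summable_on UNIV" "\<beta>' summable_on UNIV"
       "\<And>t k. t \<in> {0..c * T} \<Longrightarrow> norm (b t k) \<le> \<beta> k"
       "\<And>t k. t \<in> {0..c * T} \<Longrightarrow> norm (\<mu> * (conv (b t) (b t) k - of_int k ^ 2 * b t k)) \<le> \<beta>' k" by blast
    have ct: "c * t \<in> {0..c * T}" if "t \<in> {0..T}" for t using that c0 by auto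
    show ?thesis
    proof (rule exI[of _ "\<lambda>k. c * \<beta> k"], rule exI[of _ "\<lambda>k. c * (c * \<beta>' k)"], intro conjI ballI allI)
      show "(\<lambda>k. (of_int k)\<^sup>2 * (c * \<beta> k)) summable_on UNIV"
        using summable_on_cmult_right[OF *(2), of c] by (simp add: mult_ac)
      fix t k assume t: "t \<in> {0..T}"
      show "norm (a t k) \<le> c * \<beta> k" using *(4)[OF ct[OF t]] c0 by (simp add: a norm_mult)
      show "norm (a' t k) \<le> c * (c * \<beta>' k)"
        unfolding a'_def using *(5)[OF ct[OF t]] c0 by (simp only: norm_mult[of "of_real c"]) (auto intro!: mult_left_mono)
    qed (intro summable_on_cmult_right *)+
  qed
  have kle: "\<bar>of_int k :: real\<bar> \<le> of_int k ^ 2" for k :: int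
  proof -
    have "\<bar>k\<bar> * 1 \<le> \<bar>k\<bar> * \<bar>k\<bar>" 
      by (cases "k = 0") (use mult_left_mono[of 1 "\<bar>k\<bar>" "\<bar>k\<bar>"] in auto)
    hence "\<bar>k\<bar> \<le> k ^ 2" by (simp add: power2_eq_square)
    thus ?thesis by (metis of_int_abs of_int_le_iff of_int_power)
  qed
  have da: "((\<lambda>t. a t k) has_vector_derivative a' t k) (at t within {0..T})" if t: "t \<in> {0..T}" for t k T
  proof -
    have T: "c * T \<ge> 0" using c0 t by simp
    have im: "(\<lambda>t. c * t) ` {0..T} = {0..c * T}" using c0 t by (simp add: image_mult_atLeastAtMost_if)
    have "((\<lambda>t. c * t) has_vector_derivative c) (at t within {0..T})" by (auto intro!: derivative_eq_intros)
    moreover have "((\<lambda>t. b t k) has_vector_derivative \<mu> * (conv (b (c * t)) (b (c * t)) k - of_int k ^ 2 * b (c * t) k))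
      (at (c * t) within (\<lambda>t. c * t) ` {0..T})"
      unfolding im using sol[OF T] t c0 by (auto simp: mode_solution_def \<mu>_def)
    ultimately have "((\<lambda>t. b (c * t) k) has_vector_derivative
       c *\<^sub>R (\<mu> * (conv (b (c * t)) (b (c * t)) k - of_int k ^ 2 * b (c * t) k))) (at t within {0..T})"
      using vector_diff_chain_within[of "\<lambda>t. c * t" c t "{0..T}" "\<lambda>t. b t k"] by (simp add: o_def)
    hence "((\<lambda>t. of_real c * b (c * t) k) has_vector_derivative of_real c *
       (c *\<^sub>R (\<mu> * (conv (b (c * t)) (b (c * t)) k - of_int k ^ 2 * b (c * t) k)))) (at t within {0..T})"
      by (rule has_vector_derivative_mult_right)
    thus ?thesis by (simp add: a a'_def scaleR_conv_of_real)
  qed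
  have ca: "continuous_on {0..T} (\<lambda>t. a t k)" for T k by (rule continuous_on_vector_derivative[OF da])
  have l1: "\<exists>M. l1_le (b (c * t)) M \<and> (\<lambda>k. norm (a t k)) summable_on UNIV \<and> (\<lambda>k. \<bar>of_int k\<bar> * norm (a t k)) summable_on UNIV
     \<and> (\<lambda>k. of_int k ^ 2 * norm (a t k)) summable_on UNIV" if "t \<ge> 0" for t
  proof -
    from reg[OF that] that obtain \<beta> where \<beta>: "\<beta> summable_on UNIV" "(\<lambda>k. of_int k ^ 2 * \<beta> k) summable_on UNIV" "\<And>k. norm (a t k) \<le> \<beta> k"
      by fastforce
    have s2: "(\<lambda>k. of_int k ^ 2 * norm (a t k)) summable_on UNIV"
      by (rule summable_on_comparison_test[OF \<beta>(2)]) (auto intro!: mult_left_mono \<beta>)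
    have s1: "(\<lambda>k. \<bar>of_int k\<bar> * norm (a t k)) summable_on UNIV"
      by (rule summable_on_comparison_test[OF s2]) (auto intro!: mult_right_mono kle)
    have s0: "(\<lambda>k. norm (a t k)) summable_on UNIV"
      by (rule summable_on_comparison_test[OF \<beta>(1)]) (auto intro!: \<beta>)
    have "l1_le (a t) (\<Sum>\<^sub>\<infinity>k. norm (a t k))" by (rule l1_le_of_summable[OF s0]) auto
    from l1_le_cmult[OF this, of "1 / of_real c"] have "l1_le (b (c * t)) (norm (1 / complex_of_real c) * (\<Sum>\<^sub>\<infinity>k. norm (a t k)))"
      using c0 by (simp add: a)
    thus ?thesis using s0 s1 s2 by blast
  qed
  have pde: "fsum (a' t) x = \<mu> * (fsum (\<lambda>k. D k * (D k * a t k)) x + (fsum (a t) x)\<^sup>2)" if t: "t \<ge> 0" for t x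
  proof -
    from l1[OF t] obtain M where M: "l1_le (b (c * t)) M" and s2: "(\<lambda>k. of_int k ^ 2 * norm (a t k)) summable_on UNIV" by blast
    have n: "norm (D k * (D k * a t k)) = c * (of_int k ^ 2 * norm (a t k))" for k
      using c0 by (simp add: D2 norm_mult norm_power flip: mult.assoc)
    have l: "l1_le (\<lambda>k. D k * (D k * a t k)) (\<Sum>\<^sub>\<infinity>k. c * (of_int k ^ 2 * norm (a t k)))"
      by (rule l1_le_of_summable[OF summable_on_cmult_right[OF s2]]) (simp add: n)
    have "a' t k = \<mu> * (D k * (D k * a t k) + of_real c * (of_real c * conv (b (c * t)) (b (c * t)) k))" for k
      unfolding a'_def a by (simp add: mult.assoc[of "D k" "D k", symmetric] D2 algebra_simps)
    hence "a' t = (\<lambda>k. \<mu> * (D k * (D k * a t k) + of_real c * (of_real c * conv (b (c * t)) (b (c * t)) k)))" by auto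
    hence "fsum (a' t) x = \<mu> * (fsum (\<lambda>k. D k * (D k * a t k)) x + of_real c * (of_real c * (fsum (b (c * t)) x * fsum (b (c * t)) x)))"
      by (simp add: fsum_cmult fsum_add[OF l l1_le_cmult[OF l1_le_cmult[OF l1_le_conv[OF M M]]]] fsum_mult[OF M M])
    moreover have "fsum (a t) x = of_real c * fsum (b (c * t)) x"
      unfolding a by (rule fsum_cmult)
    ultimately show ?thesis by (simp add: power2_eq_square mult_ac)
  qed
  have dx: "(fsum (a t) has_vector_derivative fsum (\<lambda>k. D k * a t k) x) (at x)" if "t \<ge> 0" for t x
    using l1[OF that] unfolding D_def by (intro fsum_deriv_x) auto
  have dxx: "(fsum (\<lambda>k. D k * a t k) has_vector_derivative fsum (\<lambda>k. D k * (D k * a t k)) x) (at x)" if "t \<ge> 0" for t x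
  proof -
    from l1[OF that] have s1: "(\<lambda>k. \<bar>of_int k\<bar> * norm (a t k)) summable_on UNIV"
      and s2: "(\<lambda>k. of_int k ^ 2 * norm (a t k)) summable_on UNIV" by auto
    have "(\<lambda>k. norm (D k * a t k)) summable_on UNIV"
      using summable_on_cmult_right[OF s1, of "2 * pi"] by (simp add: norm_mult nD mult_ac)
    moreover have "(\<lambda>k. \<bar>of_int k\<bar> * norm (D k * a t k)) summable_on UNIV"
    proof -
      have "(\<lambda>k. \<bar>of_int k\<bar> * norm (D k * a t k)) = (\<lambda>k. 2 * pi * (of_int k ^ 2 * norm (a t k)))"
        by (auto simp: fun_eq_iff norm_mult nD power2_eq_square abs_if)
      thus ?thesis using summable_on_cmult_right[OF s2, of "2 * pi"] by simp
    qed
    ultimately show ?thesis using fsum_deriv_x[of "\<lambda>k. D k * a t k" x] by (simp add: D_def)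
  qed
  have c1: "continuous_on ({0..} \<times> UNIV) (\<lambda>(t, x). fsum (\<lambda>k. E k * a t k) x)"
    if E: "\<And>k. norm (E k) \<le> K * (1 + of_int k ^ 2)" "K \<ge> 0" for E K
  proof (rule continuous_on_half_line)
    fix T :: real assume "T \<ge> 0"
    from reg[OF this] obtain \<beta> where \<beta>: "\<beta> summable_on UNIV" "(\<lambda>k. of_int k ^ 2 * \<beta> k) summable_on UNIV"
      "\<And>t k. t \<in> {0..T} \<Longrightarrow> norm (a t k) \<le> \<beta> k" by blast
    show "continuous_on ({0..T} \<times> UNIV) (\<lambda>(t, x). fsum (\<lambda>k. E k * a t k) x)"
    proof (rule fsum_continuous[where \<beta> = "\<lambda>k. K * (\<beta> k + of_int k ^ 2 * \<beta> k)"])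
      show "continuous_on {0..T} (\<lambda>t. E k * a t k)" for k by (intro continuous_intros ca)
      show "(\<lambda>k. K * (\<beta> k + of_int k ^ 2 * \<beta> k)) summable_on UNIV"
        by (intro summable_on_cmult_right summable_on_add \<beta>)
      fix t k assume "t \<in> {0..T}"
      hence "norm (E k * a t k) \<le> K * (1 + of_int k ^ 2) * \<beta> k"
        unfolding norm_mult using E by (intro mult_mono \<beta>) (auto intro!: mult_nonneg_nonneg)
      thus "norm (E k * a t k) \<le> K * (\<beta> k + of_int k ^ 2 * \<beta> k)" by (simp add: algebra_simps)
    qed
  qed
  have k1: "\<bar>of_int k :: real\<bar> \<le> 1 + of_int k ^ 2" for k :: int using kle[of k] by linarith
  have cu: "continuous_on ({0..} \<times> UNIV) (\<lambda>(t, x). fsum (a t) x)"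
    using c1[of "\<lambda>k. 1" 1] by simp
  have cux: "continuous_on ({0..} \<times> UNIV) (\<lambda>(t, x). fsum (\<lambda>k. D k * a t k) x)"
    by (rule c1[of D "2 * pi"]) (auto simp: nD k1)
  have cuxx: "continuous_on ({0..} \<times> UNIV) (\<lambda>(t, x). fsum (\<lambda>k. D k * (D k * a t k)) x)"
  proof -
    have "norm (D k * D k) \<le> c * (1 + of_int k ^ 2)" for k using c0 by (simp add: D2 norm_mult norm_power)
    from c1[of "\<lambda>k. D k * D k", OF this] c0 show ?thesis by (simp add: mult.assoc)
  qed
  have cut: "continuous_on ({0..} \<times> UNIV) (\<lambda>(t, x). fsum (a' t) x)"
  proof -
    have "continuous_on ({0..} \<times> UNIV) (\<lambda>p. \<mu> * ((case p of (t, x) \<Rightarrow> fsum (\<lambda>k. D k * (D k * a t k)) x) + (case p of (t, x) \<Rightarrow> fsum (a t) x)\<^sup>2))"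
      by (intro continuous_intros cu cuxx)
    thus ?thesis by (rule continuous_on_cong[THEN iffD1, rotated -1]) (auto simp: pde)
  qed
  have dt: "((\<lambda>s. fsum (a s) x) has_vector_derivative fsum (a' t) x) (at t within {0..})" if "t \<ge> 0" for t x
  proof -
    have "t + 1 \<ge> 0" using that by simp
    from reg[OF this] obtain \<beta> \<beta>' where *: "\<beta> summable_on UNIV" "\<beta>' summable_on UNIV"
      "\<And>s k. s \<in> {0..t+1} \<Longrightarrow> norm (a s k) \<le> \<beta> k" "\<And>s k. s \<in> {0..t+1} \<Longrightarrow> norm (a' s k) \<le> \<beta>' k" by blast
    show ?thesis unfolding at_within_half_line[OF that]
      by (rule fsum_deriv_t[OF da *(3,1,4,2)]) (use that in auto)
  qed
  show ?thesis unfolding heat_solution_def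
  proof (rule conjI, goal_cases)
    case 2
    show ?case
    proof (rule conjI, goal_cases)
      case 2
      show ?case
  proof (rule exI[of _ "\<lambda>t. fsum (\<lambda>k. D k * a t k)"],
      rule exI[of _ "\<lambda>t. fsum (\<lambda>k. D k * (D k * a t k))"], rule exI[of _ "\<lambda>t. fsum (a' t)"], intro conjI)
    show "\<forall>t\<in>{0..}. \<forall>x. (fsum (a t) has_vector_derivative fsum (\<lambda>k. D k * a t k) x) (at x) \<and>
       (fsum (\<lambda>k. D k * a t k) has_vector_derivative fsum (\<lambda>k. D k * (D k * a t k)) x) (at x) \<and>
       ((\<lambda>s. fsum (a s) x) has_vector_derivative fsum (a' t) x) (at t within {0..}) \<and>
       fsum (a' t) x = exp (\<i> * complex_of_real \<theta>) * (fsum (\<lambda>k. D k * (D k * a t k)) x + (fsum (a t) x)\<^sup>2)"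
      using dx dxx dt pde by (auto simp: \<mu>_def cis_conv_exp)
  qed (use cu cux cuxx cut in auto)
    qed (simp add: fsum_periodic)
  qed (simp add: u0 a_def)
qed

lemma has_fourier_series_fsum:
  assumes "l1_le a M" shows "has_fourier_series (fsum a) a"
proof -
  have "((\<lambda>k. a k * fmode k x) has_sum fsum a x) UNIV" for x
    unfolding fsum_def
    by (rule has_sum_infsum, rule dominated_summable[OF _ l1_le_summable[OF assms]]) (simp add: norm_mult)
  thus ?thesis using l1_le_summable[OF assms] unfolding has_fourier_series_def fmode_def by blast
qed

section \<open>Uniqueness of classical solutions\<close>

lemma periodic_deriv:
  fixes f :: "real \<Rightarrow> complex"
  assumes p: "\<And>x. f (x + 1) = f x" and d: "\<And>x. (f has_vector_derivative f' x) (at x)"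
  shows "f' (x + 1) = f' x"
proof -
  have "((\<lambda>y. f (y + 1)) has_vector_derivative f' (x + 1)) (at x)"
  proof -
    have "((\<lambda>y. y + 1) has_vector_derivative 1) (at x)" by (auto intro!: derivative_eq_intros)
    from vector_diff_chain_at[OF this d] show ?thesis by (simp add: o_def)
  qed
  hence "(f has_vector_derivative f' (x + 1)) (at x)" by (simp add: p)
  thus ?thesis using d[of x] vector_derivative_unique_at by blast
qed

text \<open>
  Energy estimate. The difference \<open>w\<close> solves the linear equation
  \<open>w\<^sub>t = \<mu> (w\<^sub>x\<^sub>x + q w)\<close> with \<open>q\<close> the sum of the two solutions.
  Integration by parts over a period makes the diffusion contribute \<open>- Re \<mu>\<close> times the integral
  of \<open>|w\<^sub>x|\<^sup>2\<close>, so the integral of \<open>|w|\<^sup>2\<close> grows at most exponentially, and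
  it starts at 0.
\<close>

lemma heat_solution_unique:
  assumes th: "cos \<theta> \<ge> 0" and T: "T > 0"
    and u: "heat_solution \<theta> u0 {0..T} u" and v: "heat_solution \<theta> u0 {0..T} v"
    and t: "t \<in> {0..T}"
  shows "v t x = u t x"
proof -
  define \<mu> where "\<mu> = exp (\<i> * complex_of_real \<theta>)"
  have mu: "Re \<mu> \<ge> 0" using th by (simp add: \<mu>_def Re_exp)
  from u obtain ux uxx ut where u0: "\<And>x. u 0 x = u0 x" and up: "\<And>t x. t\<in>{0..T} \<Longrightarrow> u t (x + 1) = u t x"
    and uc: "continuous_on ({0..T} \<times> UNIV) (\<lambda>(t, x). u t x)" "continuous_on ({0..T} \<times> UNIV) (\<lambda>(t, x). ux t x)"
      "continuous_on ({0..T} \<times> UNIV) (\<lambda>(t, x). uxx t x)" "continuous_on ({0..T} \<times> UNIV) (\<lambda>(t, x). ut t x)"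
    and ud: "\<And>t x. t\<in>{0..T} \<Longrightarrow> (u t has_vector_derivative ux t x) (at x)"
      "\<And>t x. t\<in>{0..T} \<Longrightarrow> (ux t has_vector_derivative uxx t x) (at x)"
      "\<And>t x. t\<in>{0..T} \<Longrightarrow> ((\<lambda>s. u s x) has_vector_derivative ut t x) (at t within {0..T})"
      "\<And>t x. t\<in>{0..T} \<Longrightarrow> ut t x = \<mu> * (uxx t x + (u t x)\<^sup>2)"
    unfolding heat_solution_def \<mu>_def by blast
  from v obtain vx vxx vt where v0: "\<And>x. v 0 x = u0 x" and vp: "\<And>t x. t\<in>{0..T} \<Longrightarrow> v t (x + 1) = v t x"
    and vc: "continuous_on ({0..T} \<times> UNIV) (\<lambda>(t, x). v t x)" "continuous_on ({0..T} \<times> UNIV) (\<lambda>(t, x). vx t x)"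
      "continuous_on ({0..T} \<times> UNIV) (\<lambda>(t, x). vxx t x)" "continuous_on ({0..T} \<times> UNIV) (\<lambda>(t, x). vt t x)"
    and vd: "\<And>t x. t\<in>{0..T} \<Longrightarrow> (v t has_vector_derivative vx t x) (at x)"
      "\<And>t x. t\<in>{0..T} \<Longrightarrow> (vx t has_vector_derivative vxx t x) (at x)"
      "\<And>t x. t\<in>{0..T} \<Longrightarrow> ((\<lambda>s. v s x) has_vector_derivative vt t x) (at t within {0..T})"
      "\<And>t x. t\<in>{0..T} \<Longrightarrow> vt t x = \<mu> * (vxx t x + (v t x)\<^sup>2)"
    unfolding heat_solution_def \<mu>_def by blast
  define w where "w = (\<lambda>t x. v t x - u t x)"
  define wx where "wx = (\<lambda>t x. vx t x - ux t x)"
  define wxx where "wxx = (\<lambda>t x. vxx t x - uxx t x)"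
  define wt where "wt = (\<lambda>t x. vt t x - ut t x)"
  define q where "q = (\<lambda>t x. v t x + u t x)"
  have wc: "continuous_on ({0..T} \<times> UNIV) (\<lambda>(t, x). w t x)" "continuous_on ({0..T} \<times> UNIV) (\<lambda>(t, x). wt t x)"
    "continuous_on ({0..T} \<times> UNIV) (\<lambda>(t, x). wx t x)" "continuous_on ({0..T} \<times> UNIV) (\<lambda>(t, x). wxx t x)"
    "continuous_on ({0..T} \<times> UNIV) (\<lambda>(t, x). q t x)"
    using uc vc unfolding w_def wt_def wx_def wxx_def q_def case_prod_beta by (auto intro!: continuous_intros)
  have cx: "continuous_on S (f t)" if "continuous_on ({0..T} \<times> UNIV) (\<lambda>(t, x). f t x)" "t \<in> {0..T}" for f :: "real \<Rightarrow> real \<Rightarrow> complex" and t S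
  proof -
    have "continuous_on S (\<lambda>x. (t, x))" by (intro continuous_intros)
    from continuous_on_compose2[OF that(1) this] have "Pair t ` S \<subseteq> {0..T} \<times> UNIV \<Longrightarrow> continuous_on S (f t)" by simp
    thus ?thesis using that(2) by (simp add: image_subset_iff)
  qed
  have wd: "(w t has_vector_derivative wx t x) (at x)" "(wx t has_vector_derivative wxx t x) (at x)"
    "((\<lambda>s. w s x) has_vector_derivative wt t x) (at t within {0..T})"
    "wt t x = \<mu> * (wxx t x + q t x * w t x)" if "t \<in> {0..T}" for t x
    using ud[OF that] vd[OF that] unfolding w_def wx_def wxx_def wt_def q_def
    by (auto intro!: has_vector_derivative_diff simp: power2_eq_square algebra_simps)
  have wp: "w t (x + 1) = w t x" if "t \<in> {0..T}" for t x using up[OF that] vp[OF that] by (simp add: w_def)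
  have wxp: "wx t (x + 1) = wx t x" if "t \<in> {0..T}" for t x
    by (rule periodic_deriv[OF wp[OF that] wd(1)[OF that]])
  \<comment> \<open>a bound for the coefficient of the linear equation for the difference\<close>
  have "compact ((\<lambda>(t, x). q t x) ` ({0..T} \<times> {0..1}))"
    by (intro compact_continuous_image compact_Times continuous_on_subset[OF wc(5)]) auto
  then obtain K where "\<forall>z\<in>(\<lambda>(t, x). q t x) ` ({0..T} \<times> {0..1}). norm z \<le> K"
    using compact_imp_bounded bounded_iff by metis
  hence K: "norm (q t x) \<le> K" if "t \<in> {0..T}" "x \<in> {0..1}" for t x using that by auto
  define g where "g = (\<lambda>t x. w t x * cnj (w t x))"
  define g' where "g' = (\<lambda>t x. w t x * cnj (wt t x) + wt t x * cnj (w t x))"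
  define E where "E = (\<lambda>t. integral {0..1} (g t))"
  define E' where "E' = (\<lambda>t. integral {0..1} (g' t))"
  have gint: "continuous_on ({0..T} \<times> UNIV) (\<lambda>(t, x). g t x)" "continuous_on ({0..T} \<times> UNIV) (\<lambda>(t, x). g' t x)"
    using wc unfolding g_def g'_def case_prod_beta by (auto intro!: continuous_intros)
  have dE: "(E has_vector_derivative E' t) (at t within {0..T})" if t: "t \<in> {0..T}" for t
    unfolding E_def E'_def cbox_interval[symmetric]
  proof (rule leibniz_rule_vector_derivative[of "{0..T}" 0 1 g g', folded cbox_interval])
    show "((\<lambda>t. g t x) has_vector_derivative g' t x) (at t within cbox 0 T)" if "t \<in> cbox 0 T" for t x
      unfolding g_def g'_def using wd(3)[of t x] that
      by (intro has_vector_derivative_mult has_vector_derivative_cnj) auto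
    show "g t integrable_on cbox 0 1" if "t \<in> cbox 0 T" for t
      using cx[OF gint(1), of t] that by (auto intro!: integrable_continuous_interval)
    show "continuous_on (cbox 0 T \<times> cbox 0 1) (\<lambda>(t, x). g' t x)"
      by (rule continuous_on_subset[OF gint(2)]) auto
  qed (use t in auto)
  have gn: "g t x = of_real ((norm (w t x))\<^sup>2)" for t x
    unfolding g_def complex_norm_square ..
  have int: "f t integrable_on {0..1}" if "continuous_on ({0..T} \<times> UNIV) (\<lambda>(t, x). f t x)" "t \<in> {0..T}" for f :: "real \<Rightarrow> real \<Rightarrow> complex" and t
    by (rule integrable_continuous_interval[OF cx[OF that]])
  have key: "Re (E' t) \<le> 2 * norm \<mu> * K * Re (E t)" if t: "t \<in> {0..T}" for t
  proof -
    \<comment> \<open>the derivative of a periodic function, so its integral over a period vanishes\<close>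
    define p where "p = (\<lambda>x. wxx t x * cnj (w t x) + wx t x * cnj (wx t x))"
    have "((\<lambda>x. wx t x * cnj (w t x)) has_vector_derivative (wx t x * cnj (wx t x) + wxx t x * cnj (w t x))) (at x within {0..1})" for x
      by (rule has_vector_derivative_at_within, intro has_vector_derivative_mult has_vector_derivative_cnj wd[OF t])
    hence "(p has_integral (wx t 1 * cnj (w t 1) - wx t 0 * cnj (w t 0))) {0..1}"
      unfolding p_def by (intro fundamental_theorem_of_calculus) (auto simp: add.commute)
    hence p: "(p has_integral 0) {0..1}" using wp[OF t, of 0] wxp[OF t, of 0] by simp
    have dom: "Re (g' t x) \<le> Re (2 * \<mu> * p x + 2 * of_real (norm \<mu> * K) * g t x)" if x: "x \<in> {0..1}" for x
    proof -
      let ?z = "wt t x * cnj (w t x)"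
      have "Re (g' t x) = 2 * Re ?z" by (simp add: g'_def)
      also have "?z = \<mu> * p x - \<mu> * (wx t x * cnj (wx t x)) + \<mu> * q t x * g t x"
        by (simp add: wd(4)[OF t] p_def g_def algebra_simps)
      also have "wx t x * cnj (wx t x) = of_real ((norm (wx t x))\<^sup>2)" unfolding complex_norm_square ..
      also have "Re (\<mu> * p x - \<mu> * of_real ((norm (wx t x))\<^sup>2) + \<mu> * q t x * g t x) =
         Re (\<mu> * p x) - Re \<mu> * (norm (wx t x))\<^sup>2 + Re (\<mu> * q t x) * (norm (w t x))\<^sup>2"
        unfolding gn by (simp del: of_real_power)
      also have "\<dots> \<le> Re (\<mu> * p x) - 0 + (norm \<mu> * K) * (norm (w t x))\<^sup>2"
      proof -
        have "Re (\<mu> * q t x) \<le> norm (\<mu> * q t x)" by (rule complex_Re_le_cmod)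
        also have "\<dots> \<le> norm \<mu> * K" unfolding norm_mult by (intro mult_left_mono K t x) auto
        finally show ?thesis using mu by (intro add_mono diff_mono mult_right_mono) auto
      qed
      finally show ?thesis unfolding gn by (simp del: of_real_power)
    qed
    have "((\<lambda>x. 2 * \<mu> * p x + 2 * of_real (norm \<mu> * K) * g t x) has_integral (2 * \<mu> * 0 + 2 * of_real (norm \<mu> * K) * E t)) {0..1}"
      unfolding E_def
      by (intro has_integral_add has_integral_mult_right p integrable_integral int[OF gint(1) t])
    from has_integral_Re[OF this]
    have upper: "((\<lambda>x. Re (2 * \<mu> * p x + 2 * of_real (norm \<mu> * K) * g t x)) has_integral Re (2 * \<mu> * 0 + 2 * of_real (norm \<mu> * K) * E t)) {0..1}" .
    have "((\<lambda>x. Re (g' t x)) has_integral Re (E' t)) {0..1}"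
      unfolding E'_def by (intro has_integral_Re integrable_integral int[OF gint(2) t])
    from has_integral_le[OF this upper dom]
    have "Re (E' t) \<le> Re (2 * \<mu> * 0 + 2 * of_real (norm \<mu> * K) * E t)" .
    thus ?thesis by simp
  qed
  define C where "C = 2 * norm \<mu> * K"
  \<comment> \<open>Gronwall's inequality\<close>
  define h where "h = (\<lambda>t. exp (- C * t) * Re (E t))"
  have dRe: "((\<lambda>t. Re (E t)) has_real_derivative Re (E' t)) (at t within {0..T})" if "t \<in> {0..T}" for t
    using bounded_linear.has_vector_derivative[OF bounded_linear_Re dE[OF that]]
    by (simp add: has_real_derivative_iff_has_vector_derivative)
  have dh: "(h has_real_derivative exp (- C * t) * (Re (E' t) - C * Re (E t))) (at t within {0..T})" if "t \<in> {0..T}" for t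
  proof -
    define R where "R = (\<lambda>t. Re (E t))"
    have R: "(R has_real_derivative Re (E' t)) (at t within {0..T})" using dRe[OF that] by (simp add: R_def)
    have "((\<lambda>t. exp (- C * t) * R t) has_real_derivative exp (- C * t) * (Re (E' t) - C * R t)) (at t within {0..T})"
      by (auto intro!: derivative_eq_intros R simp: algebra_simps)
    thus ?thesis by (simp add: R_def h_def)
  qed
  have "h t \<le> h 0"
  proof (cases "t = 0")
    case False
    have "norm (0 - (0::real)) \<le> (- h t) - (- h 0)"
    proof (rule differentiable_bound_general[where f = "\<lambda>_. 0" and f' = "\<lambda>_. 0" and \<phi> = "\<lambda>t. - h t" and \<phi>' = "\<lambda>t. - (exp (- C * t) * (Re (E' t) - C * Re (E t)))"])
      show "continuous_on {0..t} (\<lambda>t. - h t)"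
        by (intro continuous_on_minus continuous_on_subset[OF DERIV_continuous_on[OF dh]]) (use t in auto)
      fix s assume s: "0 < s" "s < t"
      have "(h has_real_derivative exp (- C * s) * (Re (E' s) - C * Re (E s))) (at s)"
        using dh[of s] s t by (simp add: at_within_Icc_at)
      thus "((\<lambda>t. - h t) has_vector_derivative - (exp (- C * s) * (Re (E' s) - C * Re (E s)))) (at s)"
        by (intro has_vector_derivative_minus) (simp add: has_real_derivative_iff_has_vector_derivative)
      show "norm (0::real) \<le> - (exp (- C * s) * (Re (E' s) - C * Re (E s)))"
        using key[of s] s t by (simp add: C_def mult_le_0_iff)
    qed (use False t in auto)
    thus ?thesis by simp
  qed simp
  moreover have "E 0 = 0" by (simp add: E_def g_def w_def u0 v0)
  ultimately have "Re (E t) \<le> 0" by (simp add: h_def mult_le_0_iff not_le)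
  have hi: "((\<lambda>x. (norm (w t x))\<^sup>2) has_integral Re (E t)) {0..1}"
  proof -
    have "(\<lambda>x. Re (g t x)) = (\<lambda>x. (norm (w t x))\<^sup>2)" by (simp add: gn fun_eq_iff del: of_real_power)
    thus ?thesis using has_integral_Re[OF integrable_integral[OF int[OF gint(1) t]]] by (simp only: E_def)
  qed
  have z: "w t y = 0" if "y \<in> {0..1}" for y
  proof -
    have "Re (E t) \<ge> 0" by (rule has_integral_nonneg[OF hi]) auto
    with \<open>Re (E t) \<le> 0\<close> have hi0: "((\<lambda>x. (norm (w t x))\<^sup>2) has_integral 0) (cbox 0 1)" using hi by simp
    have c: "continuous_on (cbox 0 1) (\<lambda>x. (norm (w t x))\<^sup>2)"
      by (intro continuous_intros cx[OF wc(1) t])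
    have "(norm (w t y))\<^sup>2 = 0"
      by (rule has_integral_0_cbox_imp_0[OF c _ hi0]) (use that in auto)
    thus ?thesis by simp
  qed
  \<comment> \<open>the bound on one period extends by periodicity\<close>
  have per: "w t (y + of_nat n) = w t y" for y n
  proof (induction n)
    case (Suc n) thus ?case using wp[OF t, of "y + of_nat n"] by (simp add: add.assoc add.commute[of 1])
  qed simp
  have "w t x = 0"
  proof -
    have f: "frac x \<in> {0..1}" by (simp add: frac_lt_1 less_imp_le)
    show ?thesis
    proof (cases "x \<ge> 0")
      case True
      have "x = frac x + of_nat (nat \<lfloor>x\<rfloor>)" using True by (simp add: frac_def)
      thus ?thesis using per[of "frac x" "nat \<lfloor>x\<rfloor>"] z[OF f] by simp
    next
      case False
      have "frac x = x + of_nat (nat (- \<lfloor>x\<rfloor>))" using False by (simp add: frac_def)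
      thus ?thesis using per[of x "nat (- \<lfloor>x\<rfloor>)"] z[OF f] by simp
    qed
  qed
  thus ?thesis by (simp add: w_def)
qed

section \<open>Polynomials with Gaussian integer coefficients\<close>

text \<open>
  Pairs of integers stand for Gaussian integers, lists of them for polynomials in one complex
  variable, and a list of polynomials for the modes \<open>0, 1, 2, \<dots>\<close> of an even function. Everything
  below is plain structural recursion on such lists, so that concrete instances can be computed by
  rewriting.
\<close>

type_synonym gpoly = "(int \<times> int) list"

fun padd :: "gpoly \<Rightarrow> gpoly \<Rightarrow> gpoly" where
  "padd [] q = q"
| "padd (a # p) [] = a # p"
| "padd ((x, y) # p) ((u, v) # q) = (x + u, y + v) # padd p q"

fun pscale :: "int \<Rightarrow> gpoly \<Rightarrow> gpoly" where
  "pscale n [] = []"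
| "pscale n ((x, y) # p) = (n * x, n * y) # pscale n p"

text \<open>
  \<open>(x + i y) q + r\<close>, fused to avoid building the intermediate product.
\<close>

fun paddmul :: "int \<Rightarrow> int \<Rightarrow> gpoly \<Rightarrow> gpoly \<Rightarrow> gpoly" where
  "paddmul x y [] r = r"
| "paddmul x y ((u, v) # q) [] = (x * u - y * v, x * v + y * u) # paddmul x y q []"
| "paddmul x y ((u, v) # q) ((s, t) # r) = (s + (x * u - y * v), t + (x * v + y * u)) # paddmul x y q r"

fun pmul :: "gpoly \<Rightarrow> gpoly \<Rightarrow> gpoly" where
  "pmul [] q = []"
| "pmul ((x, y) # p) q = paddmul x y q ((0, 0) # pmul p q)"

text \<open>
  With \<open>n = 1\<close> and the constant term removed, this is the derivative.
\<close>

fun pder :: "int \<Rightarrow> gpoly \<Rightarrow> gpoly" where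
  "pder n [] = []"
| "pder n ((x, y) # p) = (n * x, n * y) # pder (n + 1) p"

text \<open>
  Substitution of \<open>- z\<close> for \<open>z\<close>.
\<close>

fun pflip :: "gpoly \<Rightarrow> gpoly" where
  "pflip [] = []"
| "pflip (a # p) = a # pscale (-1) (pflip p)"

text \<open>
  Twice the norm \<open>max |x| |y| + min |x| |y| / 2\<close>, which exceeds the modulus by at most 12 per cent
  and keeps all estimates in the integers.
\<close>

fun gnorm2 :: "int \<times> int \<Rightarrow> int" where
  "gnorm2 (x, y) = \<bar>x\<bar> + \<bar>y\<bar> + max \<bar>x\<bar> \<bar>y\<bar>"

fun pnorm2 :: "gpoly \<Rightarrow> int" where
  "pnorm2 [] = 0"
| "pnorm2 (a # p) = gnorm2 a + pnorm2 p"

fun dot :: "gpoly list \<Rightarrow> gpoly list \<Rightarrow> gpoly" where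
  "dot [] qs = []"
| "dot (p # ps) [] = []"
| "dot (p # ps) (q # qs) = padd (pmul p q) (dot ps qs)"

text \<open>
  A walk along the even sequence of modes with the modes ahead in the first argument and the modes
  behind, nearest first, in the second. At mode \<open>m\<close> the products of pairs at equal distance
  from \<open>m\<close> (or from \<open>m + 1/2\<close>) add up to the modes \<open>2 m\<close> and \<open>2 m + 1\<close> of the
  square, each product of two different factors being computed once.
\<close>

fun selfconv :: "gpoly list \<Rightarrow> gpoly list \<Rightarrow> gpoly list" where
  "selfconv [] bs = []"
| "selfconv (a # as) bs =
     padd (pmul a a) (pscale 2 (dot as bs)) # pscale 2 (dot as (a # bs)) # selfconv as (a # bs)"

text \<open>
  The defect of the modes \<open>C / S\<close>, multiplied by \<open>S\<^sup>2\<close>; the last argument is the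
  self-convolution of \<open>C\<close>, whose modes beyond those of \<open>C\<close> are pure defect.
\<close>

fun defects :: "int \<Rightarrow> int \<Rightarrow> int \<Rightarrow> gpoly list \<Rightarrow> gpoly list \<Rightarrow> gpoly list" where
  "defects R S k cs [] = []"
| "defects R S k [] (a # as) = pscale (-1) a # defects R S (k + 1) [] as"
| "defects R S k (c # cs) (a # as) =
     padd (pscale (-1) a) (pscale S (padd (pscale R (pder 1 (tl c))) (pscale (k * k) c)))
     # defects R S (k + 1) cs as"

text \<open>
  The polynomials whose values at \<open>\<mu>\<close> are the differences between the end of one step
  (argument \<open>\<mu>\<close>) and the start of the next (argument \<open>- \<mu>\<close>).
\<close>

fun jumps :: "gpoly list \<Rightarrow> gpoly list \<Rightarrow> gpoly list" where
  "jumps [] [] = []"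
| "jumps (c # cs) [] = c # jumps cs []"
| "jumps [] (d # ds) = pscale (-1) (pflip d) # jumps [] ds"
| "jumps (c # cs) (d # ds) = padd c (pscale (-1) (pflip d)) # jumps cs ds"

text \<open>
  Evaluation with the powers of the variable read from a table.
\<close>

fun lin_powers :: "gpoly \<Rightarrow> gpoly \<Rightarrow> int \<times> int" where
  "lin_powers [] ms = (0, 0)"
| "lin_powers (a # p) [] = (0, 0)"
| "lin_powers ((x, y) # p) ((u, v) # ms) = (let (s, t) = lin_powers p ms in (s + (x * u - y * v), t + (x * v + y * u)))"

text \<open>
  The \<open>\<ell>\<^sup>1\<close> norm over all integers of an even family given on \<open>0, 1, 2, \<dots>\<close>.
\<close>

fun two_sided :: "int list \<Rightarrow> int" where
  "two_sided [] = 0"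
| "two_sided (a # l) = a + 2 * sum_list l"

text \<open>
  All radii are integers in units of \<open>1/S\<close>. Replacing the powers of \<open>\<mu>\<close> by the table,
  whose entries are off by at most 1 in units of \<open>1/Q\<close>, costs at most the sum of the moduli of the
  coefficients in units of \<open>1/(Q S)\<close>.
\<close>

definition jump_ok :: "int \<Rightarrow> gpoly \<Rightarrow> gpoly list \<Rightarrow> gpoly list \<Rightarrow> int \<Rightarrow> int \<Rightarrow> bool" where
  "jump_ok Q M C D e e' \<longleftrightarrow> (let J = jumps C D in
     list_all (\<lambda>q. length q \<le> length M) J \<and>
     two_sided (map (\<lambda>q. gnorm2 (lin_powers q M) + pnorm2 q) J) \<le> 2 * Q * (e' - e))"

text \<open>
  \<open>L / S\<close> bounds the growth rate \<open>2 Re (\<mu> U\<^sub>0) + 2 \<Sum>|U\<^sub>k|\<close> (sum over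
  \<open>k \<noteq> 0\<close>) on the whole step. The constant coefficient of the mean enters with its sign through
  the approximation \<open>(u + i v) / Q\<close> of \<open>\<mu>\<close>.
\<close>

fun growth_ok :: "int \<Rightarrow> int \<times> int \<Rightarrow> gpoly list \<Rightarrow> int \<Rightarrow> bool" where
  "growth_ok Q (u, v) (((x, y) # p) # C) L \<longleftrightarrow>
     2 * (u * x - v * y + \<bar>x\<bar> + \<bar>y\<bar>) \<le> Q * (L - pnorm2 p - 2 * sum_list (map pnorm2 C))"
| "growth_ok Q m C L \<longleftrightarrow> False"

text \<open>
  The radius is followed by \<open>\<rho>(t) = (e / S) (1 - y t) ^ (-16)\<close>, a rational substitute for an
  exponential, which reaches \<open>(e / S) (1 - x / 1024) ^ (-16)\<close> at the end of the step. The last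
  inequality says that its logarithmic derivative at time 0, which is \<open>16 y = x R / 128\<close>, is at
  least \<open>L / S + e' / S\<close> plus the relative size of the defect.
\<close>

definition step_ok :: "int \<Rightarrow> int \<times> int \<Rightarrow> int \<Rightarrow> int \<Rightarrow> gpoly list \<Rightarrow> int \<Rightarrow> int \<Rightarrow> int \<Rightarrow> int \<Rightarrow> bool" where
  "step_ok Q m S R C e e' L x \<longleftrightarrow>
     0 < R \<and> 0 < e \<and> 0 \<le> x \<and> x < 1024 \<and> growth_ok Q m C L \<and>
     e * 1024 ^ 16 \<le> e' * (1024 - x) ^ 16 \<and>
     128 * e * (L + e') + 64 * two_sided (map pnorm2 (defects R S 0 C (selfconv C (tl C)))) \<le> x * R * S * e"

fun gint :: "int \<times> int \<Rightarrow> complex" where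
  "gint (x, y) = Complex (of_int x) (of_int y)"

fun peval :: "gpoly \<Rightarrow> complex \<Rightarrow> complex" where
  "peval [] z = 0"
| "peval (a # p) z = gint a + z * peval p z"

text \<open>
  The even family of numbers described by a list of modes.
\<close>

definition coef :: "gpoly list \<Rightarrow> complex \<Rightarrow> int \<Rightarrow> complex" where
  "coef C z k = (if nat \<bar>k\<bar> < length C then peval (C ! nat \<bar>k\<bar>) z else 0)"

lemma gint_simps:
  "gint (x + u, y + v) = gint (x, y) + gint (u, v)"
  "gint (n * x, n * y) = of_int n * gint (x, y)"
  "gint (x * u - y * v, x * v + y * u) = gint (x, y) * gint (u, v)"
  "gint (0, 0) = 0"
  "gint (s + (x * u - y * v), t + (x * v + y * u)) = gint (s, t) + gint (x, y) * gint (u, v)"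
  by (simp_all add: complex_eq_iff)

declare gint.simps [simp del]

lemma peval_padd: "peval (padd p q) z = peval p z + peval q z"
  by (induction p q rule: padd.induct) (simp_all add: gint_simps, simp_all add: algebra_simps)

lemma peval_pscale: "peval (pscale n p) z = of_int n * peval p z"
  by (induction n p rule: pscale.induct) (simp_all add: gint_simps, simp_all add: algebra_simps)

lemma peval_paddmul: "peval (paddmul x y q r) z = gint (x, y) * peval q z + peval r z"
  by (induction x y q r rule: paddmul.induct) (simp_all add: gint_simps, simp_all add: algebra_simps)

lemma peval_pmul: "peval (pmul p q) z = peval p z * peval q z"
  by (induction p q rule: pmul.induct) (simp_all add: gint_simps peval_paddmul, simp_all add: algebra_simps)

lemma peval_pflip: "peval (pflip p) z = peval p (- z)"
  by (induction p rule: pflip.induct) (simp_all add: peval_pscale)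

lemma peval_pder: "peval (pder n p) z = of_int n * peval p z + z * peval (pder 1 (tl p)) z"
proof (induction p arbitrary: n)
  case (Cons a p)
  obtain x y where a: "a = (x, y)" by (cases a)
  show ?case using Cons[of "n + 1"] Cons[of 1]
    by (simp add: a gint_simps(2) algebra_simps)
qed simp

lemma DERIV_peval: "(peval p has_field_derivative peval (pder 1 (tl p)) z) (at z)"
proof (induction p)
  case (Cons a p)
  have "((\<lambda>z. gint a + z * peval p z) has_field_derivative (peval p z + z * peval (pder 1 (tl p)) z)) (at z)"
    by (auto intro!: derivative_eq_intros Cons)
  moreover have "peval (a # p) = (\<lambda>z. gint a + z * peval p z)" by (simp add: fun_eq_iff)
  ultimately show ?case using peval_pder[of 1 p z] by simp
qed (simp add: fun_eq_iff[symmetric])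

text \<open>
  For \<open>0 \<le> a \<le> b\<close> this is \<open>a\<^sup>2 + b\<^sup>2 \<le> (b + a / 2)\<^sup>2\<close>, that is
  \<open>3 a \<le> 4 b\<close> after cancelling.
\<close>

lemma norm_gint: "norm (gint a) \<le> of_int (gnorm2 a) / 2"
proof (cases a)
  case (Pair x y)
  have *: "sqrt (a\<^sup>2 + b\<^sup>2) \<le> (a + b + max a b) / 2" if "0 \<le> a" "0 \<le> b" for a b :: real
  proof -
    have **: "a\<^sup>2 + b\<^sup>2 \<le> ((a + b + max a b) / 2)\<^sup>2" if "0 \<le> a" "a \<le> b" for a b :: real
    proof -
      have "a * a \<le> a * b" "0 \<le> a * b" using that by (auto intro: mult_left_mono)
      hence "a * a + b * b \<le> a * a / 4 + a * b + b * b" by linarith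
      also have "\<dots> = ((a + b + b) / 2)\<^sup>2" by (simp add: power2_eq_square field_simps)
      finally show ?thesis using that by (simp add: max_def power2_eq_square)
    qed
    have "a\<^sup>2 + b\<^sup>2 \<le> ((a + b + max a b) / 2)\<^sup>2"
      using **[of a b] **[of b a] that by (cases "a \<le> b") (auto simp: add.commute max.commute)
    thus ?thesis using that by (intro real_le_lsqrt) auto
  qed
  have "norm (gint a) = sqrt (\<bar>of_int x\<bar>\<^sup>2 + \<bar>of_int y\<bar>\<^sup>2)" by (simp add: Pair complex_norm gint.simps)
  also have "\<dots> \<le> (\<bar>of_int x\<bar> + \<bar>of_int y\<bar> + max \<bar>of_int x\<bar> \<bar>of_int y\<bar>) / 2" by (rule *) auto
  finally show ?thesis by (simp add: Pair of_int_max)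
qed

lemma gnorm2_nonneg: "gnorm2 a \<ge> 0" by (cases a) auto

lemma pnorm2_nonneg: "pnorm2 p \<ge> 0" by (induction p) (auto simp: gnorm2_nonneg)

text \<open>
  All polynomials are normalised so that the time step corresponds to the unit disc.
\<close>

lemma norm_peval:
  assumes "norm z \<le> 1" shows "norm (peval p z) \<le> of_int (pnorm2 p) / 2"
proof (induction p)
  case (Cons a p)
  have "norm (peval (a # p) z) \<le> norm (gint a) + norm z * norm (peval p z)"
    using norm_triangle_ineq[of "gint a" "z * peval p z"] by (simp add: norm_mult)
  also have "\<dots> \<le> of_int (gnorm2 a) / 2 + 1 * (of_int (pnorm2 p) / 2)"
    by (intro add_mono mult_mono norm_gint Cons assms) auto
  finally show ?case by (simp add: add_divide_distrib)
qed simp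

lemma coef_int: "coef C z (int i) = (if i < length C then peval (C ! i) z else 0)"
  by (simp add: coef_def)

lemma coef_minus: "coef C z (- k) = coef C z k" by (simp add: coef_def)

section \<open>Self-convolution of a symmetric family of polynomials\<close>

text \<open>
  The products are grouped in pairs symmetric about \<open>m\<close>.
\<close>

lemma conv_even_index:
  fixes m :: int
  assumes z: "\<And>j. j \<ge> m + int (Suc L) \<Longrightarrow> f j = 0"
  shows "conv f f (2 * m) = f m * f m + 2 * (\<Sum>i<L. f (m + 1 + int i) * f (m - 1 - int i))"
proof -
  let ?g = "\<lambda>j. f j * f (2 * m - j)"
  have "conv f f (2 * m) = infsum ?g {m - int L..m + int L}"
    unfolding conv_def
  proof (rule infsum_cong_neutral)
    fix j assume "j \<in> UNIV - {m - int L..m + int L}"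
    hence "j \<ge> m + int (Suc L) \<or> 2 * m - j \<ge> m + int (Suc L)" by auto
    thus "?g j = 0" using z by auto
  qed auto
  also have "\<dots> = sum ?g {m - int L..m + int L}" by simp
  also have "{m - int L..m + int L} = {m} \<union> ({m + 1..m + int L} \<union> {m - int L..m - 1})" by auto
  also have "sum ?g \<dots> = ?g m + (sum ?g {m + 1..m + int L} + sum ?g {m - int L..m - 1})"
    by (subst sum.union_disjoint, auto)+
  also have "sum ?g {m + 1..m + int L} = (\<Sum>i<L. f (m + 1 + int i) * f (m - 1 - int i))"
    by (rule sum.reindex_bij_witness[of _ "\<lambda>i. m + 1 + int i" "\<lambda>j. nat (j - m - 1)"]) (auto simp: algebra_simps)
  also have "sum ?g {m - int L..m - 1} = (\<Sum>i<L. f (m + 1 + int i) * f (m - 1 - int i))"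
    by (rule sum.reindex_bij_witness[of _ "\<lambda>i. m - 1 - int i" "\<lambda>j. nat (m - 1 - j)"]) (auto simp: algebra_simps)
  finally show ?thesis by (simp add: algebra_simps)
qed

text \<open>
  The products are grouped in pairs symmetric about \<open>m + 1/2\<close>.
\<close>

lemma conv_odd_index:
  fixes m :: int
  assumes z: "\<And>j. j \<ge> m + int (Suc L) \<Longrightarrow> f j = 0"
  shows "conv f f (2 * m + 1) = 2 * (\<Sum>i<L. f (m + 1 + int i) * f (m - int i))"
proof -
  let ?g = "\<lambda>j. f j * f (2 * m + 1 - j)"
  have "conv f f (2 * m + 1) = infsum ?g {m + 1 - int L..m + int L}"
    unfolding conv_def
  proof (rule infsum_cong_neutral)
    fix j assume "j \<in> UNIV - {m + 1 - int L..m + int L}"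
    hence "j \<ge> m + int (Suc L) \<or> 2 * m + 1 - j \<ge> m + int (Suc L)" by auto
    thus "?g j = 0" using z by auto
  qed auto
  also have "\<dots> = sum ?g {m + 1 - int L..m + int L}" by simp
  also have "{m + 1 - int L..m + int L} = {m + 1..m + int L} \<union> {m + 1 - int L..m}" by auto
  also have "sum ?g \<dots> = sum ?g {m + 1..m + int L} + sum ?g {m + 1 - int L..m}"
    by (subst sum.union_disjoint) auto
  also have "sum ?g {m + 1..m + int L} = (\<Sum>i<L. f (m + 1 + int i) * f (m - int i))"
    by (rule sum.reindex_bij_witness[of _ "\<lambda>i. m + 1 + int i" "\<lambda>j. nat (j - m - 1)"]) (auto simp: algebra_simps)
  also have "sum ?g {m + 1 - int L..m} = (\<Sum>i<L. f (m + 1 + int i) * f (m - int i))"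
    by (rule sum.reindex_bij_witness[of _ "\<lambda>i. m - int i" "\<lambda>j. nat (m - j)"]) (auto simp: algebra_simps)
  finally show ?thesis by (simp add: algebra_simps)
qed

lemma peval_dot:
  "length ps \<le> length qs \<Longrightarrow> peval (dot ps qs) z = (\<Sum>i<length ps. peval (ps ! i) z * peval (qs ! i) z)"
  by (induction ps qs rule: dot.induct) (auto simp: peval_padd peval_pmul sum.lessThan_Suc_shift simp del: sum.lessThan_Suc)

lemma length_selfconv: "length (selfconv as bs) = 2 * length as"
  by (induction as bs rule: selfconv.induct) auto

lemma peval_selfconv:
  assumes "\<And>i. i < length as \<Longrightarrow> peval (as ! i) z = f (m + int i)"
    and "\<And>j. j \<ge> m + int (length as) \<Longrightarrow> f j = 0"
    and "\<And>i. i < length bs \<Longrightarrow> peval (bs ! i) z = f (m - 1 - int i)"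
    and "length as \<le> Suc (length bs)" and "n < 2 * length as"
  shows "peval (selfconv as bs ! n) z = conv f f (2 * m + int n)"
  using assms
proof (induction as bs arbitrary: m n rule: selfconv.induct)
  case (2 a as bs)
  have a: "peval a z = f m" using 2(2)[of 0] by simp
  have as: "peval (as ! i) z = f (m + 1 + int i)" if "i < length as" for i
    using 2(2)[of "Suc i"] that by (simp add: algebra_simps)
  have bs': "peval ((a # bs) ! i) z = f (m - int i)" if "i < length (a # bs)" for i
    using 2(4)[of "i - 1"] a that by (cases i) (auto simp: algebra_simps)
  have zero: "f j = 0" if "j \<ge> m + int (Suc (length as))" for j using 2(3) that by simp
  consider "n = 0" | "n = 1" | n' where "n = Suc (Suc n')" by (metis One_nat_def not0_implies_Suc)
  thus ?case
  proof cases
    case 1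
    have "(\<Sum>i<length as. peval (as ! i) z * peval (bs ! i) z) = (\<Sum>i<length as. f (m + 1 + int i) * f (m - 1 - int i))"
      using 2(4,5) as by (intro sum.cong) auto
    thus ?thesis using 1 2(5) conv_even_index[OF zero]
      by (simp add: peval_padd peval_pmul peval_pscale peval_dot a)
  next
    case c2: 2
    have "(\<Sum>i<length as. peval (as ! i) z * peval ((a # bs) ! i) z) = (\<Sum>i<length as. f (m + 1 + int i) * f (m - int i))"
      using 2(5) as bs' by (intro sum.cong refl arg_cong2[of _ _ _ _ "(*)"]) auto
    thus ?thesis using c2 2(5) conv_odd_index[OF zero]
      by (simp add: peval_pscale peval_dot)
  next
    case 3
    have "peval (selfconv as (a # bs) ! n') z = conv f f (2 * (m + 1) + int n')"
    proof (rule "2.IH")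
      show "peval (as ! i) z = f (m + 1 + int i)" if "i < length as" for i using as[OF that] .
      show "f j = 0" if "m + 1 + int (length as) \<le> j" for j using zero that by simp
      show "peval ((a # bs) ! i) z = f (m + 1 - 1 - int i)" if "i < length (a # bs)" for i using bs'[OF that] by simp
    qed (use 2(5,6) 3 in auto)
    thus ?thesis using 3 by (simp add: algebra_simps)
  qed
qed simp

lemma conv_coef:
  assumes "n < 2 * length C"
  shows "peval (selfconv C (tl C) ! n) z = conv (coef C z) (coef C z) (int n)"
  using peval_selfconv[of C z "coef C z" 0 "tl C" n] assms
  by (auto simp: coef_def nth_tl nat_add_distrib algebra_simps)

lemma conv_coef_zero:
  assumes "\<bar>k\<bar> \<ge> 2 * int (length C)" shows "conv (coef C z) (coef C z) k = 0"
proof -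
  have "coef C z j * coef C z (k - j) = 0" for j
  proof (cases "\<bar>j\<bar> < int (length C)")
    case True
    hence "\<bar>k - j\<bar> \<ge> int (length C)" using assms by linarith
    thus ?thesis by (auto simp: coef_def)
  qed (auto simp: coef_def)
  thus ?thesis unfolding conv_def by (rule infsum_0)
qed

lemma conv_even: 
  assumes "\<And>k. f (- k) = f k" shows "conv f f (- k) = conv f f k"
  unfolding conv_def
proof (rule infsum_reindex_bij_witness[of _ uminus uminus])
  fix j show "f (- j) * f (k - - j) = f j * f (- k - j)"
    using assms[of j] assms[of "k + j"] by simp
qed auto

lemma l1_le_two_sided:
  fixes h :: "int \<Rightarrow> complex" and l :: "int list"
  assumes "\<And>i. i < length l \<Longrightarrow> norm (h (int i)) \<le> of_int (l ! i)"
    and even: "\<And>k. h (- k) = h k"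
    and zero: "\<And>i. i \<ge> length l \<Longrightarrow> h (int i) = 0"
  shows "l1_le h (of_int (two_sided l))"
proof (cases l)
  case Nil
  have "h k = 0" for k using zero[of "nat \<bar>k\<bar>"] even[of k] Nil by (cases "k \<ge> 0") auto
  thus ?thesis by (simp add: Nil l1_le_def)
next
  case (Cons a l')
  define n where "n = length l'"
  let ?A = "int ` {1..n}" and ?B = "(\<lambda>i. - int i) ` {1..n}"
  have U: "h k = 0" if "k \<notin> {0} \<union> (?A \<union> ?B)" for k
  proof -
    have "nat \<bar>k\<bar> \<ge> length l"
    proof (rule ccontr)
      assume "\<not> length l \<le> nat \<bar>k\<bar>"
      hence "nat \<bar>k\<bar> \<le> n" by (simp add: Cons n_def)
      moreover have "k \<in> ?A" if "k > 0" "nat \<bar>k\<bar> \<le> n"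
        by (rule image_eqI[of _ _ "nat k"]) (use that in auto)
      moreover have "k \<in> ?B" if "k < 0" "nat \<bar>k\<bar> \<le> n"
        by (rule image_eqI[of _ _ "nat (- k)"]) (use that in auto)
      ultimately show False using that by (cases k "0 :: int" rule: linorder_cases) auto
    qed
    thus ?thesis using zero[of "nat \<bar>k\<bar>"] even[of k] by (cases "k \<ge> 0") auto
  qed
  have le: "(\<Sum>i\<in>{1..n}. norm (h (int i))) \<le> of_int (sum_list l')"
  proof -
    have "(\<Sum>i\<in>{1..n}. norm (h (int i))) = (\<Sum>i<n. norm (h (int (Suc i))))"
      by (rule sum.reindex_bij_witness[of _ Suc "\<lambda>i. i - 1"]) auto
    also have "\<dots> \<le> (\<Sum>i<n. of_int (l' ! i))"
      using assms(1)[of "Suc _"] by (intro sum_mono) (auto simp: Cons n_def)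
    also have "\<dots> = of_int (sum_list l')" by (simp add: sum_list_sum_nth n_def atLeast0LessThan)
    finally show ?thesis .
  qed
  show ?thesis unfolding l1_le_def
  proof (intro allI impI)
    fix F :: "int set" assume F: "finite F"
    have "(\<Sum>k\<in>F. norm (h k)) \<le> (\<Sum>k\<in>F \<union> ({0} \<union> (?A \<union> ?B)). norm (h k))"
      using F by (intro sum_mono2) auto
    also have "\<dots> = (\<Sum>k\<in>{0} \<union> (?A \<union> ?B). norm (h k))"
      using F U by (intro sum.mono_neutral_right) auto
    also have "\<dots> = norm (h 0) + ((\<Sum>k\<in>?A. norm (h k)) + (\<Sum>k\<in>?B. norm (h k)))"
      by (subst sum.union_disjoint, auto)+
    also have "(\<Sum>k\<in>?A. norm (h k)) = (\<Sum>i\<in>{1..n}. norm (h (int i)))"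
      by (subst sum.reindex) (auto simp: inj_on_def)
    also have "(\<Sum>k\<in>?B. norm (h k)) = (\<Sum>i\<in>{1..n}. norm (h (int i)))"
      by (subst sum.reindex) (auto simp: inj_on_def even)
    also have "norm (h 0) \<le> of_int a" using assms(1)[of 0] by (simp add: Cons)
    finally show "(\<Sum>k\<in>F. norm (h k)) \<le> of_int (two_sided l)" using le by (simp add: Cons)
  qed
qed

section \<open>Soundness of the integer inequalities for one time step\<close>

lemma length_defects: "length (defects R S k cs as) = length as"
  by (induction R S k cs as rule: defects.induct) auto

lemma peval_defects:
  "i < length as \<Longrightarrow> peval (defects R S k cs as ! i) z =
     (if i < length cs then of_int S * (of_int R * peval (pder 1 (tl (cs ! i))) z + of_int (k + int i) ^ 2 * peval (cs ! i) z) else 0)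
     - peval (as ! i) z"
proof (induction R S k cs as arbitrary: i rule: defects.induct)
  case (2 R S k a as)
  thus ?case using "2.IH"[of "i - 1"] by (cases i) (auto simp: peval_pscale)
next
  case (3 R S k c cs a as)
  thus ?case using "3.IH"[of "i - 1"]
    by (cases i) (auto simp: peval_pscale peval_padd power2_eq_square add.assoc)
qed simp

text \<open>
  Stated with an offset \<open>j\<close> so that the induction can move along the table.
\<close>

lemma lin_powers_error:
  assumes "length q \<le> length M" "\<And>i. i < length M \<Longrightarrow> norm (Q * \<mu> ^ (j + i) - gint (M ! i)) \<le> 1"
  shows "norm (Q * \<mu> ^ j * peval q \<mu> - gint (lin_powers q M)) \<le> of_int (pnorm2 q) / 2"
  using assms
proof (induction q M arbitrary: j rule: lin_powers.induct)
  case (3 x y p u v M)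
  obtain s t where st: "lin_powers p M = (s, t)" by (cases "lin_powers p M")
  have IH: "norm (Q * \<mu> ^ Suc j * peval p \<mu> - gint (s, t)) \<le> of_int (pnorm2 p) / 2"
    using "3.IH"[of "Suc j"] "3.prems"(1) "3.prems"(2)[of "Suc _"] st by auto
  have "norm (Q * \<mu> ^ j - gint (u, v)) \<le> 1" using "3.prems"(2)[of 0] by simp
  hence A: "norm (gint (x, y) * (Q * \<mu> ^ j - gint (u, v))) \<le> of_int (gnorm2 (x, y)) / 2 * 1"
    unfolding norm_mult by (intro mult_mono norm_gint) (use gnorm2_nonneg[of "(x,y)"] in auto)
  have "Q * \<mu> ^ j * peval ((x, y) # p) \<mu> - gint (lin_powers ((x, y) # p) ((u, v) # M)) =
    gint (x, y) * (Q * \<mu> ^ j - gint (u, v)) + (Q * \<mu> ^ Suc j * peval p \<mu> - gint (s, t))"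
    by (simp add: st gint_simps) (simp add: algebra_simps)
  also have "norm \<dots> \<le> of_int (gnorm2 (x, y)) / 2 * 1 + of_int (pnorm2 p) / 2"
    by (rule norm_triangle_mono[OF A IH])
  finally show ?case by (simp add: add_divide_distrib)
qed (auto simp: gint_simps)

lemma length_jumps: "length (jumps C D) = max (length C) (length D)"
  by (induction C D rule: jumps.induct) auto

lemma peval_jumps:
  "i < length (jumps C D) \<Longrightarrow> peval (jumps C D ! i) z =
    (if i < length C then peval (C ! i) z else 0) - (if i < length D then peval (D ! i) (- z) else 0)"
proof (induction C D arbitrary: i rule: jumps.induct)
  case (2 c cs) thus ?case by (cases i) auto
next
  case (3 d ds) thus ?case by (cases i) (auto simp: peval_pscale peval_pflip)
next
  case (4 c cs d ds) thus ?case by (cases i) (auto simp: peval_pscale peval_pflip peval_padd)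
qed simp

definition power_table :: "complex \<Rightarrow> int \<Rightarrow> gpoly \<Rightarrow> bool" where
  "power_table \<mu> Q M \<longleftrightarrow> Q > 0 \<and> (\<forall>i<length M. norm (of_int Q * \<mu> ^ i - gint (M ! i)) \<le> 1)"

text \<open>
  Passing to the polynomials of the next step moves the reference point without moving the
  solution.
\<close>

lemma jump_sound:
  assumes M: "power_table \<mu> Q M" and ok: "jump_ok Q M C D e e'" and S: "S > 0"
    and a: "l1_le (\<lambda>k. a k - coef C \<mu> k / of_int S) (of_int e / of_int S)"
  shows "l1_le (\<lambda>k. a k - coef D (- \<mu>) k / of_int S) (of_int e' / of_int S)"
proof -
  define J where "J = jumps C D"
  define h where "h k = of_int (2 * Q) * (coef C \<mu> k - coef D (- \<mu>) k)" for k
  have Q: "Q > 0" using M by (simp add: power_table_def)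
  have "l1_le h (of_int (two_sided (map (\<lambda>q. gnorm2 (lin_powers q M) + pnorm2 q) J)))"
  proof (rule l1_le_two_sided)
    show "h (- k) = h k" for k by (simp add: h_def coef_minus)
    show "h (int i) = 0" if "i \<ge> length (map (\<lambda>q. gnorm2 (lin_powers q M) + pnorm2 q) J)" for i
      using that by (simp add: h_def coef_def J_def length_jumps)
    fix i assume "i < length (map (\<lambda>q. gnorm2 (lin_powers q M) + pnorm2 q) J)"
    hence i: "i < length J" by simp
    have "J ! i \<in> set J" using i by simp
    hence len: "length (J ! i) \<le> length M" using ok by (auto simp: jump_ok_def J_def Let_def list_all_iff)
    have "norm (of_int Q * \<mu> ^ 0 * peval (J ! i) \<mu> - gint (lin_powers (J ! i) M)) \<le> of_int (pnorm2 (J ! i)) / 2"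
      by (rule lin_powers_error[OF len]) (use M in \<open>auto simp: power_table_def\<close>)
    hence "norm (of_int Q * peval (J ! i) \<mu>) \<le> of_int (gnorm2 (lin_powers (J ! i) M)) / 2 + of_int (pnorm2 (J ! i)) / 2"
      using norm_gint[of "lin_powers (J ! i) M"] norm_triangle_ineq[of "of_int Q * peval (J ! i) \<mu> - gint (lin_powers (J ! i) M)" "gint (lin_powers (J ! i) M)"]
      by simp
    moreover have "h (int i) = 2 * (of_int Q * peval (J ! i) \<mu>)"
      using peval_jumps[of i C D \<mu>] i by (simp add: h_def coef_def J_def)
    ultimately show "norm (h (int i)) \<le> of_int (map (\<lambda>q. gnorm2 (lin_powers q M) + pnorm2 q) J ! i)"
      using i by (simp only: norm_mult) simp
  qed
  moreover have "two_sided (map (\<lambda>q. gnorm2 (lin_powers q M) + pnorm2 q) J) \<le> 2 * Q * (e' - e)"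
    using ok by (simp add: jump_ok_def J_def Let_def)
  ultimately have "l1_le h (of_int (2 * Q * (e' - e)))" using l1_le_mono of_int_le_iff by blast
  note l1 = l1_le_cmult[OF this, of "1 / (of_int (2 * Q) * of_int S)"]
  have "norm (1 / (complex_of_int (2 * Q) * of_int S)) * real_of_int (2 * Q * (e' - e)) = (of_int e' - of_int e) / of_int S"
    using Q S by (simp add: norm_divide norm_mult)
  moreover have "1 / (complex_of_int (2 * Q) * of_int S) * h k = coef C \<mu> k / of_int S - coef D (- \<mu>) k / of_int S" for k
    using Q S by (simp add: h_def diff_divide_distrib)
  ultimately have "l1_le (\<lambda>k. coef C \<mu> k / of_int S - coef D (- \<mu>) k / of_int S) ((of_int e' - of_int e) / of_int S)"
    using l1 by (simp only:)
  from l1_le_triangle[OF a this] show ?thesis by (simp add: diff_divide_distrib)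
qed

lemma growth_sound:
  assumes ok: "growth_ok Q m C L" and m: "norm (of_int Q * \<mu> - gint m) \<le> 1" "Q > 0" and S: "S > 0"
    and mu: "norm \<mu> = 1" and z: "norm z \<le> 1"
  shows "2 * Re (\<mu> * (coef C z 0 / of_int S)) + 2 * (of_int (sum_list (map pnorm2 (tl C))) / of_int S) \<le> of_int L / of_int S"
proof -
  from ok obtain u v x y p Cs where eq: "m = (u, v)" "C = ((x, y) # p) # Cs"
    and le: "2 * (u * x - v * y + \<bar>x\<bar> + \<bar>y\<bar>) \<le> Q * (L - pnorm2 p - 2 * sum_list (map pnorm2 Cs))"
    by (cases "(Q, m, C, L)" rule: growth_ok.cases) auto
  have "coef C z 0 = gint (x, y) + z * peval p z" by (simp add: coef_def eq)
  hence f1: "Re (\<mu> * coef C z 0) = Re (\<mu> * gint (x, y)) + Re (\<mu> * (z * peval p z))" by (simp only: distrib_left plus_complex.sel)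
  have f2: "Re (\<mu> * (z * peval p z)) \<le> of_int (pnorm2 p) / 2"
  proof -
    have "Re (\<mu> * (z * peval p z)) \<le> norm (\<mu> * (z * peval p z))" by (rule complex_Re_le_cmod)
    also have "\<dots> = norm z * norm (peval p z)" by (simp add: norm_mult mu)
    also have "\<dots> \<le> 1 * (of_int (pnorm2 p) / 2)" by (intro mult_mono z norm_peval[OF z]) auto
    finally show ?thesis by simp
  qed
  have f3: "of_int Q * Re (\<mu> * gint (x, y)) \<le> of_int (u * x - v * y + \<bar>x\<bar> + \<bar>y\<bar>)"
  proof -
    have "of_int Q * Re (\<mu> * gint (x, y)) = Re (gint (u, v) * gint (x, y)) + Re ((of_int Q * \<mu> - gint m) * gint (x, y))"
      by (simp add: eq algebra_simps gint.simps)
    moreover have "Re ((of_int Q * \<mu> - gint m) * gint (x, y)) \<le> norm ((of_int Q * \<mu> - gint m) * gint (x, y))"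
      by (rule complex_Re_le_cmod)
    moreover have "norm ((of_int Q * \<mu> - gint m) * gint (x, y)) \<le> 1 * (\<bar>of_int x\<bar> + \<bar>of_int y\<bar>)"
      unfolding norm_mult using cmod_le[of "gint (x, y)"] by (intro mult_mono m) (auto simp: gint.simps)
    ultimately show ?thesis by (simp add: gint.simps)
  qed
  have gen: "q * (2 * a) \<le> 2 * n + q * l" if "a = A + B" "B \<le> l / 2" "q * A \<le> n" "0 < q" for a A B l n q :: real
  proof -
    have "q * B \<le> q * (l / 2)" using that by (intro mult_left_mono) auto
    moreover have "q * (l / 2) = q * l / 2" by simp
    moreover have "q * (2 * a) = 2 * (q * A) + 2 * (q * B)" by (simp add: that(1) algebra_simps)
    ultimately show ?thesis using that(3) by linarith
  qed
  have "of_int Q * (2 * Re (\<mu> * coef C z 0)) \<le> 2 * of_int (u * x - v * y + \<bar>x\<bar> + \<bar>y\<bar>) + of_int Q * of_int (pnorm2 p)"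
    by (rule gen[OF f1 f2 f3]) (use m(2) in simp)
  also have "\<dots> = of_int (2 * (u * x - v * y + \<bar>x\<bar> + \<bar>y\<bar>)) + of_int Q * of_int (pnorm2 p)" by simp
  also have "\<dots> \<le> of_int (Q * (L - pnorm2 p - 2 * sum_list (map pnorm2 Cs))) + of_int Q * of_int (pnorm2 p)"
    using le by (intro add_right_mono) (simp only: of_int_le_iff)
  also have "\<dots> = of_int Q * (of_int L - 2 * of_int (sum_list (map pnorm2 Cs)))" by (simp add: algebra_simps)
  finally have "2 * Re (\<mu> * coef C z 0) \<le> of_int L - 2 * of_int (sum_list (map pnorm2 Cs))" using m(2) by simp
  hence "(2 * Re (\<mu> * coef C z 0) + 2 * of_int (sum_list (map pnorm2 Cs))) / of_int S \<le> of_int L / of_int S"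
    using S by (intro divide_right_mono) auto
  moreover have "Re (\<mu> * (coef C z 0 / of_int S)) = Re (\<mu> * coef C z 0) / of_int S"
  proof -
    have r: "complex_of_int S = of_real (of_int S)" by simp
    show ?thesis unfolding r times_divide_eq_right by (rule Re_divide_of_real)
  qed
  ultimately show ?thesis by (simp only: eq list.sel add_divide_distrib times_divide_eq_right)
qed

text \<open>
  The polynomials are functions of \<open>\<eta> = \<mu> (R t - 1)\<close>, which runs through a diameter of the
  unit disc during a step of length \<open>2 / R\<close>. Differentiating in time produces the factor
  \<open>\<mu> R\<close>, so \<open>\<mu>\<close> can be divided out of the equation and the defect is a polynomial with
  integer coefficients.
\<close>

lemma step_sound:
  assumes mu: "norm \<mu> = 1" "Re \<mu> > 0" and m: "norm (of_int Q * \<mu> - gint m) \<le> 1" "Q > 0" and S: "S > 0"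
    and ok: "step_ok Q m S R C e e' L x"
    and a: "l1_le (\<lambda>k. a k - coef C (- \<mu>) k / of_int S) (of_int e / of_int S)"
  shows "\<exists>b. mode_solution \<mu> (2 / of_int R) b \<and> b 0 = a \<and>
    l1_le (\<lambda>k. b (2 / of_int R) k - coef C \<mu> k / of_int S) (of_int e' / of_int S)"
proof -
  define T where "T = 2 / real_of_int R"
  define D where "D = defects R S 0 C (selfconv C (tl C))"
  define \<Delta> where "\<Delta> = two_sided (map pnorm2 D)"
  have R: "R > 0" and e: "e > 0" and x: "0 \<le> x" "x < 1024" and gr: "growth_ok Q m C L"
    and e': "e * 1024 ^ 16 \<le> e' * (1024 - x) ^ 16"
    and key: "128 * e * (L + e') + 64 * \<Delta> \<le> x * R * S * e"
    using ok by (auto simp: step_ok_def \<Delta>_def D_def)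
  define s where "s = real_of_int S"
  have s: "s > 0" using S by (simp add: s_def)
  define \<eta> where "\<eta> t = \<mu> * of_real (of_int R * t - 1)" for t
  define U where "U = (\<lambda>t k. coef C (\<eta> t) k / of_real s)"
  define d where "d = (\<lambda>t k. \<mu> * coef D (\<eta> t) k / of_real (s * s))"
  define y where "y = real_of_int x * of_int R / 2048"
  define \<rho> where "\<rho> t = of_int e / s / (1 - y * t) ^ 16" for t
  define r where "r t = 16 * y * (of_int e / s) / (1 - y * t) ^ 17" for t
  define W where "W = of_int (sum_list (map pnorm2 (tl C))) / s"
  define \<delta> where "\<delta> = of_int \<Delta> / (2 * (s * s))"
  have T0: "T \<ge> 0" using R by (simp add: T_def)
  have y0: "y \<ge> 0" using x R by (simp add: y_def)
  have yT: "y * T = of_int x / 1024" using R by (simp add: y_def T_def)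
  have yt: "0 \<le> y * t" "y * t \<le> of_int x / 1024" "1 - y * t > 0" if "t \<in> {0..T}" for t
  proof -
    show "0 \<le> y * t" using y0 that by simp
    show "y * t \<le> of_int x / 1024" using mult_left_mono[of t T y] y0 that yT by simp
    moreover have "real_of_int x / 1024 < 1" using x by simp
    ultimately show "1 - y * t > 0" by linarith
  qed
  have eta: "norm (\<eta> t) \<le> 1" if "t \<in> {0..T}" for t
  proof -
    have "0 \<le> of_int R * t" "of_int R * t \<le> 2" using that R by (auto simp: T_def field_simps)
    thus ?thesis unfolding \<eta>_def norm_mult mu norm_of_real by auto
  qed
  have deta: "(\<eta> has_vector_derivative \<mu> * of_int R) (at t within A)" for t A
    unfolding \<eta>_def by (auto intro!: derivative_eq_intros)
  have lenD: "length D = 2 * length C" by (simp add: D_def length_defects length_selfconv)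
  have tube: "tube \<mu> T U d \<rho> r (\<lambda>t. W) (\<lambda>t. \<delta>) (\<lambda>k. if nat \<bar>k\<bar> < length C then of_int (pnorm2 (C ! nat \<bar>k\<bar>)) / 2 / s else 0) a"
  proof (unfold_locales, goal_cases)
    case (4 t k)
    define c where "c = coef C (\<eta> t)"
    define c' where "c' = (if nat \<bar>k\<bar> < length C then peval (pder 1 (tl (C ! nat \<bar>k\<bar>))) (\<eta> t) else 0)"
    have "((\<lambda>t. coef C (\<eta> t) k) has_vector_derivative (\<mu> * of_int R) * c') (at t within {0..T})"
    proof (cases "nat \<bar>k\<bar> < length C")
      case True
      have "((peval (C ! nat \<bar>k\<bar>) \<circ> \<eta>) has_vector_derivative (\<mu> * of_int R) * peval (pder 1 (tl (C ! nat \<bar>k\<bar>))) (\<eta> t)) (at t within {0..T})"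
        by (rule field_vector_diff_chain_within[OF deta DERIV_subset[OF DERIV_peval subset_UNIV]])
      thus ?thesis using True by (simp add: c'_def coef_def o_def)
    qed (simp add: c'_def coef_def)
    hence dU: "((\<lambda>t. U t k) has_vector_derivative (\<mu> * of_int R) * c' / of_real s) (at t within {0..T})"
      unfolding U_def by (rule has_vector_derivative_divide)
    have cvU: "conv (U t) (U t) k = conv c c k / of_real (s * s)"
    proof -
      have "conv (U t) (U t) k = (\<Sum>\<^sub>\<infinity>j. (1 / of_real (s * s)) * (c j * c (k - j)))"
        unfolding conv_def U_def c_def by (rule infsum_cong) simp
      thus ?thesis by (simp only: infsum_cmult_right' conv_def[symmetric]) simp
    qed
    have cD: "coef D (\<eta> t) k = of_real s * (of_int R * c' + of_int k ^ 2 * c k) - conv c c k"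
    proof (cases "nat \<bar>k\<bar> < 2 * length C")
      case True
      have "conv c c (int (nat \<bar>k\<bar>)) = conv c c k"
        using conv_even[of c k] by (cases "k \<ge> 0") (auto simp: c_def coef_minus)
      moreover have "coef D (\<eta> t) k = peval (D ! nat \<bar>k\<bar>) (\<eta> t)" using True lenD by (simp add: coef_def)
      moreover have "of_int (int (nat \<bar>k\<bar>)) ^ 2 = (of_int k ^ 2 :: complex)"
        by (simp add: of_int_power[symmetric] del: of_int_power)
      ultimately show ?thesis using True peval_defects[of "nat \<bar>k\<bar>" "selfconv C (tl C)" R S 0 C "\<eta> t"]
        conv_coef[of "nat \<bar>k\<bar>" C "\<eta> t"] lenD
        by (auto simp: D_def length_selfconv c'_def c_def coef_def[of C] s_def simp del: of_int_of_nat_eq int_nat_eq)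
    next
      case False
      have "conv c c k = 0" unfolding c_def by (rule conv_coef_zero) (use False in auto)
      thus ?thesis using False lenD by (auto simp: coef_def[of D] c'_def c_def coef_def[of C])
    qed
    have "(\<mu> * of_int R) * c' / of_real s = \<mu> * (conv (U t) (U t) k - of_int k ^ 2 * U t k) + d t k"
    proof -
      have Uk: "U t k = c k / of_real s" by (simp add: U_def c_def)
      have dk: "d t k = \<mu> * (of_real s * (of_int R * c' + of_int k ^ 2 * c k) - conv c c k) / of_real (s * s)"
        by (simp only: d_def cD)
      show ?thesis unfolding cvU Uk dk using s by (simp add: field_simps)
    qed
    thus ?case using dU by simp
  next
    case (5 t k)
    have "norm (U t k) = norm (coef C (\<eta> t) k) / s" using s by (simp add: U_def norm_divide)
    also have "\<dots> \<le> (if nat \<bar>k\<bar> < length C then of_int (pnorm2 (C ! nat \<bar>k\<bar>)) / 2 else 0) / s"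
      using norm_peval[OF eta[OF 5]] s by (intro divide_right_mono) (auto simp: coef_def)
    finally show ?case by (simp split: if_splits)
  next
    case 6
    show ?case by (rule finite_nonzero_values_imp_summable_on, rule finite_subset[of _ "{- int (length C)..int (length C)}"]) auto
  next
    case (7 t)
    have "((\<lambda>t. of_int e / s / (1 - y * t) ^ 16) has_real_derivative r t) (at t within {0..T})"
    proof -
      have nz: "1 - y * t \<noteq> 0" using yt(3)[OF 7] by simp
      define v where "v = (\<lambda>t. inverse (1 - y * t))"
      have dv: "(v has_real_derivative y * v t * v t) (at t within {0..T})"
        unfolding v_def using nz by (auto intro!: derivative_eq_intros)
      have "((\<lambda>t. of_int e / s * v t ^ 16) has_real_derivative 16 * y * (of_int e / s) * v t ^ 17) (at t within {0..T})"
        by (rule DERIV_cong[OF DERIV_cmult[OF DERIV_power[OF dv]]]) (simp add: numeral_eq_Suc)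
      thus ?thesis by (simp add: v_def r_def power_inverse divide_inverse)
    qed
    thus ?case by (simp add: \<rho>_def[abs_def])
  next
    case (8 t) thus ?case using yt(3)[OF 8] e s by (simp add: \<rho>_def)
  next
    case 9
    show ?case using a by (simp add: U_def \<eta>_def \<rho>_def s_def)
  next
    case (10 t)
    have "l1_le (\<lambda>k. if k = 0 then 0 else 2 * coef C (\<eta> t) k) (of_int (two_sided (0 # map pnorm2 (tl C))))"
    proof (rule l1_le_two_sided)
      fix i assume "i < length (0 # map pnorm2 (tl C))"
      thus "norm (if int i = 0 then 0 else 2 * coef C (\<eta> t) (int i)) \<le> of_int ((0 # map pnorm2 (tl C)) ! i)"
        using norm_peval[OF eta[OF 10], of "C ! i"] by (cases i) (auto simp: coef_int norm_mult nth_tl simp del: of_nat_Suc)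
    next
      fix i assume "length (0 # map pnorm2 (tl C)) \<le> i"
      thus "(if int i = 0 then 0 else 2 * coef C (\<eta> t) (int i)) = 0" by (auto simp: coef_def)
    qed (auto simp: coef_minus)
    from l1_le_cmult[OF this, of "1 / of_real (2 * s)"]
    have "l1_le (\<lambda>k. 1 / of_real (2 * s) * (if k = 0 then 0 else 2 * coef C (\<eta> t) k)) W"
      using s by (simp add: W_def norm_divide)
    moreover have "(\<lambda>k. 1 / of_real (2 * s) * (if k = 0 then 0 else 2 * coef C (\<eta> t) k)) = (\<lambda>k. if k = 0 then 0 else U t k)"
      using s by (auto simp: U_def fun_eq_iff)
    ultimately show ?case by simp
  next
    case (11 t)
    have "l1_le (\<lambda>k. 2 * coef D (\<eta> t) k) (of_int \<Delta>)"
      unfolding \<Delta>_def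
    proof (rule l1_le_two_sided)
      fix i assume "i < length (map pnorm2 D)"
      thus "norm (2 * coef D (\<eta> t) (int i)) \<le> of_int (map pnorm2 D ! i)"
        using norm_peval[OF eta[OF 11], of "D ! i"] by (auto simp: coef_def norm_mult)
    qed (auto simp: coef_minus, auto simp: coef_def)
    from l1_le_cmult[OF this, of "\<mu> / of_real (2 * (s * s))"]
    show ?case using s mu by (simp add: d_def \<delta>_def norm_divide norm_mult)
  next
    case (12 t)
    note yt12 = yt[OF 12]
    define q where "q = 1 - y * t"
    have q: "0 < q" "q \<le> 1" using yt12 by (auto simp: q_def)
    have rho_lo: "of_int e / s \<le> \<rho> t"
    proof -
      have "q ^ 16 \<le> 1" using q by (intro power_le_one) auto
      hence "of_int e / s / 1 \<le> of_int e / s / q ^ 16" using q e s by (intro divide_left_mono) auto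
      thus ?thesis by (simp add: \<rho>_def q_def)
    qed
    have rho_hi: "\<rho> t \<le> of_int e' / s"
    proof -
      have "((1024 - of_int x) / 1024) ^ 16 \<le> q ^ 16"
        using yt12 x by (intro power_mono) (auto simp: q_def)
      hence "(1024 - of_int x) ^ 16 / 1024 ^ 16 \<le> q ^ 16" by (simp only: power_divide)
      hence q2: "of_int (1024 - x) ^ 16 \<le> 1024 ^ 16 * q ^ 16" by simp
      have "e' \<ge> 0" using e' e x
        by (smt (verit) mult_nonneg_nonneg mult_less_0_iff zero_less_power)
      have "of_int (e * 1024 ^ 16) \<le> (of_int (e' * (1024 - x) ^ 16) :: real)" using e' by (simp only: of_int_le_iff)
      also have "\<dots> = of_int e' * of_int (1024 - x) ^ 16" by simp
      also have "\<dots> \<le> of_int e' * (1024 ^ 16 * q ^ 16)" using q2 \<open>e' \<ge> 0\<close> by (intro mult_left_mono) auto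
      finally have "of_int e \<le> of_int e' * q ^ 16" by simp
      hence "of_int e / q ^ 16 \<le> of_int e'" using q by (simp add: pos_divide_le_eq)
      hence "of_int e / q ^ 16 / s \<le> of_int e' / s" using s by (intro divide_right_mono) auto
      thus ?thesis by (simp add: \<rho>_def q_def mult.commute)
    qed
    have gs: "2 * Re (\<mu> * U t 0) + 2 * W \<le> of_int L / s"
      using growth_sound[OF gr m S mu(1) eta[OF 12]] by (simp add: U_def W_def s_def)
    have "real_of_int (128 * e * (L + e') + 64 * \<Delta>) \<le> of_int (x * R * S * e)" using key by (simp only: of_int_le_iff)
    hence k1: "128 * of_int e * (of_int L + of_int e') + 64 * of_int \<Delta> \<le> of_int x * of_int R * s * of_int e" by (simp add: s_def)
    have k2: "of_int \<Delta> / (2 * s * of_int e) \<le> 16 * y - of_int L / s - of_int e' / s"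
    proof -
      have "(128 * of_int e * (of_int L + of_int e') + 64 * of_int \<Delta>) / (128 * s * of_int e) \<le>
         (of_int x * of_int R * s * of_int e) / (128 * s * of_int e)"
        using k1 s e by (intro divide_right_mono) auto
      moreover have "(of_int x * of_int R * s * of_int e) / (128 * s * of_int e) = 16 * y" using s e by (simp add: y_def)
      moreover have "(128 * of_int e * (of_int L + of_int e') + 64 * of_int \<Delta>) / (128 * s * of_int e)
        = of_int L / s + of_int e' / s + of_int \<Delta> / (2 * s * of_int e)" using s e by (simp add: field_simps)
      ultimately show ?thesis by linarith
    qed
    have D0: "\<Delta> \<ge> 0" using l1_le_nonneg[OF l1_le_two_sided[of "map pnorm2 D" "\<lambda>_. 0"]] pnorm2_nonneg by (auto simp: \<Delta>_def)
    have "\<delta> = of_int \<Delta> / (2 * s * of_int e) * (of_int e / s)" using s e by (simp add: \<delta>_def field_simps)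
    also have "\<dots> \<le> (16 * y - of_int L / s - of_int e' / s) * \<rho> t"
    proof (rule mult_mono[OF k2 rho_lo])
      show "0 \<le> 16 * y - of_int L / s - of_int e' / s" by (rule order_trans[OF _ k2]) (use e s D0 in auto)
      show "0 \<le> of_int e / s" using e s by simp
    qed
    also have "\<dots> \<le> (16 * y - (2 * Re (\<mu> * U t 0) + 2 * W) - \<rho> t) * \<rho> t"
      using gs rho_hi rho_lo e s by (intro mult_right_mono) (auto intro: order_trans[OF _ rho_lo])
    finally have "(2 * Re (\<mu> * U t 0) + 2 * W) * \<rho> t + \<rho> t ^ 2 + \<delta> \<le> 16 * y * \<rho> t"
      by (simp add: power2_eq_square algebra_simps)
    also have "\<dots> \<le> 16 * y * \<rho> t / q" using q y0 rho_lo e s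
      by (simp add: pos_le_divide_eq mult_left_le order_trans[OF _ rho_lo])
    also have "\<dots> = r t"
    proof -
      have "q ^ 17 = q ^ 16 * q" by (simp add: numeral_eq_Suc)
      thus ?thesis by (simp add: r_def \<rho>_def flip: q_def)
    qed
    finally show ?case .
  qed (use mu T0 in auto)
  have "l1_le (\<lambda>k. picard_lim \<mu> U a T k - U T k) (\<rho> T)"
    by (rule tube.picard_lim_solution(3)[OF tube]) (use T0 in auto)
  moreover have "\<rho> T \<le> of_int e' / s"
  proof -
    have x': "real_of_int (1024 - x) > 0" using x by simp
    have "real_of_int (e * 1024 ^ 16) \<le> of_int (e' * (1024 - x) ^ 16)" using e' by (simp only: of_int_le_iff)
    hence "of_int e * 1024 ^ 16 \<le> of_int e' * real_of_int (1024 - x) ^ 16" by simp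
    hence "of_int e \<le> of_int e' * (real_of_int (1024 - x) ^ 16 / 1024 ^ 16)" by simp
    also have "real_of_int (1024 - x) ^ 16 / 1024 ^ 16 = (1 - y * T) ^ 16"
    proof -
      have "1 - y * T = real_of_int (1024 - x) / 1024" by (simp add: yT diff_divide_distrib)
      thus ?thesis by (simp only: power_divide)
    qed
    finally show ?thesis using x s yt(3)[of T] T0 by (simp add: \<rho>_def field_simps)
  qed
  moreover have "U T = (\<lambda>k. coef C \<mu> k / of_int S)"
    using R by (simp add: U_def \<eta>_def T_def s_def)
  ultimately have "l1_le (\<lambda>k. picard_lim \<mu> U a T k - coef C \<mu> k / of_int S) (of_int e' / of_int S)"
    by (auto intro: l1_le_mono simp: s_def)
  thus ?thesis using tube.picard_lim_solution(1,2)[OF tube] unfolding T_def by blast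
qed

section \<open>The initial data\<close>

text \<open>
  The modes of the initial data divided by \<open>4 \<pi>\<^sup>2\<close>.
\<close>

definition init_modes :: "int \<Rightarrow> complex" where
  "init_modes k = of_real (if k = 0 then 25 / (2 * pi\<^sup>2) else if \<bar>k\<bar> = 1 then - 25 / (4 * pi\<^sup>2) else 0)"

text \<open>
  The exact solution exists up to some time at which it is within \<open>e / S\<close> of the right end of
  the approximation \<open>C\<close>. The time is existentially quantified because the terminal condition
  concerns the state only.
\<close>

definition reached :: "complex \<Rightarrow> int \<Rightarrow> gpoly list \<Rightarrow> int \<Rightarrow> bool" where
  "reached \<mu> S C e \<longleftrightarrow> (\<exists>T\<ge>0. \<exists>b. mode_solution \<mu> T b \<and> b 0 = init_modes \<and>
     l1_le (\<lambda>k. b T k - coef C \<mu> k / of_int S) (of_int e / of_int S))"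

text \<open>
  The derivative of the difference is the geometric remainder \<open>\<plusminus> y ^ n / (1 + y\<^sup>2)\<close>.
\<close>

lemma arctan_taylor_bounds:
  fixes x :: real assumes "x \<ge> 0"
  shows "x - x^3/3 + x^5/5 - x^7/7 + x^9/9 - x^11/11 \<le> arctan x"
    and "arctan x \<le> x - x^3/3 + x^5/5 - x^7/7 + x^9/9"
proof -
  define p where "p = (\<lambda>x::real. x - x^3/3 + x^5/5 - x^7/7 + x^9/9)"
  have dp: "(p has_real_derivative 1 - x^2 + x^4 - x^6 + x^8) (at x)" for x
    unfolding p_def by (auto intro!: derivative_eq_intros)
  have pos: "1 + x^2 > 0" for x :: real by (simp add: add_pos_nonneg)
  have "arctan 0 - (p 0 - 0^11/11) \<le> arctan x - (p x - x^11/11)"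
  proof (rule DERIV_nonneg_imp_nondecreasing[OF assms])
    fix y :: real
    have "((\<lambda>x. arctan x - (p x - x^11/11)) has_real_derivative 1 / (1 + y^2) - ((1 - y^2 + y^4 - y^6 + y^8) - y^10)) (at y)"
      by (auto intro!: derivative_eq_intros dp simp: inverse_eq_divide)
    moreover have "1 / (1 + y^2) - ((1 - y^2 + y^4 - y^6 + y^8) - y^10) = y^12 / (1 + y^2)"
      using pos[of y] by (simp add: field_simps flip: power_add)
    ultimately show "\<exists>z. ((\<lambda>x. arctan x - (p x - x^11/11)) has_real_derivative z) (at y) \<and> 0 \<le> z"
      using pos[of y] by auto
  qed
  thus "x - x^3/3 + x^5/5 - x^7/7 + x^9/9 - x^11/11 \<le> arctan x" by (simp add: p_def)
  have "p 0 - arctan 0 \<le> p x - arctan x"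
  proof (rule DERIV_nonneg_imp_nondecreasing[OF assms])
    fix y :: real
    have "((\<lambda>x. p x - arctan x) has_real_derivative (1 - y^2 + y^4 - y^6 + y^8) - 1 / (1 + y^2)) (at y)"
      by (auto intro!: derivative_eq_intros dp simp: inverse_eq_divide)
    moreover have "(1 - y^2 + y^4 - y^6 + y^8) - 1 / (1 + y^2) = y^10 / (1 + y^2)"
      using pos[of y] by (simp add: field_simps flip: power_add)
    ultimately show "\<exists>z. ((\<lambda>x. p x - arctan x) has_real_derivative z) (at y) \<and> 0 \<le> z"
      using pos[of y] by auto
  qed
  thus "arctan x \<le> x - x^3/3 + x^5/5 - x^7/7 + x^9/9" by (simp add: p_def)
qed

lemma pi_bounds: "31415926 / 10^7 \<le> pi" "pi \<le> 31415928 / 10^7"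
  using arctan_taylor_bounds[of "1/5"] arctan_taylor_bounds[of "1/239"] machin
  by (simp_all add: power_divide)

text \<open>
  The initial modes involve \<open>\<pi>\<^sup>2\<close>; the two inequalities place them within \<open>w / S\<close> of
  rational numbers.
\<close>

lemma reached_start:
  assumes S: "S > 0" and lo: "(2 * i - w) * (2 * 31415928\<^sup>2) \<le> S * 25 * 10 ^ 14"
    and hi: "S * 25 * 10 ^ 14 \<le> (2 * i + w) * (2 * 31415926\<^sup>2)" and w: "0 \<le> w" "w \<le> 2 * i"
  shows "reached \<mu> S [[(2 * i, 0)], [(- i, 0)]] (2 * w)"
proof -
  define s where "s = real_of_int S"
  define q where "q = s * (25 / (2 * pi\<^sup>2))"
  have s: "s > 0" using S by (simp add: s_def)
  have pi2: "(31415926 / 10^7)\<^sup>2 \<le> pi\<^sup>2" "pi\<^sup>2 \<le> (31415928 / 10^7)\<^sup>2"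
    using pi_bounds by (auto intro!: power_mono)
  have "real_of_int ((2 * i - w) * (2 * 31415928\<^sup>2)) \<le> of_int (S * 25 * 10 ^ 14)" using lo by (simp only: of_int_le_iff)
  hence l1: "real_of_int (2 * i - w) * (2 * (31415928 / 10^7)\<^sup>2) \<le> s * 25" by (simp add: s_def power_divide)
  have l2: "real_of_int (2 * i - w) * (2 * pi\<^sup>2) \<le> real_of_int (2 * i - w) * (2 * (31415928 / 10^7)\<^sup>2)"
    using w by (intro mult_left_mono mult_left_mono pi2) auto
  have l: "real_of_int (2 * i - w) \<le> q" using order_trans[OF l2 l1] by (simp add: q_def pos_le_divide_eq)
  have "of_int (S * 25 * 10 ^ 14) \<le> real_of_int ((2 * i + w) * (2 * 31415926\<^sup>2))" using hi by (simp only: of_int_le_iff)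
  hence "s * 25 \<le> real_of_int (2 * i + w) * (2 * (31415926 / 10^7)\<^sup>2)" by (simp add: s_def power_divide)
  also have "\<dots> \<le> real_of_int (2 * i + w) * (2 * pi\<^sup>2)"
    using w by (intro mult_left_mono mult_left_mono pi2) auto
  finally have h: "q \<le> real_of_int (2 * i + w)" by (simp add: q_def pos_divide_le_eq)
  let ?C = "[[(2 * i, 0)], [(- i, 0)]]"
  define d where "d k = 2 * (of_real s * init_modes k - coef ?C \<mu> k)" for k
  have "l1_le d (of_int (two_sided [2 * w, w]))"
  proof (rule l1_le_two_sided)
    show "d (- k) = d k" for k by (simp add: d_def init_modes_def coef_minus)
    show "d (int j) = 0" if "length [2 * w, w] \<le> j" for j
      using that by (auto simp: d_def init_modes_def coef_int)
    fix j assume "j < length [2 * w, w]"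
    hence "j = 0 \<or> j = 1" by auto
    moreover have "d 0 = of_real (2 * (q - of_int (2 * i)))"
      by (simp add: d_def init_modes_def coef_def gint.simps q_def complex_eq_iff)
    moreover have "d 1 = of_real (- (q - of_int (2 * i)))"
      by (simp add: d_def init_modes_def coef_def gint.simps q_def complex_eq_iff)
    ultimately show "norm (d (int j)) \<le> of_int ([2 * w, w] ! j)"
      using l h by (auto simp: norm_of_real simp del: of_real_mult of_real_diff of_real_minus)
  qed
  from l1_le_cmult[OF this, of "1 / (2 * of_real s)"]
  have "l1_le (\<lambda>k. 1 / (2 * of_real s) * d k) (of_int (2 * w) / s)" using s by (simp add: norm_divide norm_mult)
  moreover have "1 / (2 * of_real s) * d k = init_modes k - coef ?C \<mu> k / of_int S" for k
    using s by (simp add: d_def s_def diff_divide_distrib)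
  ultimately have l1: "l1_le (\<lambda>k. init_modes k - coef ?C \<mu> k / of_int S) (of_int (2 * w) / of_int S)"
    by (simp only: s_def)
  have "mode_solution \<mu> 0 (\<lambda>t. init_modes)"
    unfolding mode_solution_def
  proof (intro conjI exI[of _ "\<lambda>k. norm (init_modes k)"] ballI allI)
    show "(\<lambda>k. norm (init_modes k)) summable_on UNIV"
      by (rule finite_nonzero_values_imp_summable_on, rule finite_subset[of _ "{-1..1}"]) (auto simp: init_modes_def split: if_splits)
  qed (auto simp: has_vector_derivative_def has_derivative_within_singleton_iff intro!: bounded_linear_scaleR_left)
  thus ?thesis unfolding reached_def using l1 by (intro exI[of _ 0] conjI) auto
qed

section \<open>Chaining the steps\<close>

definition advance_ok :: "int \<Rightarrow> gpoly \<Rightarrow> int \<Rightarrow> gpoly list \<Rightarrow> int \<Rightarrow> int \<Rightarrow> gpoly list \<Rightarrow> int \<Rightarrow> int \<Rightarrow> int \<Rightarrow> int \<Rightarrow> bool" where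
  "advance_ok Q M S C e R D e1 e2 L x \<longleftrightarrow>
     jump_ok Q M C D e e1 \<and> 1 < length M \<and> step_ok Q (hd (tl M)) S R D e1 e2 L x"

lemma reached_advance:
  assumes re: "reached \<mu> S C e" and ok: "advance_ok Q M S C e R D e1 e2 L x"
    and M: "power_table \<mu> Q M" and S: "S > 0" and mu: "norm \<mu> = 1" "Re \<mu> > 0"
  shows "reached \<mu> S D e2"
proof -
  from re obtain T b where T: "T \<ge> 0" and b: "mode_solution \<mu> T b" "b 0 = init_modes"
    and l: "l1_le (\<lambda>k. b T k - coef C \<mu> k / of_int S) (of_int e / of_int S)"
    unfolding reached_def by blast
  have j: "jump_ok Q M C D e e1" and st: "step_ok Q (hd (tl M)) S R D e1 e2 L x" and len: "1 < length M"
    using ok by (auto simp: advance_ok_def)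
  have hd: "hd (tl M) = M ! 1" using len by (cases M; cases "tl M") auto
  have m: "norm (of_int Q * \<mu> - gint (hd (tl M))) \<le> 1" "Q > 0"
    using M len unfolding power_table_def hd by (metis power_one_right, simp)
  have R: "R > 0" using st by (simp add: step_ok_def)
  from step_sound[OF mu m S st jump_sound[OF M j S l]] obtain b2 where
    b2: "mode_solution \<mu> (2 / of_int R) b2" "b2 0 = b T"
      "l1_le (\<lambda>k. b2 (2 / of_int R) k - coef D \<mu> k / of_int S) (of_int e2 / of_int S)" by blast
  have h: "2 / real_of_int R > 0" using R by simp
  define b' where "b' = (\<lambda>t. if t \<in> {0..T} then b t else b2 (t - T))"
  have "mode_solution \<mu> (T + 2 / of_int R) b'"
    unfolding b'_def by (rule mode_solution_continue[OF b(1) b2(1,2)]) (use T h in auto)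
  moreover have "b' 0 = init_modes" using T b by (simp add: b'_def)
  moreover have "b' (T + 2 / of_int R) = b2 (2 / of_int R)" using h by (simp add: b'_def)
  ultimately show ?thesis unfolding reached_def using b2(3) T h
    by (intro exI[of _ "T + 2 / of_int R"] conjI exI[of _ b']) auto
qed

fun cone_ok :: "int \<Rightarrow> gpoly \<Rightarrow> gpoly list \<Rightarrow> int \<Rightarrow> int \<times> int \<Rightarrow> int \<Rightarrow> bool" where
  "cone_ok Q M C e (x, y) e' \<longleftrightarrow> jump_ok Q M C [[(x, y)]] e e' \<and> 1 < length M \<and> 0 < e' \<and>
     (case hd (tl M) of (u, v) \<Rightarrow> Q * e' \<le> - (u * x - v * y + \<bar>x\<bar> + \<bar>y\<bar>))"

lemma mode_solution_restrict: "mode_solution \<mu> T b \<Longrightarrow> T' \<le> T \<Longrightarrow> mode_solution \<mu> T' b"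
  unfolding mode_solution_def
  by (meson atLeastAtMost_iff has_vector_derivative_within_subset order_trans atLeastatMost_subset_iff order_refl)

lemma mode_solution_cong:
  assumes "mode_solution \<mu> T b" "\<And>t. t \<in> {0..T} \<Longrightarrow> b' t = b t" shows "mode_solution \<mu> T b'"
  unfolding mode_solution_def
proof (intro conjI ballI allI)
  show "\<exists>\<beta>. \<beta> summable_on UNIV \<and> (\<forall>t\<in>{0..T}. \<forall>k. norm (b' t k) \<le> \<beta> k)"
    using assms by (auto simp: mode_solution_def)
  fix t k assume t: "t \<in> {0..T}"
  show "((\<lambda>t. b' t k) has_vector_derivative \<mu> * (conv (b' t) (b' t) k - (of_int k)\<^sup>2 * b' t k)) (at t within {0..T})"
    by (rule has_vector_derivative_transform[OF t, of _ "\<lambda>t. b t k"]) (use assms t in \<open>auto simp: mode_solution_def\<close>)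
qed

text \<open>
  A jump to a constant function \<open>\<beta>\<close> turns the last radius into the terminal condition.
\<close>

lemma reached_global:
  assumes re: "reached \<mu> S C e" and ok: "cone_ok Q M C e z e'"
    and M: "power_table \<mu> Q M" and S: "S > 0" and mu: "norm \<mu> = 1" "Re \<mu> > 0"
  shows "\<exists>b g. b 0 = init_modes \<and> (\<forall>T\<ge>0. mode_solution \<mu> T b) \<and> (\<forall>\<^sub>F t in at_top. l1_le (b t) (g t)) \<and> (g \<longlongrightarrow> 0) at_top"
proof -
  from re obtain T b where T: "T \<ge> 0" and b: "mode_solution \<mu> T b" "b 0 = init_modes"
    and l: "l1_le (\<lambda>k. b T k - coef C \<mu> k / of_int S) (of_int e / of_int S)"
    unfolding reached_def by blast
  obtain x y where z: "z = (x, y)" by (cases z)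
  obtain u v where uv: "hd (tl M) = (u, v)" by (cases "hd (tl M)")
  have j: "jump_ok Q M C [[z]] e e'" and len: "1 < length M" and e': "e' > 0"
    and le: "Q * e' \<le> - (u * x - v * y + \<bar>x\<bar> + \<bar>y\<bar>)"
    using ok uv by (auto simp: z)
  have hd: "hd (tl M) = M ! 1" using len by (cases M; cases "tl M") auto
  have m: "norm (of_int Q * \<mu> - gint (u, v)) \<le> 1" and Q: "Q > 0"
    using M len unfolding power_table_def hd[unfolded uv] by (metis power_one_right, simp)
  define \<beta> where "\<beta> = gint z / of_int S"
  have l': "l1_le (\<lambda>k. b T k - mode0 \<beta> k) (of_int e' / of_int S)"
  proof -
    have "coef [[z]] (- \<mu>) k / of_int S = mode0 \<beta> k" for k
      by (auto simp: coef_def mode0_def \<beta>_def)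
    thus ?thesis using jump_sound[OF M j S l] by simp
  qed
  have re1: "of_int Q * Re (\<mu> * gint z) \<le> - (of_int Q * of_int e')"
  proof -
    have "of_int Q * Re (\<mu> * gint (x, y)) = Re (gint (u, v) * gint (x, y)) + Re ((of_int Q * \<mu> - gint (u, v)) * gint (x, y))"
      by (simp add: algebra_simps gint.simps)
    moreover have "Re ((of_int Q * \<mu> - gint (u, v)) * gint (x, y)) \<le> norm ((of_int Q * \<mu> - gint (u, v)) * gint (x, y))"
      by (rule complex_Re_le_cmod)
    moreover have "norm ((of_int Q * \<mu> - gint (u, v)) * gint (x, y)) \<le> 1 * (\<bar>of_int x\<bar> + \<bar>of_int y\<bar>)"
      unfolding norm_mult using cmod_le[of "gint (x, y)"] by (intro mult_mono m) (auto simp: gint.simps)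
    moreover have "real_of_int (Q * e') \<le> of_int (- (u * x - v * y + \<bar>x\<bar> + \<bar>y\<bar>))" using le by (simp only: of_int_le_iff)
    ultimately show ?thesis by (simp add: gint.simps z)
  qed
  hence re2: "Re (\<mu> * gint z) \<le> - of_int e'"
  proof -
    have "of_int Q * Re (\<mu> * gint z) \<le> of_int Q * (- of_int e')" using re1 by simp
    thus ?thesis using Q by (simp only: mult_le_cancel_left_pos of_int_0_less_iff)
  qed
  have reb: "Re (\<mu> * \<beta>) = Re (\<mu> * gint z) / of_int S"
  proof -
    have r: "complex_of_int S = of_real (of_int S)" by simp
    show ?thesis unfolding \<beta>_def r times_divide_eq_right by (rule Re_divide_of_real)
  qed
  have neg: "Re (\<mu> * \<beta>) < 0" unfolding reb using re2 e' S by (simp add: divide_less_0_iff)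
  have "of_int e' / of_int S \<le> - Re (\<mu> * \<beta>)"
    unfolding reb using divide_right_mono[OF re2, of "of_int S"] S by simp
  from cone_global[OF mu neg l1_le_mono[OF l' this]] obtain b2 where
    b2: "b2 0 = b T" "\<And>T. T \<ge> 0 \<Longrightarrow> mode_solution \<mu> T b2"
      "\<And>t. t \<ge> 0 \<Longrightarrow> l1_le (b2 t) (2 * norm (\<beta> / (1 - \<beta> * \<mu> * of_real t)))" by blast
  define b' where "b' = (\<lambda>t. if t \<in> {0..T} then b t else b2 (t - T))"
  define g where "g t = 2 * norm (\<beta> / (1 - \<beta> * \<mu> * of_real (t - T)))" for t
  have sol: "mode_solution \<mu> T' b'" if "T' \<ge> 0" for T'
  proof (cases "T' \<le> T")
    case True
    show ?thesis by (rule mode_solution_cong[OF mode_solution_restrict[OF b(1) True]]) (use True in \<open>auto simp: b'_def\<close>)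
  next
    case False
    have "mode_solution \<mu> (T + (T' - T)) b'"
      unfolding b'_def by (rule mode_solution_continue[OF b(1) b2(2,1)]) (use T False in auto)
    thus ?thesis by simp
  qed
  have "l1_le (b' t) (g t)" if "t > T" for t
    using b2(3)[of "t - T"] that by (simp add: b'_def g_def)
  hence "\<forall>\<^sub>F t in at_top. l1_le (b' t) (g t)" by (rule eventually_mono[OF eventually_gt_at_top[of T]])
  moreover have "(g \<longlongrightarrow> 0) at_top"
  proof -
    have nz: "\<beta> * \<mu> \<noteq> 0" using neg by auto
    have "filterlim (\<lambda>t. complex_of_real (t - T)) at_infinity at_top"
      using filterlim_compose[OF filterlim_of_real_at_infinity
          filterlim_tendsto_add_at_top[OF tendsto_const[of "- T"] filterlim_ident]] by simp
    hence "filterlim (\<lambda>t. - (\<beta> * \<mu>) * of_real (t - T)) at_infinity at_top"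
      by (intro tendsto_mult_filterlim_at_infinity[of _ "- (\<beta> * \<mu>)"] tendsto_const) (use nz in auto)
    hence "filterlim (\<lambda>t. 1 + - (\<beta> * \<mu>) * of_real (t - T)) at_infinity at_top"
      by (intro tendsto_add_filterlim_at_infinity[of _ 1] tendsto_const)
    hence "filterlim (\<lambda>t. 1 - \<beta> * \<mu> * of_real (t - T)) at_infinity at_top" by simp
    from tendsto_divide_0[OF tendsto_const this, of \<beta>]
    have "((\<lambda>t. 2 * norm (\<beta> / (1 - \<beta> * \<mu> * of_real (t - T)))) \<longlongrightarrow> 2 * norm (0 :: complex)) at_top"
      by (intro tendsto_mult tendsto_norm tendsto_const)
    thus ?thesis by (simp add: g_def[abs_def])
  qed
  moreover have "b' 0 = init_modes" using T b by (simp add: b'_def)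
  ultimately show ?thesis using sol by blast
qed

lemma heat_solution_subset:
  assumes "heat_solution \<theta> u0 J u" "K \<subseteq> J" shows "heat_solution \<theta> u0 K u"
proof -
  from assms(1) obtain u_x u_xx u_t where
    1: "\<forall>x. u 0 x = u0 x" "\<forall>t\<in>J. \<forall>x. u t (x + 1) = u t x" and
    2: "continuous_on (J \<times> UNIV) (\<lambda>(t, x). u t x)" "continuous_on (J \<times> UNIV) (\<lambda>(t, x). u_x t x)"
       "continuous_on (J \<times> UNIV) (\<lambda>(t, x). u_xx t x)" "continuous_on (J \<times> UNIV) (\<lambda>(t, x). u_t t x)" and
    3: "\<forall>t\<in>J. \<forall>x::real. ((\<lambda>y. u t y) has_vector_derivative u_x t x) (at x) \<and>
           ((\<lambda>y. u_x t y) has_vector_derivative u_xx t x) (at x) \<and>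
           ((\<lambda>s. u s x) has_vector_derivative u_t t x) (at t within J) \<and>
           u_t t x = exp (\<i> * complex_of_real \<theta>) * (u_xx t x + (u t x)\<^sup>2)"
    unfolding heat_solution_def by blast
  have sub: "K \<times> UNIV \<subseteq> J \<times> (UNIV :: real set)" using assms(2) by auto
  have "\<forall>t\<in>K. \<forall>x::real. ((\<lambda>y. u t y) has_vector_derivative u_x t x) (at x) \<and>
           ((\<lambda>y. u_x t y) has_vector_derivative u_xx t x) (at x) \<and>
           ((\<lambda>s. u s x) has_vector_derivative u_t t x) (at t within K) \<and>
           u_t t x = exp (\<i> * complex_of_real \<theta>) * (u_xx t x + (u t x)\<^sup>2)"
    using 3 assms(2) has_vector_derivative_within_subset[OF _ assms(2)] by blast
  thus ?thesis unfolding heat_solution_def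
    using 1 assms(2) 2[THEN continuous_on_subset, OF sub] by blast
qed

text \<open>
  The cosine is half the sum of two characters.
\<close>

lemma initial_fsum: "initial_data x = fsum (\<lambda>k. of_real (4 * pi\<^sup>2) * init_modes k) x"
proof -
  have "fsum (\<lambda>k. of_real (4 * pi\<^sup>2) * init_modes k) x = (\<Sum>\<^sub>\<infinity>k\<in>{-1, 0, 1}. of_real (4 * pi\<^sup>2) * init_modes k * fmode k x)"
    unfolding fsum_def by (rule infsum_cong_neutral) (auto simp: init_modes_def)
  also have "\<dots> = 50 - 25 * (fmode (- 1) x + fmode 1 x)"
    by (simp add: init_modes_def fmode_def algebra_simps)
  also have "fmode (- 1) x + fmode 1 x = of_real (2 * cos (2 * pi * x))"
  proof -
    have "fmode 1 x = cis (2 * pi * x)" "fmode (- 1) x = cis (- (2 * pi * x))"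
      by (simp_all add: fmode_def cis_conv_exp mult_ac)
    thus ?thesis by (simp add: complex_eq_iff)
  qed
  finally show ?thesis by (simp add: initial_data_def algebra_simps)
qed

text \<open>
  The limit is taken in the rescaled time, which tends to infinity together with \<open>t\<close>.
\<close>

lemma global_solution_of_reached:
  assumes re: "reached (cis \<theta>) S C e" and ok: "cone_ok Q M C e z e'"
    and M: "power_table (cis \<theta>) Q M" and S: "S > 0" and th: "cos \<theta> > 0"
  shows "\<exists>(u :: real \<Rightarrow> real \<Rightarrow> complex) (a :: real \<Rightarrow> int \<Rightarrow> complex).
           heat_solution \<theta> initial_data {0..} u \<and>
           (\<forall>T>0. \<forall>v. heat_solution \<theta> initial_data {0..T} v \<longrightarrow>
                (\<forall>t\<in>{0..T}. \<forall>x. v t x = u t x)) \<and>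
           (\<forall>t\<ge>0. has_fourier_series (u t) (a t)) \<and>
           ((\<lambda>t. l1_norm (a t)) \<longlongrightarrow> 0) at_top"
proof -
  from reached_global[OF re ok M S] th obtain b g where b: "b 0 = init_modes" "\<And>T. T \<ge> 0 \<Longrightarrow> mode_solution (cis \<theta>) T b"
    and g: "\<forall>\<^sub>F t in at_top. l1_le (b t) (g t)" "(g \<longlongrightarrow> 0) at_top" by auto
  define c where "c = 4 * pi\<^sup>2"
  have c: "c > 0" by (simp add: c_def)
  define a where "a = (\<lambda>t k. of_real c * b (c * t) k)"
  have b0: "(\<lambda>k. of_int k ^ 2 * norm (b 0 k)) summable_on UNIV"
    by (rule finite_nonzero_values_imp_summable_on, rule finite_subset[of _ "{-1..1}"]) (auto simp: b init_modes_def split: if_splits)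
  have u: "heat_solution \<theta> initial_data {0..} (\<lambda>t. fsum (a t))"
    unfolding a_def c_def
    by (rule global_heat_solution[OF b(2) th b0]) (simp_all add: b(1) initial_fsum)
  moreover have "v t x = fsum (a t) x" if "T > 0" "heat_solution \<theta> initial_data {0..T} v" "t \<in> {0..T}" for T v t x
    by (rule heat_solution_unique[OF _ that(1) heat_solution_subset[OF u] that(2,3)]) (use th in auto)
  moreover have "has_fourier_series (fsum (a t)) (a t)" if "t \<ge> 0" for t
  proof -
    have "c * t \<ge> 0" using c that by simp
    from b(2)[OF this] obtain \<beta> where "\<beta> summable_on UNIV" "\<And>k. norm (b (c * t) k) \<le> \<beta> k"
      using \<open>c * t \<ge> 0\<close> by (auto simp: mode_solution_def)
    hence "l1_le (b (c * t)) (\<Sum>\<^sub>\<infinity>k. \<beta> k)" by (rule l1_le_of_summable)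
    from has_fourier_series_fsum[OF l1_le_cmult[OF this]] show ?thesis unfolding a_def .
  qed
  moreover have "((\<lambda>t. l1_norm (a t)) \<longlongrightarrow> 0) at_top"
  proof (rule Lim_null_comparison)
    have ct: "filterlim (\<lambda>t. c * t) at_top at_top"
      by (rule filterlim_tendsto_pos_mult_at_top[OF tendsto_const c filterlim_ident])
    have "\<forall>\<^sub>F t in at_top. l1_le (b (c * t)) (g (c * t))" by (rule eventually_compose_filterlim[OF g(1) ct])
    thus "\<forall>\<^sub>F t in at_top. norm (l1_norm (a t)) \<le> c * g (c * t)"
    proof eventually_elim
      case (elim t)
      have "l1_le (a t) (norm (complex_of_real c) * g (c * t))" unfolding a_def by (rule l1_le_cmult[OF elim])
      hence "l1_norm (a t) \<le> c * g (c * t)" unfolding l1_norm_def using l1_le_infsum c by fastforce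
      moreover have "l1_norm (a t) \<ge> 0" unfolding l1_norm_def by (rule infsum_nonneg) simp
      ultimately show ?case by simp
    qed
    have "((\<lambda>t. c * g (c * t)) \<longlongrightarrow> c * 0) at_top"
      by (intro tendsto_mult tendsto_const filterlim_compose[OF g(2) ct])
    thus "((\<lambda>t. c * g (c * t)) \<longlongrightarrow> 0) at_top" by simp
  qed
  ultimately show ?thesis by blast
qed

section \<open>Powers of the direction of the path\<close>

fun quarter_turn :: "int \<times> int \<Rightarrow> int \<times> int" where
  "quarter_turn (x, y) = (- y, x)"

text \<open>
  The powers of \<open>cis (pi / 12)\<close> rounded in units of \<open>2 ^ (-24)\<close>. All four directions are
  powers of this number. A quarter turn is exact on Gaussian integers, so six entries suffice.
\<close>

fun omega_table :: "nat \<Rightarrow> int \<times> int" where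
  "omega_table n = (if n < 6 then
     [(16777216, 0), (16205546, 4342263), (14529495, 8388608), (11863283, 11863283), (8388608, 14529495), (4342263, 16205546)] ! n
     else quarter_turn (omega_table (n - 6)))"

declare omega_table.simps [simp del]

lemma omega_table: "norm (16777216 * cis (pi / 12) ^ n - gint (omega_table n)) \<le> 1"
proof (induction n rule: less_induct)
  case (less n)
  show ?case
  proof (cases "n < 6")
    case False
    have "cis (pi / 12) ^ n = cis (pi / 12) ^ 6 * cis (pi / 12) ^ (n - 6)"
      using False by (simp flip: power_add)
    moreover have "cis (pi / 12) ^ 6 = \<i>" unfolding Complex.DeMoivre by simp
    moreover have "gint (quarter_turn z) = \<i> * gint z" for z by (cases z) (simp add: gint.simps complex_eq_iff)
    ultimately have "16777216 * cis (pi / 12) ^ n - gint (omega_table n) =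
        \<i> * (16777216 * cis (pi / 12) ^ (n - 6) - gint (omega_table (n - 6)))"
      using False by (simp add: omega_table.simps[of n] algebra_simps)
    thus ?thesis using less[of "n - 6"] False by (simp add: norm_mult)
  next
    case True
    have s2: "1.41421356 \<le> sqrt 2" "sqrt 2 \<le> 1.41421357"
      by (rule real_le_rsqrt, simp add: power2_eq_square) (rule real_le_lsqrt, simp_all add: power2_eq_square)
    have s3: "1.7320508 \<le> sqrt 3" "sqrt 3 \<le> 1.73205081"
      by (rule real_le_rsqrt, simp add: power2_eq_square) (rule real_le_lsqrt, simp_all add: power2_eq_square)
    have s6: "2.44948974 \<le> sqrt 6" "sqrt 6 \<le> 2.44948975"
      by (rule real_le_rsqrt, simp add: power2_eq_square) (rule real_le_lsqrt, simp_all add: power2_eq_square)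
    have s23: "sqrt 2 * sqrt 3 = sqrt 6" by (simp flip: real_sqrt_mult)
    have c1: "cos (pi / 12) = (sqrt 6 + sqrt 2) / 4" and s1: "sin (pi / 12) = (sqrt 6 - sqrt 2) / 4"
      using cos_diff[of "pi / 3" "pi / 4"] sin_diff[of "pi / 3" "pi / 4"] s23
      by (simp_all add: cos_45 sin_45 cos_60 sin_60 field_simps)
    have c5: "cos (5 * pi / 12) = sin (pi / 12)" "sin (5 * pi / 12) = cos (pi / 12)"
      using cos_diff[of "pi / 2" "pi / 12"] sin_diff[of "pi / 2" "pi / 12"] by (simp_all add: field_simps)
    have n: "n = 0 \<or> n = 1 \<or> n = 2 \<or> n = 3 \<or> n = 4 \<or> n = 5" using True by auto
    have close: "norm (16777216 * Complex a b - gint (x, y)) \<le> 1"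
      if "of_int x - 1/2 \<le> 16777216 * a" "16777216 * a \<le> of_int x + 1/2"
        "of_int y - 1/2 \<le> 16777216 * b" "16777216 * b \<le> of_int y + 1/2" for a b x y
    proof -
      have "\<bar>16777216 * a - of_int x\<bar> \<le> 1/2" "\<bar>16777216 * b - of_int y\<bar> \<le> 1/2"
        using that by (simp_all only: abs_le_iff) linarith+
      thus ?thesis using cmod_le[of "16777216 * Complex a b - gint (x, y)"] by (simp add: gint.simps)
    qed
    have eq: "cis (pi / 12) ^ n = Complex (cos (real n * pi / 12)) (sin (real n * pi / 12))"
      unfolding Complex.DeMoivre by (simp add: complex_eq_iff)
    have v: "cos (2 * pi / 12) = sqrt 3 / 2" "sin (2 * pi / 12) = 1 / 2" "cos (3 * pi / 12) = sqrt 2 / 2" "sin (3 * pi / 12) = sqrt 2 / 2"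
      "cos (4 * pi / 12) = 1 / 2" "sin (4 * pi / 12) = sqrt 3 / 2"
      using cos_30 sin_30 cos_45 sin_45 cos_60 sin_60 by simp_all
    show ?thesis using n
    proof (elim disjE)
      assume "n = 0" thus ?thesis unfolding eq by (simp add: omega_table.simps) (intro close; simp)
    next
      assume "n = 1" thus ?thesis unfolding eq
        using s2 s6 by (simp add: omega_table.simps) (intro close; simp add: c1 s1)
    next
      assume "n = 2" thus ?thesis unfolding eq
        using s3 by (simp only: of_nat_numeral v) (simp add: omega_table.simps, intro close; simp)
    next
      assume "n = 3" thus ?thesis unfolding eq
        using s2 by (simp only: of_nat_numeral v) (simp add: omega_table.simps, intro close; simp)
    next
      assume "n = 4" thus ?thesis unfolding eq
        using s3 by (simp only: of_nat_numeral v) (simp add: omega_table.simps, intro close; simp)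
    next
      assume "n = 5" thus ?thesis unfolding eq
        using s2 s6 by (simp only: of_nat_numeral c5) (simp add: omega_table.simps, intro close; simp add: c1 s1)
    qed
  qed
qed

lemma power_table_omega:
  "power_table (cis (real d * pi / 12)) 16777216 (map (\<lambda>i. omega_table (d * i)) [0..<n])"
proof -
  have "cis (real d * pi / 12) = cis (pi / 12) ^ d" unfolding Complex.DeMoivre by simp
  thus ?thesis using omega_table[of "d * _"] by (auto simp: power_table_def power_mult)
qed

section \<open>The path of angle pi/3\<close>

text \<open>
  The coefficients are rounded Taylor coefficients, at the midpoints of consecutive time intervals, of
  a numerical solution. In each step the numbers after the
  polynomials are the radius at the start, the radius at the end, the growth bound \<open>L\<close> and the
  exponent parameter \<open>x\<close>. The starting radius is chosen larger than the previous one where this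
  makes the relative size of the defect, and with it the final radius, smaller.
\<close>

definition ray60_powers :: gpoly where
  "ray60_powers = [(16777216,0),(8388608,14529495),(-8388608,14529495),(-16777216,0),(-8388608,-14529495),(8388608,-14529495),
    (16777216,0),(8388608,14529495),(-8388608,14529495),(-16777216,0),(-8388608,-14529495),(8388608,-14529495),
    (16777216,0),(8388608,14529495),(-8388608,14529495)]"

lemma ray60_powers: "power_table (cis (pi / 3)) 16777216 ray60_powers"
proof -
  have "map (\<lambda>i. omega_table (4 * i)) [0..<15] = ray60_powers" by code_simp
  thus ?thesis using power_table_omega[of 4 15] by simp
qed

definition ray60_p0 :: "gpoly list" where
  "ray60_p0 = [[(2 * 166005, 0)], [(- 166005, 0)]]"

definition ray60_p1 :: "gpoly list" where
  "ray60_p1 = [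
   [(353043,52056),(57552,16621),(8710,4289),(1389,973),(211,211),(31,44),(4,9),(1,2)],
   [(-173494,-22201),(-24050,-9816),(-5061,-2647),(-833,-663),(-140,-149),(-21,-32),(-3,-7)],
   [(3774,8046),(8705,1736),(795,973),(297,223),(42,61),(8,14),(1,3)],
   [(219,-379),(-403,-734),(-346,-53),(-6,-84),(-17,-11),(-1,-5)],
   [(-21,2),(-23,55),(31,39),(7,0),(0,6)],
   [(1,1),(3,-1),(1,-5),(-2,-1)]]"

lemma ray60_step1: "advance_ok 16777216 ray60_powers 262144 ray60_p0 2 12 ray60_p1 336 2426 1400206 119"
  by code_simp

definition ray60_p2 :: "gpoly list" where
  "ray60_p2 = [
   [(343492,173367),(36838,49151),(958,9962),(-713,1531),(-244,165),(-52,3),(-8,-4)],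
   [(-158348,-75952),(-11290,-27814),(266,-5813),(614,-933),(185,-92),(38,2),(6,4)],
   [(3394,22630),(2747,5104),(-840,1747),(-278,221),(-81,16),(-16,-6),(-2,-3)],
   [(1781,-1992),(48,-1083),(259,-129),(78,-43),(22,7),(4,3)],
   [(-287,3),(-107,116),(-34,-5),(-18,0),(-2,-3)],
   [(20,21),(20,-1),(3,2),(2,2)],
   [(0,-3),(-2,-2)]]"

lemma ray60_step2: "advance_ok 16777216 ray60_powers 262144 ray60_p1 2426 13 ray60_p2 2445 6425 1306763 60"
  by code_simp

definition ray60_p3 :: "gpoly list" where
  "ray60_p3 = [
   [(263702,262886),(-236,58271),(-7537,5963),(-1574,-380),(-116,-256),(23,-44),(9,-1)],
   [(-106312,-106194),(10833,-28059),(5179,-2045),(952,499),(40,197),(-24,29),(-7,0)],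
   [(-4745,25312),(-3762,2098),(-1661,-55),(-184,-335),(24,-74),(15,-7),(3,2)],
   [(3084,-1790),(551,204),(258,236),(-25,79),(-15,13),(-5,-1)],
   [(-408,-134),(-26,-80),(-3,-56),(14,-7),(4,0)],
   [(19,44),(-6,10),(-6,5),(-2,-1)],
   [(2,-5)]]"

lemma ray60_step3: "advance_ok 16777216 ray60_powers 262144 ray60_p2 6425 12 ray60_p3 6452 12610 914988 42"
  by code_simp

definition ray60_p4 :: "gpoly list" where
  "ray60_p4 = [
   [(152560,287483),(-30987,44866),(-9494,-2278),(-178,-1765),(300,-137),(43,46),(-6,11)],
   [(-49005,-95239),(23969,-13673),(4298,3570),(-327,1103),(-235,21),(-21,-43),(7,-7),(2,1)],
   [(-8084,16392),(-4402,-3328),(-97,-1100),(314,-204),(69,57),(-6,19),(-4,1)],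
   [(2103,-545),(-43,978),(-156,73),(-75,-21),(3,-24),(5,-2)],
   [(-175,-137),(106,-77),(24,20),(3,11),(-4,2)],
   [(0,22),(-15,-5),(1,-5)],
   [(2,-1),(1,2)]]"

lemma ray60_step4: "advance_ok 16777216 ray60_powers 262144 ray60_p3 12610 9 ray60_p4 12642 22054 563502 35"
  by code_simp

definition ray60_p5 :: "gpoly list" where
  "ray60_p5 = [
   [(72495,263145),(-27590,16491),(-2656,-3060),(344,-383),(54,39),(-4,8)],
   [(-19522,-67125),(14843,-783),(285,2198),(-307,95),(-21,-41),(5,-4)],
   [(-4954,8245),(-1539,-2875),(439,-151),(55,44),(-6,14),(-2,-1)],
   [(786,-123),(-145,396),(-75,-68),(9,-9)],
   [(-43,-44),(40,-10),(-2,13),(-2,-1)],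
   [(-1,4),(-3,-2)]]"

lemma ray60_step5: "advance_ok 16777216 ray60_powers 262144 ray60_p4 22054 10 ray60_p5 22087 25843 144141 10"
  by code_simp

lemma ray60_cone: "cone_ok 16777216 ray60_powers ray60_p5 25843 (48064, 247051) 166378"
  by code_simp

lemma ray60_reached: "reached (cis (pi / 3)) 262144 ray60_p5 25843"
proof -
  have pos: "Re (cis (pi / 3)) > 0" using cos_gt_zero[of "pi / 3"] by simp
  have "reached (cis (pi / 3)) 262144 ray60_p0 2"
    using reached_start[of 262144 166005 1] by (simp add: ray60_p0_def)
  note advance = reached_advance[OF _ _ ray60_powers zero_less_numeral norm_cis pos]
  note start = \<open>reached (cis (pi / 3)) 262144 ray60_p0 2\<close>
  note r1 = advance[OF start ray60_step1]
  note r2 = advance[OF r1 ray60_step2]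
  note r3 = advance[OF r2 ray60_step3]
  note r4 = advance[OF r3 ray60_step4]
  note r5 = advance[OF r4 ray60_step5]
  show ?thesis by (rule r5)
qed

section \<open>The path of angle pi/4\<close>

text \<open>
  Closer to the real axis the path passes closer to the blow-up time of the real solution, and errors
  are amplified more; hence the growing number of steps and, for the smaller angles, the larger
  denominators.
\<close>

definition ray45_powers :: gpoly where
  "ray45_powers = [(16777216,0),(11863283,11863283),(0,16777216),(-11863283,11863283),(-16777216,0),(-11863283,-11863283),
    (0,-16777216),(11863283,-11863283),(16777216,0),(11863283,11863283),(0,16777216),(-11863283,11863283),
    (-16777216,0),(-11863283,-11863283),(0,-16777216)]"

lemma ray45_powers: "power_table (cis (pi / 4)) 16777216 ray45_powers"
proof -
  have "map (\<lambda>i. omega_table (3 * i)) [0..<15] = ray45_powers" by code_simp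
  thus ?thesis using power_table_omega[of 3 15] by simp
qed

definition ray45_p0 :: "gpoly list" where
  "ray45_p0 = [[(2 * 166005, 0)], [(- 166005, 0)]]"

definition ray45_p1 :: "gpoly list" where
  "ray45_p1 = [
   [(359433,32628),(45386,7986),(5446,1586),(702,279),(89,47),(12,8)],
   [(-176975,-14053),(-19401,-4742),(-3215,-988),(-433,-192),(-61,-34),(-8,-6)],
   [(4541,5061),(6983,880),(574,366),(159,67),(20,14),(3,3)],
   [(1,-253),(-345,-359),(-236,-25),(-9,-25),(-8,-3)],
   [(-6,7),(2,26),(18,16),(6,0)]]"

lemma ray45_step1: "advance_ok 16777216 ray45_powers 262144 ray45_p0 2 16 ray45_p1 327 1946 1483259 108"
  by code_simp

definition ray45_p2 :: "gpoly list" where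
  "ray45_p2 = [
   [(397412,121613),(41745,28187),(3603,5010),(223,764),(-7,105),(-6,13)],
   [(-189270,-56844),(-17817,-16878),(-1926,-3199),(-100,-522),(11,-74),(5,-9)],
   [(10032,17393),(5115,4056),(236,1115),(8,186),(-10,29),(-3,4)],
   [(330,-1845),(-367,-960),(-27,-185),(14,-50),(4,-7)],
   [(-123,109),(-30,122),(-3,30),(-5,7)],
   [(14,-1),(10,-9),(2,-4)]]"

lemma ray45_step2: "advance_ok 16777216 ray45_powers 262144 ray45_p1 1946 19 ray45_p2 1970 4688 1651719 54"
  by code_simp

definition ray45_p3 :: "gpoly list" where
  "ray45_p3 = [
   [(392409,227337),(26448,48739),(-895,7011),(-638,688),(-126,25),(-16,-7)],
   [(-175616,-108712),(-7247,-28307),(1272,-4206),(511,-405),(94,-6),(12,7)],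
   [(6524,29599),(461,6501),(-942,1182),(-232,78),(-40,-10),(-4,-5)],
   [(1933,-3370),(537,-1065),(285,-116),(65,4),(10,8)],
   [(-431,150),(-164,81),(-52,-8),(-11,-7)],
   [(47,19),(25,5),(6,5)],
   [(-3,-5)]]"

lemma ray45_step3: "advance_ok 16777216 ray45_powers 262144 ray45_p2 4688 20 ray45_p3 4738 10049 1639073 47"
  by code_simp

definition ray45_p4 :: "gpoly list" where
  "ray45_p4 = [
   [(334611,322756),(-869,55960),(-5717,4302),(-913,-257),(-47,-121),(9,-15)],
   [(-131095,-149072),(10417,-29067),(4231,-1709),(595,322),(17,97),(-9,11)],
   [(-5310,34284),(-5163,4216),(-1560,-168),(-145,-231),(13,-43),(7,-3)],
   [(4171,-2810),(1239,51),(252,263),(-6,73),(-11,9)],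
   [(-638,-148),(-138,-151),(0,-69),(12,-11)],
   [(40,70),(-2,31),(-8,8)],
   [(3,-9),(3,-3)]]"

lemma ray45_step4: "advance_ok 16777216 ray45_powers 262144 ray45_p3 10049 20 ray45_p4 10109 18514 1385948 38"
  by code_simp

definition ray45_p5 :: "gpoly list" where
  "ray45_p5 = [
   [(238629,377518),(-26807,47239),(-7011,-911),(-222,-927),(110,-74),(15,11)],
   [(-70448,-158036),(24362,-18127),(4042,2178),(-48,691),(-97,33),(-10,-11)],
   [(-16530,27174),(-6742,-1513),(-564,-1366),(194,-208),(46,15),(1,8)],
   [(4575,-375),(529,1215),(-167,298),(-79,-4),(-6,-14)],
   [(-375,-455),(113,-188),(65,-6),(10,15)],
   [(-20,69),(-33,2),(-7,-9)],
   [(8,-3),(3,4)]]"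

lemma ray45_step5: "advance_ok 16777216 ray45_powers 262144 ray45_p4 18514 18 ray45_p5 18566 31358 1084013 33"
  by code_simp

definition ray45_p6 :: "gpoly list" where
  "ray45_p6 = [
   [(137089,382155),(-38859,27181),(-4094,-4267),(485,-587),(84,56),(-6,12)],
   [(-18998,-135572),(25723,-2758),(1087,3696),(-497,258),(-48,-64),(8,-8)],
   [(-18819,14476),(-3402,-5062),(701,-898),(202,83),(-7,37),(-6,0)],
   [(2787,1247),(-529,977),(-246,-58),(-5,-57),(11,-4)],
   [(-11,-350),(166,5),(8,46),(-10,6)],
   [(-34,17),(-9,-20),(6,-4)]]"

lemma ray45_step6: "advance_ok 16777216 ray45_powers 262144 ray45_p5 31358 16 ray45_p6 31412 44465 641499 22"
  by code_simp

definition ray45_p7 :: "gpoly list" where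
  "ray45_p7 = [
   [(53485,350332),(-40700,9754),(-1085,-5101),(662,-85),(2,88),(-12,-1)],
   [(10099,-98383),(19957,7367),(-1275,3068),(-453,-188),(28,-65),(9,4)],
   [(-13653,4867),(33,-4783),(916,41),(12,170),(-30,4),(-1,-5)],
   [(960,1144),(-676,254),(-43,-182),(38,-12),(3,8)],
   [(74,-117),(54,68),(-25,14),(-4,-6)],
   [(-12,-3),(5,-8),(3,3)]]"

lemma ray45_step7: "advance_ok 16777216 ray45_powers 262144 ray45_p6 44465 13 ray45_p7 44496 56346 310061 15"
  by code_simp

definition ray45_p8 :: "gpoly list" where
  "ray45_p8 = [
   [(-4109,301318),(-33964,-2525),(904,-3896),(429,206),(-38,44),(-4,-6)],
   [(18922,-63171),(11367,10201),(-1956,1370),(-150,-307),(45,-14),(1,6)],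
   [(-7216,791),(1244,-2628),(426,436),(-82,62),(-10,-15)],
   [(179,514),(-315,-60),(54,-81),(14,16)],
   [(32,-18),(0,29),(-10,-5)]]"

lemma ray45_step8: "advance_ok 16777216 ray45_powers 262144 ray45_p7 56346 11 ray45_p8 56396 62938 68363 7"
  by code_simp

lemma ray45_cone: "cone_ok 16777216 ray45_powers ray45_p8 62938 (-22856, 276541) 191742"
  by code_simp

lemma ray45_reached: "reached (cis (pi / 4)) 262144 ray45_p8 62938"
proof -
  have pos: "Re (cis (pi / 4)) > 0" using cos_gt_zero[of "pi / 4"] by simp
  have "reached (cis (pi / 4)) 262144 ray45_p0 2"
    using reached_start[of 262144 166005 1] by (simp add: ray45_p0_def)
  note advance = reached_advance[OF _ _ ray45_powers zero_less_numeral norm_cis pos]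
  note start = \<open>reached (cis (pi / 4)) 262144 ray45_p0 2\<close>
  note r1 = advance[OF start ray45_step1]
  note r2 = advance[OF r1 ray45_step2]
  note r3 = advance[OF r2 ray45_step3]
  note r4 = advance[OF r3 ray45_step4]
  note r5 = advance[OF r4 ray45_step5]
  note r6 = advance[OF r5 ray45_step6]
  note r7 = advance[OF r6 ray45_step7]
  note r8 = advance[OF r7 ray45_step8]
  show ?thesis by (rule r8)
qed

section \<open>The path of angle pi/6\<close>

definition ray30_powers :: gpoly where
  "ray30_powers = [(16777216,0),(14529495,8388608),(8388608,14529495),(0,16777216),(-8388608,14529495),(-14529495,8388608),
    (-16777216,0),(-14529495,-8388608),(-8388608,-14529495),(0,-16777216),(8388608,-14529495),(14529495,-8388608),
    (16777216,0),(14529495,8388608),(8388608,14529495)]"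

lemma ray30_powers: "power_table (cis (pi / 6)) 16777216 ray30_powers"
proof -
  have "map (\<lambda>i. omega_table (2 * i)) [0..<15] = ray30_powers" by code_simp
  thus ?thesis using power_table_omega[of 2 15] by simp
qed

definition ray30_p0 :: "gpoly list" where
  "ray30_p0 = [[(2 * 2656074, 0)], [(- 2656074, 0)]]"

definition ray30_p1 :: "gpoly list" where
  "ray30_p1 = [
   [(5892771,385627),(764593,97207),(95384,19855),(12810,3610),(1715,631),(234,106),(32,18),(4,3)],
   [(-2896682,-168850),(-333501,-57997),(-56736,-12504),(-8030,-2494),(-1180,-453),(-167,-79),(-24,-13)],
   [(93518,59339),(117125,11555),(11103,4619),(2949,892),(415,192),(70,36),(10,7)],
   [(-2016,-3553),(-6954,-4255),(-4097,-446),(-269,-311),(-145,-42),(-15,-12),(-4,-2)],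
   [(6,147),(227,362),(353,195),(117,16),(7,18),(7,1)],
   [(2,-5),(-2,-20),(-16,-22),(-14,-7)]]"

lemma ray30_step1: "advance_ok 16777216 ray30_powers 4194304 ray30_p0 2 16 ray30_p1 841 4430 26495645 101"
  by code_simp

definition ray30_p2 :: "gpoly list" where
  "ray30_p2 = [
   [(7054159,1611585),(821735,402397),(88227,78149),(8854,13383),(694,2125),(15,316),(-10,44),(-3,6)],
   [(-3391957,-793564),(-386714,-248783),(-51843,-52056),(-5398,-9516),(-418,-1570),(1,-241),(9,-34),(3,-5)],
   [(259720,241074),(112400,69227),(11837,19345),(1619,3806),(83,693),(-14,112),(-7,17)],
   [(-10965,-31141),(-12069,-16281),(-2304,-4154),(-154,-1083),(5,-201),(11,-36),(3,-6)],
   [(-370,2877),(517,2401),(208,774),(-11,205),(-11,46),(-4,8)],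
   [(135,-204),(59,-256),(9,-112),(9,-32),(4,-8)],
   [(-17,10),(-16,20),(-6,12),(-2,4)]]"

lemma ray30_step2: "advance_ok 16777216 ray30_powers 4194304 ray30_p1 4430 20 ray30_p2 4479 11967 33042152 61"
  by code_simp

definition ray30_p3 :: "gpoly list" where
  "ray30_p3 = [
   [(7793146,3392686),(657539,757375),(26672,121532),(-4504,15570),(-1533,1537),(-284,82),(-40,-9),(-4,-4)],
   [(-3635257,-1781042),(-282637,-475620),(-7613,-81226),(4468,-10782),(1274,-1054),(230,-46),(32,10),(3,3)],
   [(308203,518686),(55839,143024),(-6017,28977),(-2913,3918),(-707,350),(-122,-2),(-16,-9)],
   [(872,-79489),(1853,-29973),(3584,-6064),(1202,-839),(263,-39),(44,14),(5,5)],
   [(-5052,8290),(-2562,4132),(-1108,829),(-332,78),(-69,-14),(-11,-8)],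
   [(997,-532),(618,-340),(234,-48),(66,12),(13,9)],
   [(-127,-5),(-95,-2),(-36,-10),(-10,-7)],
   [(12,8),(10,6),(4,4)]]"

lemma ray30_step3: "advance_ok 16777216 ray30_powers 4194304 ray30_p2 11967 25 ray30_p3 12025 27232 37654655 51"
  by code_simp

definition ray30_p4 :: "gpoly list" where
  "ray30_p4 = [
   [(7708099,5534579),(283006,1105423),(-72569,128134),(-19134,5577),(-2448,-1314),(-116,-376),(26,-50),(8,-3)],
   [(-3327321,-2964163),(-3594,-673167),(65347,-77305),(14882,-1877),(1781,1295),(58,318),(-26,40),(-7,2)],
   [(135668,812966),(-70772,180970),(-35925,18055),(-6697,-1696),(-650,-942),(24,-182),(22,-19)],
   [(62192,-115576),(35053,-25503),(11000,581),(1709,1512),(64,429),(-41,65),(-13,4)],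
   [(-17551,7788),(-8243,36),(-2016,-1459),(-180,-579),(48,-122),(23,-13),(5,1)],
   [(2590,648),(1136,847),(165,469),(-38,133),(-27,20),(-7,0)],
   [(-220,-284),(-62,-219),(26,-87),(22,-18),(8,0)],
   [(0,47),(-13,32),(-12,9),(-5,0)],
   [(4,-5),(4,-3)]]"

lemma ray30_step4: "advance_ok 16777216 ray30_powers 4194304 ray30_p3 27232 27 ray30_p4 27291 56938 38739465 46"
  by code_simp

definition ray30_p5 :: "gpoly list" where
  "ray30_p5 = [
   [(6534692,7541155),(-305454,1139233),(-146921,37193),(-13852,-15035),(932,-2685),(397,-62),(35,46),(-4,8)],
   [(-2307567,-3926515),(402139,-609011),(108654,976),(8127,13765),(-1147,2031),(-341,0),(-24,-44),(4,-6)],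
   [(-261804,919588),(-206617,84370),(-38767,-24135),(-178,-7949),(1081,-731),(190,85),(4,32),(-4,3)],
   [(149565,-78290),(50733,19110),(4155,13101),(-1698,2289),(-537,-15),(-51,-81),(7,-15)],
   [(-25661,-9146),(-4546,-10364),(1523,-3055),(811,-161),(132,119),(-4,35),(-6,3)],
   [(1607,3852),(-842,1965),(-713,228),(-173,-114),(-4,-50),(8,-7)],
   [(265,-558),(356,-125),(132,73),(9,46),(-8,10)],
   [(-86,25),(-56,-30),(-7,-28),(6,-8)],
   [(11,7),(2,10),(-3,4)]]"

lemma ray30_step5: "advance_ok 16777216 ray30_powers 4194304 ray30_p4 56938 28 ray30_p5 56996 113225 37566600 43"
  by code_simp

definition ray30_p6 :: "gpoly list" where
  "ray30_p6 = [
   [(4543760,8714125),(-781774,813577),(-121179,-73188),(6278,-17607),(2519,371),(17,353),(-48,12),(-3,-6)],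
   [(-881626,-4167364),(661626,-277429),(67101,80898),(-8691,12353),(-2004,-786),(46,-304),(44,-3),(2,6)],
   [(-643979,688073),(-208696,-93644),(1471,-45395),(7573,-2277),(715,1057),(-127,153),(-28,-13),(1,-4)],
   [(168827,29328),(11643,56358),(-11574,8384),(-2505,-1608),(120,-542),(96,-11),(7,15)],
   [(-10578,-26322),(8776,-8700),(3467,1280),(44,899),(-174,81),(-27,-26),(3,-6)],
   [(-2686,3550),(-2327,-559),(-172,-821),(190,-137),(48,29),(-2,12)],
   [(670,77),(130,412),(-127,119),(-51,-21),(0,-15)],
   [(-40,-91),(49,-55),(32,9),(2,12)],
   [(-8,12),(-12,-2),(-2,-6)]]"

lemma ray30_step6: "advance_ok 16777216 ray30_powers 4194304 ray30_p5 113225 27 ray30_p6 113289 200852 30690093 36"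
  by code_simp

definition ray30_p7 :: "gpoly list" where
  "ray30_p7 = [
   [(2341711,8821915),(-1006674,360086),(-41125,-130051),(17881,-4323),(420,2532),(-363,33),(-1,-52),(8,0)],
   [(405132,-3610933),(673479,112713),(-12496,103404),(-15237,-1566),(262,-2212),(320,50),(-10,46),(-7,-2)],
   [(-747088,255854),(-78096,-204526),(39105,-22114),(4753,6682),(-1064,868),(-146,-165),(25,-23),(4,4)],
   [(89518,104454),(-38177,37673),(-11408,-8178),(1408,-2761),(571,209),(-28,107),(-19,-3)],
   [(10829,-18849),(10041,4617),(-907,3433),(-922,-81),(-13,-209),(42,-8),(3,8)],
   [(-3183,-636),(196,-2033),(778,-58),(59,227),(-55,25),(-8,-12)],
   [(55,464),(-342,78),(-60,-144),(45,-29),(10,11)],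
   [(59,-27),(29,49),(-22,19),(-9,-7)],
   [(-6,-7),(6,-7),(4,3)]]"

lemma ray30_step7: "advance_ok 16777216 ray30_powers 4194304 ray30_p6 200852 23 ray30_p7 200913 328564 22463905 31"
  by code_simp

definition ray30_p8 :: "gpoly list" where
  "ray30_p8 = [
   [(470460,8072275),(-941903,-50969),(35418,-112462),(12873,8928),(-1717,1330),(-108,-287),(44,-3),(-1,6)],
   [(1147215,-2581778),(454935,369850),(-68727,60918),(-6946,-11546),(1838,-604),(17,277),(-39,-8),(3,-5)],
   [(-550762,-86326),(65216,-166312),(34183,16659),(-3618,6106),(-958,-740),(141,-134),(16,25),(-4,2)],
   [(318,85844),(-38736,-7171),(2820,-10677),(2421,771),(-191,481),(-86,-44),(9,-14)],
   [(11855,-1385),(-384,7173),(-2505,-333),(124,-688),(162,37),(-10,34),(-7,-3)],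
   [(-325,-1527),(1165,-57),(-18,495),(-160,-14),(6,-44),(11,2)],
   [(-188,57),(-24,-174),(87,-4),(0,32),(-10,-1)],
   [(9,22),(-24,5),(-2,-14),(6,0)]]"

lemma ray30_step8: "advance_ok 16777216 ray30_powers 4194304 ray30_p7 328564 19 ray30_p8 328621 488031 14691832 25"
  by code_simp

definition ray30_p9 :: "gpoly list" where
  "ray30_p9 = [
   [(-831550,6877638),(-761329,-304550),(71047,-71143),(3839,12450),(-1759,-368),(164,-197),(14,34),(-5,0)],
   [(1292287,-1532557),(194942,430289),(-78011,7393),(2762,-11386),(1371,963),(-203,122),(-3,-33),(5,2)],
   [(-266614,-190158),(109392,-63010),(6670,28645),(-5738,-86),(279,-978),(141,91),(-21,16),(-1,-4)],
   [(-25872,31391),(-10590,-20162),(7127,-1339),(-98,1798),(-374,-109),(38,-66),(10,10)],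
   [(3126,3281),(-3111,1230),(-99,-1359),(410,74),(-42,99),(-20,-15),(4,-3)],
   [(384,-275),(104,421),(-215,-15),(26,-74),(20,13),(-4,4)],
   [(-21,-42),(52,-5),(-7,30),(-11,-6),(3,-3)],
   [(-4,1),(0,-6),(4,1)]]"

lemma ray30_step9: "advance_ok 16777216 ray30_powers 4194304 ray30_p8 488031 15 ray30_p9 488074 637990 7503195 17"
  by code_simp

definition ray30_p10 :: "gpoly list" where
  "ray30_p10 = [
   [(-1574477,5628544),(-516492,-385351),(64127,-30195),(-1247,7835),(-644,-694),(122,-10),(-8,14)],
   [(1068148,-780424),(10038,322627),(-47446,-22273),(5704,-4730),(222,949),(-118,-34),(11,-10)],
   [(-84181,-139642),(68894,3635),(-8435,14247),(-1863,-2522),(512,-136),(-11,82),(-10,-6)],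
   [(-14505,3774),(2836,-8837),(2194,2234),(-735,276),(3,-166),(29,12),(-4,4)],
   [(-100,1218),(-806,-597),(396,-188),(1,138),(-33,-13),(6,-6)],
   [(84,39),(-79,52),(-4,-51),(18,7),(-4,4)],
   [(5,-5),(2,8),(-5,-1)]]"

lemma ray30_step10: "advance_ok 16777216 ray30_powers 4194304 ray30_p9 637990 13 ray30_p10 638026 712037 1893730 7"
  by code_simp

lemma ray30_cone: "cone_ok 16777216 ray30_powers ray30_p10 712037 (-1777888, 5075610) 3351446"
  by code_simp

lemma ray30_reached: "reached (cis (pi / 6)) 4194304 ray30_p10 712037"
proof -
  have pos: "Re (cis (pi / 6)) > 0" using cos_gt_zero[of "pi / 6"] by simp
  have "reached (cis (pi / 6)) 4194304 ray30_p0 2"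
    using reached_start[of 4194304 2656074 1] by (simp add: ray30_p0_def)
  note advance = reached_advance[OF _ _ ray30_powers zero_less_numeral norm_cis pos]
  note start = \<open>reached (cis (pi / 6)) 4194304 ray30_p0 2\<close>
  note r1 = advance[OF start ray30_step1]
  note r2 = advance[OF r1 ray30_step2]
  note r3 = advance[OF r2 ray30_step3]
  note r4 = advance[OF r3 ray30_step4]
  note r5 = advance[OF r4 ray30_step5]
  note r6 = advance[OF r5 ray30_step6]
  note r7 = advance[OF r6 ray30_step7]
  note r8 = advance[OF r7 ray30_step8]
  note r9 = advance[OF r8 ray30_step9]
  note r10 = advance[OF r9 ray30_step10]
  show ?thesis by (rule r10)
qed

section \<open>The path of angle pi/12\<close>

text \<open>
  The hardest case: the solution becomes large while the path passes the real blow-up time, about 0.47 in the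
  rescaled time, and the bound for the amplification of errors is about 5000. The steps shrink and grow in proportion to the distance to the singularity.
\<close>

definition ray15_powers :: gpoly where
  "ray15_powers = [(16777216,0),(16205546,4342263),(14529495,8388608),(11863283,11863283),(8388608,14529495),(4342263,16205546),
    (0,16777216),(-4342263,16205546),(-8388608,14529495),(-11863283,11863283),(-14529495,8388608),
    (-16205546,4342263),(-16777216,0),(-16205546,-4342263),(-14529495,-8388608)]"

lemma ray15_powers: "power_table (cis (pi / 12)) 16777216 ray15_powers"
proof -
  have "map (\<lambda>i. omega_table (1 * i)) [0..<15] = ray15_powers" by code_simp
  thus ?thesis using power_table_omega[of 1 15] by simp
qed

definition ray15_p0 :: "gpoly list" where
  "ray15_p0 = [[(2 * 42497185, 0)], [(- 42497185, 0)]]"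

definition ray15_p1 :: "gpoly list" where
  "ray15_p1 = [
   [(91955137,2022449),(7806574,329778),(635741,43832),(56248,5174),(4970,590),(452,65),(41,7),(4,1)],
   [(-45392180,-868943),(-3352617,-196087),(-377888,-27329),(-35052,-3561),(-3419,-420),(-322,-48),(-31,-5)],
   [(1122599,316351),(1220529,36048),(69318,10182),(13052,1240),(1189,178),(136,21),(14,3)],
   [(-25292,-14609),(-56331,-15325),(-29484,-649),(-823,-469),(-450,-35),(-26,-8),(-5,-1)],
   [(516,499),(1844,1018),(1967,486),(618,0),(0,20),(16,0)],
   [(-9,-15),(-49,-45),(-85,-43),(-56,-12),(-11,0)]]"

lemma ray15_step1: "advance_ok 16777216 ray15_powers 67108864 ray15_p0 18 24 ray15_p1 601 2806 403795367 94"
  by code_simp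

definition ray15_p2 :: "gpoly list" where
  "ray15_p2 = [
   [(107589104,7813203),(8736934,1273300),(702544,165768),(59876,19429),(5138,2173),(446,235),(39,25),(3,3)],
   [(-52416643,-3721069),(-4142721,-781655),(-429555,-109580),(-39365,-13836),(-3638,-1614),(-329,-181),
    (-30,-20)],
   [(3499706,1180101),(1309985,204106),(110421,41122),(14622,5541),(1434,728),(146,87),(14,10)],
   [(-205330,-130309),(-142474,-53202),(-28570,-8146),(-2809,-1675),(-427,-215),(-42,-30),(-5,-4)],
   [(10701,10963),(11354,7343),(3878,1732),(584,301),(74,57),(11,7)],
   [(-486,-799),(-744,-756),(-379,-263),(-87,-53),(-12,-10)],
   [(18,53),(41,65),(30,31),(10,8)],
   [(0,-3),(-2,-5)]]"

lemma ray15_step2: "advance_ok 16777216 ray15_powers 67108864 ray15_p1 2806 29 ray15_p2 2902 6155 486332055 47"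
  by code_simp

definition ray15_p3 :: "gpoly list" where
  "ray15_p3 = [
   [(124606529,16415666),(9875789,2721117),(780860,355634),(63536,41852),(5091,4659),(396,499),(29,52),(2,5)],
   [(-60662372,-8465372),(-5023621,-1734848),(-490801,-245668),(-43066,-30782),(-3662,-3566),(-295,-393),
    (-22,-42),(-1,-4)],
   [(6044473,2599340),(1517380,540289),(146106,97564),(16372,13479),(1506,1719),(131,203),(10,23)],
   [(-510597,-394207),(-218676,-131912),(-34044,-24774),(-3807,-4200),(-429,-579),(-39,-75),(-3,-9)],
   [(37028,46754),(23304,22434),(5328,5197),(715,965),(85,154),(8,22)],
   [(-2210,-4817),(-1977,-3054),(-622,-889),(-104,-186),(-13,-33),(-1,-5)],
   [(88,449),(128,358),(55,128),(11,31),(1,6)],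
   [(2,-39),(-4,-37),(-3,-16),(-1,-4)]]"

lemma ray15_step3: "advance_ok 16777216 ray15_powers 67108864 ray15_p2 6155 34 ray15_p3 6221 11769 584736768 40"
  by code_simp

definition ray15_p4 :: "gpoly list" where
  "ray15_p4 = [
   [(142726009,28960244),(10763328,4805404),(788490,619161),(55230,71078),(3329,7596),(128,767),(-6,73),(-2,7)],
   [(-69874652,-15936827),(-5738965,-3177410),(-501990,-442626),(-37318,-53637),(-2293,-5937),(-78,-615),(7,-60),
    (2,-6)],
   [(8763052,4993841),(1707515,1109570),(156420,186777),(13512,25012),(793,3003),(8,330),(-7,34)],
   [(-889777,-911257),(-273817,-282960),(-33785,-53490),(-2809,-8266),(-126,-1081),(15,-128),(5,-14)],
   [(72093,132122),(30792,54289),(4719,12092),(324,2091),(-17,303),(-11,38),(-2,4)],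
   [(-3843,-16597),(-2225,-8567),(-340,-2255),(17,-435),(17,-69),(5,-9)],
   [(-82,1870),(-13,1168),(-32,359),(-20,77),(-6,13)],
   [(62,-191),(40,-141),(17,-50),(6,-12)],
   [(-12,18),(-9,15),(-4,6)]]"

lemma ray15_step4: "advance_ok 16777216 ray15_powers 67108864 ray15_p3 11769 40 ray15_p4 11845 21693 697258302 38"
  by code_simp

definition ray15_p5 :: "gpoly list" where
  "ray15_p5 = [
   [(160618384,46336435),(10810824,7387249),(638480,892462),(25851,93526),(-743,8790),(-347,739),(-54,54),(-7,3)],
   [(-79116472,-26875298),(-5876489,-5035660),(-394559,-653437),(-14657,-71645),(990,-6920),(315,-590),(48,-43),
    (6,-2)],
   [(11318720,8769524),(1680424,1901276),(107488,288338),(1577,34504),(-1044,3537),(-223,311),(-32,22),(-4,1)],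
   [(-1211970,-1810445),(-250031,-511897),(-13051,-87876),(1962,-11694),(665,-1271),(119,-114),(17,-8)],
   [(82507,297923),(16532,105610),(-2179,20698),(-1281,3000),(-292,341),(-49,30),(-7,2)],
   [(2083,-41913),(2778,-17845),(1584,-3940),(473,-608),(98,-69),(16,-5)],
   [(-1998,5154),(-1287,2540),(-491,615),(-131,97),(-27,10)],
   [(454,-549),(302,-302),(112,-76),(30,-11),(6,-1)],
   [(-77,48),(-55,28),(-21,6),(-6,0)],
   [(11,-3),(9,-1)]]"

lemma ray15_step5: "advance_ok 16777216 ray15_powers 67108864 ray15_p4 21693 48 ray15_p5 21766 37970 815708815 35"
  by code_simp

definition ray15_p6 :: "gpoly list" where
  "ray15_p6 = [
   [(176407313,69130522),(10080750,10557540),(348353,1170700),(-20053,106019),(-6060,7715),(-827,375),(-85,-5),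
    (-7,-4)],
   [(-86937852,-41781352),(-5343329,-7353612),(-167000,-866730),(22450,-81014),(5373,-5926),(713,-271),(73,8),
    (6,4)],
   [(13042543,14203529),(1298329,2909725),(-14976,387777),(-19414,38210),(-3596,2752),(-457,92),(-46,-12),
    (-4,-3)],
   [(-1219597,-3175947),(-75671,-805791),(38843,-118056),(10904,-12036),(1780,-764),(219,7),(21,11)],
   [(-6396,558980),(-45445,168186),(-19519,26348),(-4312,2541),(-671,80),(-81,-25),(-7,-7)],
   [(33549,-81220),(20092,-27342),(6319,-4235),(1307,-275),(199,39),(23,16)],
   [(-9366,9590),(-5232,3290),(-1568,374),(-318,-43),(-47,-27),(-5,-7)],
   [(1832,-806),(1055,-194),(317,42),(63,33),(9,10)],
   [(-294,9),(-176,-35),(-53,-29),(-10,-11)],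
   [(40,15),(24,16),(7,8)],
   [(-5,-4),(-3,-4)]]"

lemma ray15_step6: "advance_ok 16777216 ray15_powers 67108864 ray15_p5 37970 56 ray15_p6 38053 65317 936725137 34"
  by code_simp

definition ray15_p7 :: "gpoly list" where
  "ray15_p7 = [
   [(187823769,97683224),(8015894,13985304),(-128683,1343859),(-78473,90109),(-10607,2489),(-934,-389),(-50,-81),
    (1,-9)],
   [(-91443164,-60859234),(-3699203,-9839720),(216607,-987069),(69869,-65733),(9017,-1330),(776,392),(39,74),
    (-1,8)],
   [(12930530,21312014),(308690,3938782),(-227369,422490),(-45795,25619),(-5488,-398),(-443,-347),(-17,-54),
    (2,-5)],
   [(-513279,-4948224),(345589,-1061894),(126411,-112396),(21390,-3969),(2386,941),(168,233),(1,31)],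
   [(-312516,870224),(-182505,199247),(-46925,16241),(-7292,-1394),(-736,-656),(-35,-117),(4,-14)],
   [(117683,-114917),(54958,-22457),(12849,1086),(1837,1226),(145,294),(-3,44),(-3,5)],
   [(-26978,8886),(-12197,-742),(-2670,-1514),(-319,-501),(-6,-98),(7,-13)],
   [(4754,665),(2090,1179),(395,560),(20,147),(-9,25),(-3,3)],
   [(-660,-449),(-257,-375),(-25,-144),(10,-33),(5,-5)],
   [(64,114),(12,83),(-8,29),(-5,6)],
   [(-1,-21),(5,-14),(4,-4)]]"

lemma ray15_step7: "advance_ok 16777216 ray15_powers 67108864 ray15_p6 65317 64 ray15_p7 65402 110462 1053726524 33"
  by code_simp

definition ray15_p8 :: "gpoly list" where
  "ray15_p8 = [
   [(191922294,131214610),(4276864,17111415),(-757719,1280314),(-128660,32856),(-10482,-6275),(-273,-1112),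
    (57,-92),(10,-2)],
   [(-90207820,-83314412),(-655226,-11968089),(721210,-896323),(108577,-14628),(8410,6223),(156,992),(-57,79),
    (-9,1)],
   [(9713500,29433672),(-1438768,4601467),(-495707,311419),(-63135,-10096),(-4186,-5232),(52,-685),(52,-47),
    (7,0)],
   [(1365010,-6728691),(1043840,-1071997),(223163,-30339),(24510,15081),(1037,3216),(-151,346),(-37,17),(-4,-1)],
   [(-944815,1056291),(-383485,115197),(-68557,-24235),(-5809,-9063),(160,-1411),(126,-120),(20,-1)],
   [(267226,-84056),(94953,22441),(13898,15545),(312,3513),(-282,436),(-66,22),(-8,-3)],
   [(-52284,-12556),(-16085,-15442),(-1160,-5371),(420,-960),(149,-84),(25,4)],
   [(7191,7097),(1286,4691),(-420,1293),(-231,174),(-52,0),(-7,-5)],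
   [(-457,-1811),(277,-986),(240,-212),(75,-9),(13,7)],
   [(-100,326),(-153,143),(-71,14),(-17,-7)],
   [(46,-41),(41,-9),(15,6),(3,4)],
   [(-11,2),(-8,-3)]]"

lemma ray15_step8: "advance_ok 16777216 ray15_powers 67108864 ray15_p7 110462 71 ray15_p8 110559 183742 1136115767 32"
  by code_simp

definition ray15_p9 :: "gpoly list" where
  "ray15_p9 = [
   [(185783382,167149363),(-1142567,18747905),(-1351104,826357),(-129134,-57836),(-2287,-12833),(876,-853),
    (114,24),(4,10)],
   [(-80932708,-106775171),(3701458,-12715028),(1171181,-470274),(101746,63065),(734,11382),(-854,684),
    (-101,-30),(-3,-10)],
   [(2378662,36888685),(-3750553,4257227),(-683740,-7614),(-46182,-58009),(1814,-7499),(722,-311),(68,40),(1,8)],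
   [(4612390,-7655189),(1827339,-553388),(246994,140999),(7378,35197),(-2580,3292),(-463,7),(-31,-39),(1,-5)],
   [(-1850854,796318),(-531382,-166260),(-46757,-88196),(4689,-13824),(1751,-746),(207,102),(6,26)],
   [(424225,97143),(89639,117891),(-3350,31015),(-4076,3239),(-749,-110),(-56,-84),(3,-12)],
   [(-59419,-69316),(-799,-36963),(5915,-6741),(1682,-128),(204,180),(1,39),(-4,4)],
   [(1274,18706),(-5074,7206),(-2360,545),(-437,-258),(-22,-87),(7,-12)],
   [(2061,-3179),(1927,-634),(573,245),(58,132),(-10,26),(-4,2)],
   [(-710,260),(-431,-145),(-78,-133),(8,-38),(7,-5)],
   [(143,43),(56,82),(-4,37),(-8,7)],
   [(-17,-24),(1,-21),(6,-6)],
   [(0,6),(-3,3)]]"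

lemma ray15_step9: "advance_ok 16777216 ray15_powers 67108864 ray15_p8 183742 77 ray15_p9 183838 300640 1213432115 31"
  by code_simp

definition ray15_p10 :: "gpoly list" where
  "ray15_p10 = [
   [(167791796,201163325),(-7462378,18197076),(-1668369,42629),(-62546,-136585),(9417,-10287),(1242,444),(7,126),
    (-11,5)],
   [(-62602544,-127361047),(8638232,-11433195),(1348429,227593),(35530,125140),(-9504,8042),(-1080,-525),
    (5,-116),(11,-4)],
   [(-8975264,41144058),(-5989836,2514747),(-634679,-460352),(10403,-84492),(8312,-3074),(655,623),(-29,87),
    (-9,1)],
   [(8698648,-6625648),(2266687,583871),(118465,328504),(-27368,34663),(-5079,-737),(-197,-533),(41,-45),(6,2)],
   [(-2641262,-198208),(-426090,-596353),(41100,-125068),(18532,-5238),(1863,1681),(-60,298),(-33,11),(-3,-3)],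
   [(422753,446406),(-21266,208414),(-37598,23281),(-6811,-2859),(-205,-1054),(104,-98),(17,5)],
   [(-1842,-138593),(41742,-37645),(13482,2241),(1173,2291),(-194,366),(-60,6),(-5,-6)],
   [(-20541,22665),(-14400,-136),(-2478,-3099),(201,-808),(137,-55),(19,13)],
   [(6619,-542),(2587,2448),(-72,1095),(-210,143),(-46,-16),(-2,-8)],
   [(-1113,-888),(-52,-855),(212,-201),(73,10),(8,14)],
   [(42,299),(-129,155),(-75,1),(-13,-16),(1,-5)],
   [(37,-52),(46,-6),(14,13),(0,6)],
   [(-13,3),(-9,-6),(0,-5)]]"

lemma ray15_step10: "advance_ok 16777216 ray15_powers 67108864 ray15_p9 300640 80 ray15_p10 300729 491798 1266957858 31"
  by code_simp

definition ray15_p11 :: "gpoly list" where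
  "ray15_p11 = [
   [(138716636,228228151),(-13342602,14926117),(-1483428,-842401),(47975,-146723),(14302,1721),(101,1366),
    (-127,35),(-6,-11)],
   [(-36460369,-140685940),(12849674,-7772816),(1062143,964608),(-64265,120580),(-12653,-3419),(63,-1266),
    (122,-19),(4,11)],
   [(-22499447,39731478),(-7126771,-552920),(-253863,-827438),(76571,-54688),(7715,6027),(-390,920),(-100,-16),
    (-1,-10)],
   [(12164519,-2991742),(1831660,2013122),(-158672,376652),(-51830,-775),(-1952,-5698),(532,-400),(57,42),(-3,7)],
   [(-2647040,-1809118),(65126,-898948),(150583,-63441),(17647,16306),(-1095,2939),(-380,1),(-14,-41),(4,-3)],
   [(90899,780931),(-215133,167061),(-53215,-23457),(-394,-9779),(1279,-636),(143,125),(-8,22)],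
   [(127372,-137165),(75794,14845),(5957,18067),(-2533,2580),(-554,-190),(-7,-85),(10,-5)],
   [(-43563,-2076),(-10282,-18198),(2967,-5032),(1238,51),(91,202),(-23,27),(-5,-1)],
   [(6043,7961),(-1897,5119),(-1681,302),(-252,-311),(31,-72),(13,-1)],
   [(510,-2203),(1306,-466),(371,305),(-22,121),(-25,8),(-3,-3)],
   [(-452,227),(-297,-175),(-1,-131),(32,-18),(7,4)],
   [(103,45),(13,83),(-26,23),(-10,-3)],
   [(-7,-24),(13,-15),(9,2)],
   [(-3,4),(-5,0)]]"

lemma ray15_step11: "advance_ok 16777216 ray15_powers 67108864 ray15_p10 491798 80 ray15_p11 491884 791553 1238151834 30"
  by code_simp

definition ray15_p12 :: "gpoly list" where
  "ray15_p12 = [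
   [(102190521,244111009),(-17317126,9539596),(-833524,-1465849),(132936,-75521),(6997,12460),(-1192,656),
    (-62,-116),(11,-6)],
   [(-6354999,-143414703),(15013171,-2453226),(380725,1402687),(-131169,43419),(-4522,-12445),(1197,-455),
    (45,116),(-11,4)],
   [(-34706930,31661990),(-6366652,-4024671),(319416,-859353),(97540,20882),(-1122,10293),(-1053,-38),(-2,-106),
    (11,-1)],
   [(13132449,2589973),(403442,2959802),(-416636,180200),(-33837,-46963),(4711,-4804),(595,444),(-40,68),(-8,-4)],
   [(-1416152,-3261368),(737229,-717862),(167734,88716),(-6226,27490),(-3697,-3),(-83,-441),(49,-17),(3,5)],
   [(-491314,759100),(-316996,-62169),(-10078,-69687),(10877,-5112),(1137,1356),(-143,189),(-27,-13)],
   [(223124,-376),(36456,87774),(-17572,16294),(-4055,-2243),(166,-742),(112,-4),(4,15)],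
   [(-29104,-45307),(15069,-22000),(7434,1779),(163,1646),(-276,118),(-30,-37),(4,-6)],
   [(-5386,11587),(-7212,-223),(-780,-2183),(429,-353),(93,59),(-5,19)],
   [(2968,-377),(966,1634),(-412,536),(-170,-53),(-1,-38),(7,-2)],
   [(-439,-536),(223,-434),(190,17),(15,53),(-10,7)],
   [(-51,151),(-123,10),(-24,-47),(11,-12),(4,2)],
   [(35,-8),(18,24),(-7,12),(-5,-1)],
   [(-6,-6),(3,-7)]]"

lemma ray15_step12: "advance_ok 16777216 ray15_powers 67108864 ray15_p11 791553 77 ray15_p12 791663 1233646 1119643010 28"
  by code_simp

definition ray15_p13 :: "gpoly list" where
  "ray15_p13 = [
   [(63658690,247228331),(-18538969,3431922),(-13431,-1594463),(141181,25822),(-4874,12380),(-1055,-681),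
    (84,-86),(6,10)],
   [(22459271,-134954469),(14501681,3061147),(-386241,1352207),(-121610,-52008),(6663,-10630),(894,802),(-92,71),
    (-5,-10)],
   [(-41947583,18484768),(-3771919,-6540554),(772660,-501358),(52701,84624),(-9051,4804),(-386,-955),(99,-26),
    (1,10)],
   [(10609484,8045311),(-1405494,2728217),(-442894,-163346),(17350,-57814),(6713,1936),(-234,727),(-75,-30),
    (4,-7)],
   [(644817,-3542266),(1079405,-28615),(38266,199352),(-29066,9091),(-1453,-3731),(446,-188),(21,51),(-6,2)],
   [(-897657,246541),(-163586,-304177),(59890,-48599),(9855,9036),(-1177,1600),(-225,-142),(17,-29)],
   [(150974,177839),(-60902,83499),(-24401,-11060),(1338,-5112),(872,106),(-2,130),(-18,1)],
   [(24275,-51716),(28895,5703),(182,8700),(-1886,395),(-126,-332),(51,-27),(5,7)],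
   [(-13745,-220),(-1867,-7869),(2409,-1183),(401,524),(-91,98),(-19,-13)],
   [(1280,3001),(-1710,1315),(-615,-503),(99,-190),(45,14),(-1,9)],
   [(522,-560),(494,268),(-59,220),(-67,-3),(-2,-16)],
   [(-168,-59),(11,-143),(63,-10),(7,19),(-4,3)],
   [(3,41),(-34,12),(-9,-15),(4,-4)],
   [(8,-4),(6,7),(-3,4)]]"

lemma ray15_step13: "advance_ok 16777216 ray15_powers 67108864 ray15_p12 1233646 72 ray15_p13 1233740 1922532 1041543979 28"
  by code_simp

definition ray15_p14 :: "gpoly list" where
  "ray15_p14 = [
   [(27802682,238940265),(-17774572,-1997381),(675961,-1368519),(94740,101549),(-12040,4875),(-17,-1236),
    (112,42),(-8,9)],
   [(45733512,-117410287),(12128114,7588844),(-971665,973822),(-62212,-114527),(12267,-2161),(-199,1185),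
    (-102,-58),(9,-7)],
   [(-42296367,3571680),(-345861,-7396172),(927421,37100),(-20613,100019),(-9660,-4367),(681,-830),(60,89),
    (-10,3)],
   [(5375714,11089798),(-2687820,1398389),(-217959,-433430),(58990,-24304),(1937,7273),(-831,69),(12,-88),(9,3)],
   [(2376133,-2323150),(791932,715477),(-137010,160082),(-24475,-21865),(3176,-3101),(337,432),(-56,31),(-2,-7)],
   [(-751424,-408012),(137923,-311389),(75017,28752),(-5043,13657),(-2081,-833),(133,-279),(34,20),(-3,4)],
   [(-44799,208155),(-100691,-12195),(1516,-27843),(5777,117),(-19,1001),(-153,-8),(2,-21)],
   [(51649,-3356),(4668,28338),(-8767,2141),(-599,-2020),(387,-124),(20,66),(-10,3)],
   [(-4074,-11661),(7085,-3327),(1381,2399),(-601,395),(-88,-125),(23,-17),(3,4)],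
   [(-2392,1649),(-1349,-1571),(568,-583),(177,151),(-33,43),(-9,-6)],
   [(516,436),(-299,443),(-203,-111),(30,-66),(17,7),(-1,4)],
   [(66,-141),(128,44),(-15,62),(-21,-3),(1,-6)],
   [(-35,-6),(2,-34),(17,-1),(1,6)],
   [(1,8),(-8,2),(-1,-4)]]"

lemma ray15_step14: "advance_ok 16777216 ray15_powers 67108864 ray15_p13 1922532 64 ray15_p14 1922632 2996030 912250951 28"
  by code_simp

definition ray15_p15 :: "gpoly list" where
  "ray15_p15 = [
   [(-2264539,222248774),(-15307084,-6043532),(1076926,-895433),(22862,125502),(-11235,-3931),(855,-735),
    (20,107),(-10,-4)],
   [(61013042,-94365625),(8418770,10340904),(-1221437,411261),(12959,-120963),(9712,6328),(-976,539),(0,-108),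
    (9,5)],
   [(-36132975,-9298295),(2813703,-6307296),(718397,520700),(-78049,60247),(-3085,-9776),(1032,96),(-52,90),
    (-6,-9)],
   [(-373117,10589763),(-2760952,-383638),(125031,-447542),(56027,28123),(-4924,5661),(-440,-712),(88,-19),
    (-2,9)],
   [(2761415,-363564),(58155,959494),(-199420,-7007),(5591,-31760),(4191,1576),(-313,468),(-43,-50),(7,-3)],
   [(-186394,-671302),(291859,-64633),(10725,73839),(-14129,521),(242,-2242),(306,91),(-20,36),(-4,-3)],
   [(-155319,64895),(-29903,-81174),(24197,-7288),(1121,5390),(-991,87),(10,-157),(22,5)],
   [(19411,34573),(-21127,10864),(-3266,-7254),(1842,-670),(97,384),(-69,8),(0,-11)],
   [(7447,-5334),(3484,5215),(-2028,1224),(-299,-579),(135,-55),(8,27),(-5,1)],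
   [(-1387,-1557),(1230,-1032),(412,535),(-170,115),(-25,-44),(10,-4)],
   [(-316,346),(-289,-279),(134,-129),(40,47),(-13,10)],
   [(84,62),(-61,77),(-38,-32),(12,-13),(4,4)],
   [(12,-20),(20,13),(-7,11),(-4,-3)],
   [(-5,-2),(3,-5)]]"

lemma ray15_step15: "advance_ok 16777216 ray15_powers 67108864 ray15_p14 2996030 56 ray15_p15 2996116 4594470 763366249 27"
  by code_simp

definition ray15_p16 :: "gpoly list" where
  "ray15_p16 = [
   [(-25182850,200744416),(-12270825,-8492832),(1197707,-407873),(-36090,110061),(-6190,-8847),(1017,45),
    (-63,74),(-2,-9)],
   [(67824293,-69756580),(4518426,11320525),(-1184662,-104465),(66797,-89696),(3476,10056),(-982,-286),(78,-61),
    (0,10)],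
   [(-25849988,-17369059),(4757403,-3982420),(311910,764279),(-93224,131),(4299,-8742),(557,812),(-98,5),(5,-8)],
   [(-4311218,7265196),(-1755801,-1654573),(355645,-230874),(16664,56891),(-7243,-461),(368,-732),(54,70),(-9,2)],
   [(1815205,1078020),(-527192,594030),(-104974,-140811),(27439,-11611),(501,4263),(-542,-116),(36,-56),(4,6)],
   [(267775,-422673),(173363,157953),(-50100,37793),(-5294,-11418),(2065,-395),(-28,308),(-38,-16),(4,-4)],
   [(-93717,-65404),(44934,-45904),(11756,16424),(-4265,1934),(-181,-874),(148,7),(-7,21)],
   [(-15643,20023),(-11326,-12221),(5040,-3296),(609,1464),(-333,64),(3,-63),(10,3)],
   [(4151,3663),(-3198,2645),(-853,-1465),(469,-171),(18,117),(-24,-1),(1,-4)],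
   [(841,-839),(590,809),(-407,206),(-43,-142),(39,-4),(-1,9)],
   [(-166,-189),(199,-126),(47,109),(-41,10),(-1,-12)],
   [(-42,32),(-26,-48),(28,-10),(2,11)],
   [(6,9),(-11,5),(-2,-7)]]"

lemma ray15_step16: "advance_ok 16777216 ray15_powers 67108864 ray15_p15 4594470 48 ray15_p16 4594573 6714976 596006975 24"
  by code_simp

definition ray15_p17 :: "gpoly list" where
  "ray15_p17 = [
   [(-41404197,177270776),(-9425804,-9721093),(1151629,-13124),(-73660,79000),(-774,-10205),(750,612),(-93,10),
    (6,-7)],
   [(67288461,-46460681),(1061934,11032146),(-997648,-489628),(93979,-46971),(-2464,9795),(-558,-815),(96,13),
    (-7,6)],
   [(-14522386,-19851643),(5253838,-1330545),(-111963,757516),(-73443,-51375),(8731,-3882),(-182,962),(-67,-73),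
    (10,-1)],
   [(-5395285,3056586),(-371863,-1939709),(371912,53152),(-27403,48548),(-4207,-5758),(822,-124),(-34,85),
    (-6,-8)],
   [(474072,1351035),(-602460,23182),(37963,-140750),(22094,14829),(-3325,2350),(-115,-540),(67,16),(-5,6)],
   [(309648,-40289),(-25513,162110),(-43631,-20719),(7150,-7703),(889,1661),(-292,38),(11,-40),(4,3)],
   [(6195,-65171),(38451,15045),(-8702,11391),(-2125,-2937),(709,-230),(-3,132),(-20,-8)],
   [(-12629,-4298),(5561,-8094),(2512,3020),(-1039,450),(-29,-262),(51,11),(-5,8)],
   [(-1429,2245),(-1498,-1665),(909,-451),(59,323),(-84,-9),(8,-17)],
   [(361,378),(-436,234),(-55,-244),(90,5),(-9,24),(-5,-4)],
   [(88,-50),(26,103),(-60,-1),(7,-22),(6,4)],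
   [(-5,-19),(22,0),(-4,13),(-5,-3)],
   [(-4,0),(1,-5)]]"

lemma ray15_step17: "advance_ok 16777216 ray15_powers 67108864 ray15_p16 6714976 40 ray15_p17 6715058 9658370 459985192 23"
  by code_simp

definition ray15_p18 :: "gpoly list" where
  "ray15_p18 = [
   [(-52053815,153805008),(-6959798,-9987649),(986780,260445),(-89480,41528),(3647,-8938),(316,856),(-75,-43),
    (8,-1)],
   [(61089458,-26400214),(-1727234,9736907),(-726091,-727386),(96563,-5998),(-6332,6779),(8,-929),(64,68),
    (-9,-1)],
   [(-4890073,-17573012),(4416361,913526),(-426955,537778),(-31198,-78081),(8930,1990),(-738,589),(6,-96),(7,7)],
   [(-4135812,-124221),(652640,-1338691),(201027,237284),(-47882,12917),(1466,-6532),(587,558),(-89,20),(4,-9)],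
   [(-330749,786799),(-284251,-291664),(101283,-40548),(-523,21687),(-3201,-1570),(409,-309),(9,66),(-7,-3)],
   [(115687,118380),(-91473,37037),(-102,-32346),(7159,2907),(-1070,1055),(-86,-237),(38,4),(-3,4)],
   [(28815,-10819),(-533,22026),(-7867,-3335),(1680,-1692),(206,494),(-103,-2),(8,-16)],
   [(356,-5544),(4191,1995),(-1518,1421),(-243,-617),(169,2),(-15,34),(-5,-5)],
   [(-865,-464),(717,-604),(153,451),(-171,-8),(20,-44),(8,9)],
   [(-136,103),(-49,-177),(103,11),(-19,37),(-9,-10)],
   [(6,29),(-34,-6),(11,-19),(6,8)],
   [(5,1),(-4,5),(-3,-4)]]"

lemma ray15_step18: "advance_ok 16777216 ray15_powers 67108864 ray15_p17 9658370 33 ray15_p18 9658475 13242454 329444876 20"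
  by code_simp

definition ray15_p19 :: "gpoly list" where
  "ray15_p19 = [
   [(-58404758,131914843),(-4938525,-9427217),(738176,369137),(-78473,6860),(5828,-5530),(-65,756),(-37,-56),
    (5,2)],
   [(51290102,-10988533),(-3577557,7601179),(-417339,-791172),(78325,21055),(-6605,2901),(366,-603),(9,72),
    (-5,-5)],
   [(1233012,-12591739),(2723840,2108353),(-517907,207051),(12429,-69428),(5340,5502),(-762,43),(51,-54),(0,7)],
   [(-2064733,-1394759),(888744,-442079),(-6798,223655),(-32612,-19041),(4608,-2613),(-36,651),(-57,-46),(8,-2)],
   [(-405810,176429),(19962,-233277),(57703,36326),(-12496,7374),(-110,-2515),(336,171),(-43,27),(0,-6)],
   [(-13713,72239),(-37999,-30357),(15843,-7192),(-184,4472),(-807,-457),(138,-88),(1,26)],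
   [(8141,8386),(-8898,2642),(704,-3875),(950,713),(-256,127),(1,-58),(9,5)],
   [(1781,-270),(-540,1580),(-573,-586),(270,-87),(-12,77),(-15,-10)],
   [(124,-241),(167,234),(-159,24),(19,-60),(14,13),(-5,2)],
   [(-18,-36),(48,0),(-14,27),(-8,-10),(4,-1)],
   [(-6,-1),(5,-6),(2,5)]]"

lemma ray15_step19: "advance_ok 16777216 ray15_powers 67108864 ray15_p18 13242454 28 ray15_p19 13242531 17037341 205254495 16"
  by code_simp

definition ray15_p20 :: "gpoly list" where
  "ray15_p20 = [
   [(-61842168,111782416),(-3620054,-9074731),(591241,384628),(-61668,-12692),(6829,-2210),(-404,661),(-15,-70),
    (4,4)],
   [(39763246,-482325),(-4672254,5444971),(-155266,-818426),(67081,39939),(-6340,1021),(446,-326),(-29,53),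
    (-1,-7)],
   [(3715304,-7198911),(1094542,2280593),(-452772,-69544),(43061,-46616),(1476,7223),(-661,-350),(66,-20),(-4,5)],
   [(-509482,-1227149),(595482,128167),(-109427,109823),(-6583,-28344),(4228,1482),(-476,359),(-1,-70),(6,5)],
   [(-180731,-72168),(97774,-67196),(1575,39168),(-8162,-4547),(1564,-886),(-12,295),(-35,-25),(5,-2)],
   [(-24575,10020),(3906,-19851),(6004,5635),(-2297,637),(147,-530),(74,78),(-18,4)],
   [(-1441,3140),(-1687,-2675),(1529,-5),(-269,446),(-65,-124),(32,2),(-4,5)],
   [(136,414),(-450,-119),(190,-178),(21,100),(-30,-10),(6,-5)],
   [(47,26),(-58,31),(3,-42),(15,11),(-6,2)],
   [(6,-1),(-3,8),(-4,-5)]]"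

lemma ray15_step20: "advance_ok 16777216 ray15_powers 67108864 ray15_p19 17037341 23 ray15_p20 17037408 20251244 102334997 11"
  by code_simp

definition ray15_p21 :: "gpoly list" where
  "ray15_p21 = [
   [(-63090842,93397614),(-2366964,-8369599),(480228,331895),(-37118,-11171),(4193,548),(-496,227),(22,-56),
    (3,5)],
   [(28420125,5249376),(-4649264,3091192),(91950,-679083),(44738,50267),(-5484,-155),(296,-212),(-17,17)],
   [(3588784,-3126881),(-29366,1615967),(-240061,-201037),(44788,-10280),(-2278,5155),(-287,-525),(54,11),(-4,2)],
   [(118873,-610532),(196035,241318),(-85121,2140),(9703,-13991),(940,2614),(-376,-105),(38,-30),(0,5)],
   [(-27654,-66216),(45825,13469),(-13729,10096),(-23,-4346),(729,509),(-145,53),(6,-23)],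
   [(-6263,-4431),(6139,-1763),(-1019,2622),(-471,-736),(215,10),(-27,35),(-2,-8)],
   [(-780,-53),(527,-577),(73,403),(-135,-66),(38,-20),(-1,10)],
   [(-69,35),(18,-88),(36,41),(-23,2),(4,-7)],
   [(-4,6),(-3,-9),(7,2)]]"

lemma ray15_step21: "advance_ok 16777216 ray15_powers 67108864 ray15_p20 20251244 20 ray15_p21 20251303 22247839 36350273 6"
  by code_simp

definition ray15_p22 :: "gpoly list" where
  "ray15_p22 = [
   [(-62492862,78220565),(-1087596,-6549215),(305278,232868),(-17797,-2020),(918,249),(-124,-22),(13,-7)],
   [(19628272,7098762),(-3382316,1206896),(167716,-352782),(12949,31895),(-2445,-862),(143,-80),(-2,7)],
   [(2527465,-1034141),(-345970,762816),(-54694,-134348),(17893,6144),(-1768,1077),(26,-197),(12,12)],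
   [(181496,-212426),(10967,126088),(-24763,-18867),(5428,-1171),(-367,717),(-42,-92),(11,3)],
   [(7497,-23790),(7250,13211),(-4716,-1109),(892,-654),(-11,201),(-23,-21),(4,-1)],
   [(-145,-2050),(1201,986),(-611,92),(92,-146),(12,36),(-7,-3)],
   [(-68,-146),(139,46),(-60,34),(5,-22),(4,5)],
   [(-9,-9),(13,-1),(-5,5)]]"

lemma ray15_step22: "advance_ok 16777216 ray15_powers 67108864 ray15_p21 22247839 21 ray15_p22 22247887 23317190 0 3"
  by code_simp

lemma ray15_cone: "cone_ok 16777216 ray15_powers ray15_p22 23317190 (-61711309, 71954122) 68238375"
  by code_simp

lemma ray15_reached: "reached (cis (pi / 12)) 67108864 ray15_p22 23317190"
proof -
  have pos: "Re (cis (pi / 12)) > 0" using cos_gt_zero[of "pi / 12"] by simp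
  have "reached (cis (pi / 12)) 67108864 ray15_p0 18"
    using reached_start[of 67108864 42497185 9] by (simp add: ray15_p0_def)
  note advance = reached_advance[OF _ _ ray15_powers zero_less_numeral norm_cis pos]
  note start = \<open>reached (cis (pi / 12)) 67108864 ray15_p0 18\<close>
  note r1 = advance[OF start ray15_step1]
  note r2 = advance[OF r1 ray15_step2]
  note r3 = advance[OF r2 ray15_step3]
  note r4 = advance[OF r3 ray15_step4]
  note r5 = advance[OF r4 ray15_step5]
  note r6 = advance[OF r5 ray15_step6]
  note r7 = advance[OF r6 ray15_step7]
  note r8 = advance[OF r7 ray15_step8]
  note r9 = advance[OF r8 ray15_step9]
  note r10 = advance[OF r9 ray15_step10]
  note r11 = advance[OF r10 ray15_step11]
  note r12 = advance[OF r11 ray15_step12]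
  note r13 = advance[OF r12 ray15_step13]
  note r14 = advance[OF r13 ray15_step14]
  note r15 = advance[OF r14 ray15_step15]
  note r16 = advance[OF r15 ray15_step16]
  note r17 = advance[OF r16 ray15_step17]
  note r18 = advance[OF r17 ray15_step18]
  note r19 = advance[OF r18 ray15_step19]
  note r20 = advance[OF r19 ray15_step20]
  note r21 = advance[OF r20 ray15_step21]
  note r22 = advance[OF r21 ray15_step22]
  show ?thesis by (rule r22)
qed

section \<open>Global existence, uniqueness and decay\<close>

theorem theorem1p2:
  fixes \<theta> :: real
  assumes "\<theta> \<in> {pi / 3, pi / 4, pi / 6, pi / 12}"
  shows "\<exists>(u :: real \<Rightarrow> real \<Rightarrow> complex) (a :: real \<Rightarrow> int \<Rightarrow> complex).
           heat_solution \<theta> initial_data {0..} u \<and>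
           (\<forall>T>0. \<forall>v. heat_solution \<theta> initial_data {0..T} v \<longrightarrow>
                (\<forall>t\<in>{0..T}. \<forall>x. v t x = u t x)) \<and>
           (\<forall>t\<ge>0. has_fourier_series (u t) (a t)) \<and>
           ((\<lambda>t. l1_norm (a t)) \<longlongrightarrow> 0) at_top"
proof -
  consider "\<theta> = pi / 3" | "\<theta> = pi / 4" | "\<theta> = pi / 6" | "\<theta> = pi / 12" using assms by auto
  thus ?thesis
  proof cases
    case 1 show ?thesis
      unfolding 1 by (rule global_solution_of_reached[OF ray60_reached ray60_cone ray60_powers]) (simp_all add: cos_gt_zero)
  next
    case 2 show ?thesis
      unfolding 2 by (rule global_solution_of_reached[OF ray45_reached ray45_cone ray45_powers]) (simp_all add: cos_gt_zero)
  next
    case 3 show ?thesis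
      unfolding 3 by (rule global_solution_of_reached[OF ray30_reached ray30_cone ray30_powers]) (simp_all add: cos_gt_zero)
  next
    case 4 show ?thesis
      unfolding 4 by (rule global_solution_of_reached[OF ray15_reached ray15_cone ray15_powers]) (simp_all add: cos_gt_zero)
  qed
qed

end
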